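(* Let $T_1,\dots,T_N\in\mathfrak G\cup\mathfrak B$ be a finite collection of good and bad maps with $\Sigma_G\neq\emptyset$ and $\Sigma_B\neq\emptyset$, let $\Sigma=\{1,\dots,N\}$, and let $\mathbf p=(p_j)_{j\in\Sigma}$ be a positive probability vector. Let $\mu_{\mathbf p}$ be the unique (up to scalar multiplication) $\sigma$-finite stationary measure for the associated random map $F$ that is absolutely continuous with respect to Lebesgue measure $\lambda$. Set $\theta=\sum_{b\in\Sigma_B}p_b\ell_b$. Then $\mu_{\mathbf p}$ is finite if and only if $\theta<1$. In this case, there exists a constant $C>0$ such that $$\mu_{\mathbf p}(A)\le C\cdot\sum_{k=0}^\infty\theta^k\lambda(A)^{\ell_{\max}^{-k}r_{\max}^{-1}}$$ for any Borel set $A\subseteq[0,1]$, where $r_{\max}=\max\{r_g:g\in\Sigma_G\}$ and $\ell_{\max}=\max\{\ell_b:b\in\Sigma_B\}$.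
   Context: Fix $c\in(0,1)$. $D$ denotes the derivative (one-sided at $0$ and $1$). The Schwarzian derivative is $\mathbf ST=\frac{D^3T}{DT}-\frac32\big(\frac{D^2T}{DT}\big)^2$; $T$ has non-positive Schwarzian derivative on an interval if $DT\ne0$ and $\mathbf ST\le0$ there. The class $\mathfrak G$ of good maps consists of the maps $T_g:[0,1]\to[0,1]$ such that (G1) $T_g|_{(0,c)}$ and $T_g|_{(c,1)}$ are $C^3$ diffeomorphisms onto $(0,1)$ and $T_g(\{0,c,1\})\subseteq\{0,1\}$; (G2) $T_g$ has non-positive Schwarzian derivative on $[0,c)$ and $(c,1]$; (G3) there are associated constants $r_g\ge1$, $0<K_g<1$, $M_g>r_g$ with $K_g|x-c|^{r_g-1}\le|DT_g(x)|\le M_g|x-c|^{r_g-1}$ for all $x\in[0,1]\setminus\{c\}$; (G4) $|DT_g(0)|,|DT_g(1)|>1$. The class $\mathfrak B$ of bad maps consists of the maps $T_b:[0,1]\to[0,1]$ such that (B1) $T_b|_{(0,c)}$ and $T_b|_{(c,1)}$ are $C^3$ diffeomorphisms, each onto $(0,c)$ or $(c,1)$, $T_b(\{0,1\})\subseteq\{0,1\}$ and $T_b(c)=c$; (B2) $T_b$ has non-positive Schwarzian derivative on $[0,c)$ and $(c,1]$; (B3) there are associated constants $\ell_b>1$, $0<K_b<1$, $M_b>\ell_b$ with $K_b|x-c|^{\ell_b-1}\le|DT_b(x)|\le M_b|x-c|^{\ell_b-1}$ for all $x\in[0,1]\setminus\{c\}$; (B4) $|DT_b(0)|,|DT_b(1)|>1$.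 For $T_1,\dots,T_N\in\mathfrak G\cup\mathfrak B$ put $\Sigma=\{1,\dots,N\}$, $\Sigma_G=\{j:T_j\in\mathfrak G\}$, $\Sigma_B=\{j:T_j\in\mathfrak B\}$. The random map (skew product) is $F:\Sigma^{\mathbb N}\times[0,1]\to\Sigma^{\mathbb N}\times[0,1]$, $F(\omega,x)=(\sigma\omega,T_{\omega_1}(x))$, with $\sigma$ the left shift. A Borel measure $\mu$ on $[0,1]$ is stationary for $F$ if $\sum_{j\in\Sigma}p_j\mu(T_j^{-1}A)=\mu(A)$ for all Borel $A\subseteq[0,1]$. A probability vector is positive if all its entries are positive. It is a fact (another theorem of the paper) that an absolutely continuous $\sigma$-finite stationary measure $\mu_{\mathbf p}$ exists and is unique up to scalar multiplication. *)

theory Defs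
  imports "HOL-Analysis.Analysis"
begin

text \<open>Derivative relative to \<open>[0,1]\<close>: the ordinary derivative at interior points and the
  one-sided derivative at the endpoints.\<close>

definition der :: "(real \<Rightarrow> real) \<Rightarrow> real \<Rightarrow> real" where
  "der f x = vector_derivative f (at x within {0..1})"

text \<open>The next two notions are meant for sets \<open>S\<close> that are relatively open in \<open>[0,1]\<close>; there
  differentiability within \<open>S\<close> agrees with differentiability within \<open>[0,1]\<close>, and \<open>der\<close> iterates
  correctly.\<close>

definition diff3_on :: "(real \<Rightarrow> real) \<Rightarrow> real set \<Rightarrow> bool" where
  "diff3_on f S \<longleftrightarrow> (\<forall>k<3. (der ^^ k) f differentiable_on S)"

definition C3_on :: "(real \<Rightarrow> real) \<Rightarrow> real set \<Rightarrow> bool" where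
  "C3_on f S \<longleftrightarrow> diff3_on f S \<and> continuous_on S ((der ^^ 3) f)"

definition C3_diffeo :: "(real \<Rightarrow> real) \<Rightarrow> real set \<Rightarrow> real set \<Rightarrow> bool" where
  "C3_diffeo f S S' \<longleftrightarrow> bij_betw f S S' \<and> C3_on f S \<and> C3_on (inv_into S f) S'"

definition schwarzian :: "(real \<Rightarrow> real) \<Rightarrow> real \<Rightarrow> real" where
  "schwarzian f x =
     (der ^^ 3) f x / der f x - 3/2 * ((der ^^ 2) f x / der f x)\<^sup>2"

text \<open>Existence of the derivatives entering the Schwarzian is part of the condition; on
  \<open>[0,c)\<close> and \<open>(c,1]\<close> this includes the one-sided derivatives at \<open>0\<close> and \<open>1\<close>.\<close>

definition nonpos_schwarzian_on :: "(real \<Rightarrow> real) \<Rightarrow> real set \<Rightarrow> bool" where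
  "nonpos_schwarzian_on f S \<longleftrightarrow>
     diff3_on f S \<and> (\<forall>x\<in>S. der f x \<noteq> 0 \<and> schwarzian f x \<le> 0)"

definition derivative_bounds ::
  "real \<Rightarrow> (real \<Rightarrow> real) \<Rightarrow> real \<Rightarrow> real \<Rightarrow> real \<Rightarrow> bool" where
  "derivative_bounds c f e K M \<longleftrightarrow>
     (\<forall>x\<in>{0..1} - {c}. K * \<bar>x - c\<bar> powr (e - 1) \<le> \<bar>der f x\<bar> \<and>
                      \<bar>der f x\<bar> \<le> M * \<bar>x - c\<bar> powr (e - 1))"

text \<open>\<open>good_exponent c f r\<close> and \<open>bad_exponent c f l\<close> say that \<open>r\<close> and \<open>l\<close> are the associated
  constants \<open>r\<^sub>g\<close> and \<open>\<ell>\<^sub>b\<close>; letting \<open>x\<close> tend to \<open>c\<close> shows that they are determined by \<open>f\<close>.\<close>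

definition good_exponent :: "real \<Rightarrow> (real \<Rightarrow> real) \<Rightarrow> real \<Rightarrow> bool" where
  "good_exponent c f r \<longleftrightarrow>
     1 \<le> r \<and> (\<exists>K M. 0 < K \<and> K < 1 \<and> r < M \<and> derivative_bounds c f r K M)"

definition bad_exponent :: "real \<Rightarrow> (real \<Rightarrow> real) \<Rightarrow> real \<Rightarrow> bool" where
  "bad_exponent c f l \<longleftrightarrow>
     1 < l \<and> (\<exists>K M. 0 < K \<and> K < 1 \<and> l < M \<and> derivative_bounds c f l K M)"

definition good_map :: "real \<Rightarrow> (real \<Rightarrow> real) \<Rightarrow> bool" where
  "good_map c f \<longleftrightarrow>
     f ` {0..1} \<subseteq> {0..1} \<and>
     C3_diffeo f {0<..<c} {0<..<1} \<and> C3_diffeo f {c<..<1} {0<..<1} \<and>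
     f ` {0, c, 1} \<subseteq> {0, 1} \<and>
     nonpos_schwarzian_on f {0..<c} \<and> nonpos_schwarzian_on f {c<..1} \<and>
     (\<exists>r. good_exponent c f r) \<and>
     \<bar>der f 0\<bar> > 1 \<and> \<bar>der f 1\<bar> > 1"

definition bad_map :: "real \<Rightarrow> (real \<Rightarrow> real) \<Rightarrow> bool" where
  "bad_map c f \<longleftrightarrow>
     f ` {0..1} \<subseteq> {0..1} \<and>
     (C3_diffeo f {0<..<c} {0<..<c} \<or> C3_diffeo f {0<..<c} {c<..<1}) \<and>
     (C3_diffeo f {c<..<1} {0<..<c} \<or> C3_diffeo f {c<..<1} {c<..<1}) \<and>
     f ` {0, 1} \<subseteq> {0, 1} \<and> f c = c \<and>
     nonpos_schwarzian_on f {0..<c} \<and> nonpos_schwarzian_on f {c<..1} \<and>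
     (\<exists>l. bad_exponent c f l) \<and>
     \<bar>der f 0\<bar> > 1 \<and> \<bar>der f 1\<bar> > 1"

definition borel_measure_on_unit :: "real measure \<Rightarrow> bool" where
  "borel_measure_on_unit \<mu> \<longleftrightarrow>
     space \<mu> = {0..1} \<and> sets \<mu> = sets (restrict_space borel {0..1})"

text \<open>Stationarity for the random map that applies \<open>T j\<close> with probability \<open>p j\<close>
  (independently at each step), \<open>j \<in> J\<close>.\<close>

definition stationary ::
  "'i set \<Rightarrow> ('i \<Rightarrow> real) \<Rightarrow> ('i \<Rightarrow> real \<Rightarrow> real) \<Rightarrow> real measure \<Rightarrow> bool" where
  "stationary J p T \<mu> \<longleftrightarrow>
     borel_measure_on_unit \<mu> \<and>
     (\<forall>A\<in>sets \<mu>. (\<Sum>j\<in>J. ennreal (p j) * emeasure \<mu> (T j -` A \<inter> {0..1})) = emeasure \<mu> A)"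

text \<open>The zero measure is excluded: ``unique up to scalar multiplication'' refers to
  nonzero measures.\<close>

definition acs_measure ::
  "'i set \<Rightarrow> ('i \<Rightarrow> real) \<Rightarrow> ('i \<Rightarrow> real \<Rightarrow> real) \<Rightarrow> real measure \<Rightarrow> bool" where
  "acs_measure J p T \<mu> \<longleftrightarrow>
     stationary J p T \<mu> \<and> sigma_finite_measure \<mu> \<and>
     absolutely_continuous (restrict_space lborel {0..1}) \<mu> \<and>
     emeasure \<mu> {0..1} \<noteq> 0"

end

theory Submission
  imports Defs
begin

text \<open>
  Non-positive Schwarzian derivative means that the derivative \<open>w\<close> of an inverse branch is of the
  form \<open>v\<^sup>-\<^sup>2\<close> with \<open>v\<close> concave. Sums of such functions form a cone that is stable under the transfer
  operator \<open>P\<close> of the random system, and the values of a member of the cone at any two points of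
  \<open>[a+\<epsilon>, b-\<epsilon>]\<close> are comparable with a constant depending only on \<open>\<epsilon>\<close>.

  Along an orbit of a single good map this distortion bound shrinks the images of the middle of
  \<open>[0,1]\<close> under inverse branches to points, and a Vitali covering argument shows that an invariant
  density that does not vanish almost everywhere is positive almost everywhere.

  If \<open>\<mu>\<close> is finite, comparing \<open>-ln dist(x,{0,1})\<close> with its average after one step shows that
  \<open>V = -ln \<bar>x-c\<bar>\<close> is integrable. A bad map multiplies \<open>V\<close> by about \<open>\<ell>\<^sub>b\<close>, so \<open>\<theta> \<ge> 1\<close> would be
  incompatible with stationarity and \<open>\<mu>(V > K) > 0\<close>.

  If \<open>\<theta> < 1\<close>, the densities \<open>P\<^sup>n 1\<close> are bounded away from \<open>0\<close>, \<open>c\<close>, \<open>1\<close> by the cone property; near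
  \<open>c\<close> and then near \<open>0\<close>, \<open>1\<close> the mass of a set is controlled recursively in terms of its Lebesgue
  measure, which gives the asserted series. A lower limit of Cesaro means is a finite invariant density
  \<open>k > 0\<close>. For an arbitrary stationary density \<open>h\<close> the functions \<open>min(h, t k)\<close> are again invariant,
  and full support of their differences forces \<open>h \<le> s k\<close> for some \<open>s\<close>.
\<close>

subsection \<open>Positive concave functions and distortion\<close>

text \<open>No bound on a given stationary density is available in advance, and no ergodicity is
  established. Quantitative estimates are therefore made only for the iterates of the constant
  density 1, whose total mass stays 1, and reach \<mu> by domination at the very end; positivity
  almost everywhere is the one qualitative fact that this needs.

  Why a bad map counts with weight \<open>p b * l b\<close> and not \<open>p b\<close>: near
  \<open>c\<close>, a chain of bad maps b1, ..., bk turns a set of measure s into a preimage of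
  measure about s powr a, where 1/a is the product of the exponents \<open>l b\<close>, and it has
  the product of the \<open>p b\<close> as probability. A set near 0 or 1 collects such mass from
  all earlier times, because m steps back towards the endpoint shrink it only by the factor
  \<rho>^m. The sum of (\<rho>^m s) powr a over m is at most s powr a / ((1 - \<rho>) a), and 1/a
  supplies the missing factors \<open>l b\<close>, along with one exponent of the good map that
  leads from \<open>c\<close> to the endpoint. The asserted series adds up these contributions; its
  exponents are the worst ones, as s \<le> 1.\<close>

definition conc :: "real \<Rightarrow> real \<Rightarrow> (real \<Rightarrow> real) \<Rightarrow> bool" where
  "conc a b v \<longleftrightarrow> (\<exists>v' v''. \<forall>y\<in>{a<..<b}. 0 < v y \<and> (v has_real_derivative v' y) (at y) \<and>
     (v' has_real_derivative v'' y) (at y) \<and> v'' y \<le> 0)"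

lemma conc_subinterval: "conc a b v \<Longrightarrow> a \<le> a' \<Longrightarrow> b' \<le> b \<Longrightarrow> conc a' b' v"
  unfolding conc_def by (elim exE, intro exI) fastforce

lemma conc_pos: "conc a b v \<Longrightarrow> y \<in> {a<..<b} \<Longrightarrow> 0 < v y"
  unfolding conc_def by blast

lemma conc_concave_on: "conc a b v \<Longrightarrow> concave_on {a<..<b} v"
  unfolding conc_def by (elim exE, rule f''_le0_imp_concave) auto

lemma conc_const: "0 < k \<Longrightarrow> conc a b (\<lambda>_. k)"
  unfolding conc_def
  by (rule exI[of _ "\<lambda>_. 0"], rule exI[of _ "\<lambda>_. 0"]) auto

text \<open>A positive concave function lies above its chords to the boundary points at height 0. As
  \<open>v\<close> need not have values at \<open>a\<close> and \<open>b\<close>, the three-point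
  inequality is used with an interior point \<open>t\<close>, the positive term containing
  \<open>v t\<close> is dropped, and then \<open>t\<close> tends to the end.\<close>

lemma conc_ratio_aux:
  assumes v: "conc a b v" and ab: "a < x" "x < y" "y < b"
  shows "v y * (x - a) \<le> v x * (y - a)" "v x * (b - y) \<le> v y * (b - x)"
proof -
  have cc: "convex_on {a<..<b} (\<lambda>x. - v x)"
    using conc_concave_on[OF v] unfolding concave_on_def .
  have 1: "v y * (x - t) \<le> v x * (y - t)" if t: "a < t" "t < x" for t
  proof -
    have "(v x - v t) * (y - t) \<ge> (v y - v t) * (x - t)"
    proof -
      have "- v x \<le> (- v y - - v t) / (y - t) * (x - t) + - v t"
        using t ab by (intro convex_onD_Icc'[OF convex_on_subset[OF cc], of t y x, THEN order_trans]) auto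
      then show ?thesis using t ab by (simp add: field_simps)
    qed
    moreover have "0 < v t" using conc_pos[OF v] t ab by auto
    moreover have "0 \<le> v t * (y - x)" using \<open>0 < v t\<close> ab by auto
    ultimately show ?thesis unfolding left_diff_distrib right_diff_distrib by linarith
  qed
  have 2: "v x * (t - y) \<le> v y * (t - x)" if t: "t < b" "y < t" for t
  proof -
    have "(v y - v x) * (t - x) \<ge> (v t - v x) * (y - x)"
    proof -
      have "- v y \<le> (- v t - - v x) / (t - x) * (y - x) + - v x"
        using t ab by (intro convex_onD_Icc'[OF convex_on_subset[OF cc], of x t y, THEN order_trans]) auto
      then show ?thesis using t ab by (simp add: field_simps)
    qed
    moreover have "0 < v t" using conc_pos[OF v] t ab by auto
    moreover have "0 \<le> v t * (y - x)" using \<open>0 < v t\<close> ab by auto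
    ultimately show ?thesis unfolding left_diff_distrib right_diff_distrib by linarith
  qed
  show "v y * (x - a) \<le> v x * (y - a)"
  proof (rule tendsto_le[of "at_right a"])
    show "((\<lambda>t. v y * (x - t)) \<longlongrightarrow> v y * (x - a)) (at_right a)" by (intro tendsto_intros)
    show "((\<lambda>t. v x * (y - t)) \<longlongrightarrow> v x * (y - a)) (at_right a)" by (intro tendsto_intros)
    show "\<forall>\<^sub>F t in at_right a. v y * (x - t) \<le> v x * (y - t)"
      using eventually_at_right_real[OF ab(1)] by eventually_elim (use 1 in auto)
  qed simp
  show "v x * (b - y) \<le> v y * (b - x)"
  proof (rule tendsto_le[of "at_left b"])
    show "((\<lambda>t. v x * (t - y)) \<longlongrightarrow> v x * (b - y)) (at_left b)" by (intro tendsto_intros)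
    show "((\<lambda>t. v y * (t - x)) \<longlongrightarrow> v y * (b - x)) (at_left b)" by (intro tendsto_intros)
    show "\<forall>\<^sub>F t in at_left b. v x * (t - y) \<le> v y * (t - x)"
      using eventually_at_left_real[OF ab(3)] by eventually_elim (use 2 in auto)
  qed simp
qed

text \<open>All distances to the ends that occur lie between \<open>e\<close> and
  \<open>b - a\<close>. The constant does not depend on \<open>v\<close>, which makes the distortion
  of all iterates uniform.\<close>

lemma conc_ratio:
  assumes v: "conc a b v" and e: "0 < e"
    and x: "x \<in> {a+e..b-e}" and y: "y \<in> {a+e..b-e}"
  shows "v y \<le> (b - a) / e * v x"
proof -
  have vx: "0 < v x" and vy: "0 < v y" using conc_pos[OF v] x y e by auto
  consider "x < y" | "y < x" | "x = y" by linarith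
  then have "v y * e \<le> v x * (b - a)"
  proof cases
    case 1
    have "v y * e \<le> v y * (x - a)" using vy x by auto
    also have "\<dots> \<le> v x * (y - a)" using conc_ratio_aux(1)[OF v _ 1] x y e by auto
    also have "\<dots> \<le> v x * (b - a)" using vx y e by auto
    finally show ?thesis .
  next
    case 2
    have "v y * e \<le> v y * (b - x)" using vy x by auto
    also have "\<dots> \<le> v x * (b - y)" using conc_ratio_aux(2)[OF v _ 2] x y e by auto
    also have "\<dots> \<le> v x * (b - a)" using vx y e by auto
    finally show ?thesis .
  next
    case 3 then show ?thesis using vx x y e by auto
  qed
  then show ?thesis using e by (simp add: field_simps)
qed

text \<open>The computation behind the stability of the cone under transfer operators: if
  \<open>\<phi>' = \<plusminus> q\<^sup>-\<^sup>2\<close>, then \<open>((v \<circ> \<phi>) q)'' = (v'' \<circ> \<phi>) q\<^sup>-\<^sup>3 + (v \<circ> \<phi>) q''\<close>.\<close>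

lemma conc_compose:
  assumes v: "conc a b v" and q: "conc a' b' q"
    and s: "s = 1 \<or> s = (-1::real)"
    and \<phi>: "\<And>y. y \<in> {a'<..<b'} \<Longrightarrow> \<phi> y \<in> {a<..<b}"
    and d: "\<And>y. y \<in> {a'<..<b'} \<Longrightarrow> (\<phi> has_real_derivative s / (q y)\<^sup>2) (at y)"
  shows "conc a' b' (\<lambda>y. v (\<phi> y) * q y)"
proof -
  obtain v1 v2 where v12: "\<And>y. y \<in> {a<..<b} \<Longrightarrow> 0 < v y \<and> (v has_real_derivative v1 y) (at y) \<and>
     (v1 has_real_derivative v2 y) (at y) \<and> v2 y \<le> 0"
    using v unfolding conc_def by blast
  obtain q1 q2 where q12: "\<And>y. y \<in> {a'<..<b'} \<Longrightarrow> 0 < q y \<and> (q has_real_derivative q1 y) (at y) \<and>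
     (q1 has_real_derivative q2 y) (at y) \<and> q2 y \<le> 0"
    using q unfolding conc_def by blast
  define g1 where "g1 y = s * v1 (\<phi> y) / q y + v (\<phi> y) * q1 y" for y
  define g2 where "g2 y = v2 (\<phi> y) / (q y)^3 + v (\<phi> y) * q2 y" for y
  have s2: "s * s = 1" using s by auto
  have "\<forall>y\<in>{a'<..<b'}. 0 < v (\<phi> y) * q y \<and>
     ((\<lambda>y. v (\<phi> y) * q y) has_real_derivative g1 y) (at y) \<and>
     (g1 has_real_derivative g2 y) (at y) \<and> g2 y \<le> 0"
  proof (intro ballI conjI)
    fix y assume y: "y \<in> {a'<..<b'}"
    note vy = v12[OF \<phi>[OF y]] and qy = q12[OF y]
    have dv: "((\<lambda>y. v (\<phi> y)) has_real_derivative v1 (\<phi> y) * (s / (q y)\<^sup>2)) (at y)"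
      using DERIV_chain2 vy d[OF y] by blast
    have dv1: "((\<lambda>y. v1 (\<phi> y)) has_real_derivative v2 (\<phi> y) * (s / (q y)\<^sup>2)) (at y)"
      using DERIV_chain2 vy d[OF y] by blast
    show "0 < v (\<phi> y) * q y" using vy qy by simp
    show "((\<lambda>y. v (\<phi> y) * q y) has_real_derivative g1 y) (at y)"
      using DERIV_mult[OF dv, of q "q1 y"] qy
      by (simp add: g1_def power2_eq_square mult_ac)
    have "((\<lambda>y. s * v1 (\<phi> y) / q y) has_real_derivative
        ((s * (v2 (\<phi> y) * (s / (q y)\<^sup>2))) * q y - (s * v1 (\<phi> y)) * q1 y) / (q y * q y)) (at y)"
      using qy by (intro DERIV_divide DERIV_cmult dv1) auto
    moreover have "((\<lambda>y. v (\<phi> y) * q1 y) has_real_derivative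
        v1 (\<phi> y) * (s / (q y)\<^sup>2) * q1 y + q2 y * v (\<phi> y)) (at y)"
      using qy by (intro DERIV_mult dv) auto
    ultimately have "((\<lambda>y. s * v1 (\<phi> y) / q y + v (\<phi> y) * q1 y) has_real_derivative
        ((s * (v2 (\<phi> y) * (s / (q y)\<^sup>2))) * q y - (s * v1 (\<phi> y)) * q1 y) / (q y * q y) +
        (v1 (\<phi> y) * (s / (q y)\<^sup>2) * q1 y + q2 y * v (\<phi> y))) (at y)"
      by (rule DERIV_add)
    \<comment> \<open>The two terms with \<open>v1 * q1\<close> cancel, and the sign disappears
      because it is squared.\<close>
    moreover have "((s * (v2 (\<phi> y) * (s / (q y)\<^sup>2))) * q y - (s * v1 (\<phi> y)) * q1 y) / (q y * q y) +
        (v1 (\<phi> y) * (s / (q y)\<^sup>2) * q1 y + q2 y * v (\<phi> y)) = g2 y"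
      using s qy by (auto simp: g2_def field_simps power2_eq_square power3_eq_cube)
    ultimately have "((\<lambda>y. s * v1 (\<phi> y) / q y + v (\<phi> y) * q1 y) has_real_derivative g2 y) (at y)"
      by simp
    then show "(g1 has_real_derivative g2 y) (at y)" by (simp add: g1_def[abs_def])
    show "g2 y \<le> 0" unfolding g2_def using vy qy
      by (intro add_nonpos_nonpos) (auto simp: divide_le_0_iff mult_le_0_iff)
  qed
  then show ?thesis unfolding conc_def by blast
qed

text \<open>Given by generators and not by a characterisation: the estimates below are linear in the
  function, so they need a proof only for a single \<open>1 / v^2\<close>. Equality is demanded only
  inside (a,b), because densities are studied piece by piece. The factor \<open>C\<close> may be 0,
  which covers branches that miss the interval.\<close>

inductive cone :: "real \<Rightarrow> real \<Rightarrow> (real \<Rightarrow> ennreal) \<Rightarrow> bool" for a b where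
  cone_base: "conc a b v \<Longrightarrow> (\<And>y. y \<in> {a<..<b} \<Longrightarrow> f y = ennreal (1 / (v y)\<^sup>2)) \<Longrightarrow> cone a b f"
| cone_add: "cone a b f \<Longrightarrow> cone a b g \<Longrightarrow> (\<And>y. y \<in> {a<..<b} \<Longrightarrow> h y = f y + g y) \<Longrightarrow> cone a b h"
| cone_scale: "cone a b f \<Longrightarrow> (\<And>y. y \<in> {a<..<b} \<Longrightarrow> h y = C * f y) \<Longrightarrow> cone a b h"

lemma cone_one: "cone a b (\<lambda>_. 1)"
  by (rule cone_base[of a b "\<lambda>_. 1"]) (auto intro: conc_const)

lemma cone_zero: "cone a b (\<lambda>_. 0)"
  by (rule cone_scale[OF cone_one, of a b _ 0]) auto

lemma cone_cong: "cone a b f \<Longrightarrow> (\<And>y. y \<in> {a<..<b} \<Longrightarrow> h y = f y) \<Longrightarrow> cone a b h"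
  by (rule cone_scale[of a b f _ 1]) auto

lemma cone_sum:
  assumes "finite I" "\<And>i. i \<in> I \<Longrightarrow> cone a b (f i)"
  shows "cone a b (\<lambda>y. \<Sum>i\<in>I. f i y)"
  using assms
proof (induction rule: finite_induct)
  case empty then show ?case by (simp add: cone_zero)
next
  case (insert x F)
  have "cone a b (f x)" "cone a b (\<lambda>y. \<Sum>i\<in>F. f i y)" using insert by auto
  from cone_add[OF this] show ?case using insert(1,2) by simp
qed

lemma cone_ratio:
  assumes "cone a b f" and e: "0 < e"
    and x: "x \<in> {a+e..b-e}" and y: "y \<in> {a+e..b-e}"
  shows "f x \<le> ennreal (((b - a) / e)\<^sup>2) * f y"
  using assms(1)
proof (induction rule: cone.induct)
  case (cone_base v f)
  have xy: "x \<in> {a<..<b}" "y \<in> {a<..<b}" using x y e by auto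
  have pos: "0 < v x" "0 < v y" using conc_pos[OF cone_base(1)] xy by auto
  have "v y \<le> (b - a) / e * v x" by (rule conc_ratio[OF cone_base(1) e x y])
  then have "(v y)\<^sup>2 \<le> ((b - a) / e)\<^sup>2 * (v x)\<^sup>2"
    using pos by (metis less_imp_le power_mono power_mult_distrib)
  then have "(v y)\<^sup>2 / ((v x)\<^sup>2 * (v y)\<^sup>2) \<le> ((b - a) / e)\<^sup>2 * (v x)\<^sup>2 / ((v x)\<^sup>2 * (v y)\<^sup>2)"
    by (rule divide_right_mono) simp
  then have "1 / (v x)\<^sup>2 \<le> ((b - a) / e)\<^sup>2 * (1 / (v y)\<^sup>2)"
    using pos by simp
  then show ?case using cone_base(2) xy
    by (simp add: ennreal_mult'[symmetric] ennreal_leI)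
next
  case (cone_add f g h)
  have "x \<in> {a<..<b}" "y \<in> {a<..<b}" using x y e by auto
  then show ?case using cone_add by (simp add: distrib_left add_mono)
next
  case (cone_scale f h C)
  have "x \<in> {a<..<b}" "y \<in> {a<..<b}" using x y e by auto
  then show ?case using cone_scale by (simp add: mult.left_commute mult_left_mono)
qed

text \<open>The value at \<open>y\<close> is at most a constant times every value on the middle
  interval; averaging over that interval, of length \<open>b - a - 2 * e\<close>, converts the bound
  on the mass into a pointwise one.\<close>

lemma cone_bound:
  assumes f: "cone a b f" and [measurable]: "f \<in> borel_measurable borel"
    and e: "0 < e" "2 * e < b - a"
    and m: "(\<integral>\<^sup>+x\<in>{a<..<b}. f x \<partial>lborel) \<le> 1" and y: "y \<in> {a+e..b-e}"
  shows "f y \<le> ennreal (((b - a) / e)\<^sup>2 / (b - a - 2 * e))"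
proof -
  define D where "D = ((b - a) / e)\<^sup>2"
  have D: "0 < D" using e by (simp add: D_def)
  have "f y * ennreal (b - a - 2 * e) = (\<integral>\<^sup>+x\<in>{a+e..b-e}. f y \<partial>lborel)"
    using e by (simp add: nn_integral_cmult_indicator algebra_simps)
  also have "\<dots> \<le> (\<integral>\<^sup>+x. ennreal D * (f x * indicator {a<..<b} x) \<partial>lborel)"
    using cone_ratio[OF f e(1) y] e by (intro nn_integral_mono) (auto simp: D_def split: split_indicator)
  also have "\<dots> = ennreal D * (\<integral>\<^sup>+x\<in>{a<..<b}. f x \<partial>lborel)"
    by (rule nn_integral_cmult) measurable
  also have "\<dots> \<le> ennreal D" using m mult_left_mono[OF m, of "ennreal D"] by simp
  finally have "f y * ennreal (b - a - 2 * e) \<le> ennreal D" .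
  then have "f y * ennreal (b - a - 2 * e) / ennreal (b - a - 2 * e) \<le> ennreal D / ennreal (b - a - 2 * e)"
    by (rule divide_right_mono_ennreal)
  then show ?thesis
    using e D by (simp add: ennreal_times_divide[symmetric] mult_divide_eq_ennreal divide_ennreal D_def)
qed

text \<open>On a generator \<open>1 / v^2\<close> the result is the inverse square of
  \<open>(v o \<phi>) q\<close>, which is concave by \<open>conc_compose\<close>; the other two
  rules pass through by linearity. The weight \<open>1 / q^2\<close> is the absolute derivative of
  \<open>\<phi>\<close>.\<close>

lemma cone_branch:
  assumes f: "cone a b f" and q: "conc a' b' q"
    and s: "s = 1 \<or> s = (-1::real)"
    and \<phi>: "\<And>y. y \<in> {a'<..<b'} \<Longrightarrow> \<phi> y \<in> {a<..<b}"
    and d: "\<And>y. y \<in> {a'<..<b'} \<Longrightarrow> (\<phi> has_real_derivative s / (q y)\<^sup>2) (at y)"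
  shows "cone a' b' (\<lambda>y. f (\<phi> y) * ennreal (1 / (q y)\<^sup>2))"
  using f
proof (induction rule: cone.induct)
  case (cone_base v f)
  show ?case
    by (rule cone.cone_base[OF conc_compose[OF cone_base(1) q s \<phi> d]])
       (auto simp: cone_base(2)[OF \<phi>] ennreal_mult'[symmetric] power_mult_distrib)
next
  case (cone_add f g h)
  show ?case by (rule cone.cone_add[OF cone_add(4,5)]) (auto simp: cone_add(3)[OF \<phi>] distrib_right)
next
  case (cone_scale f h C)
  show ?case by (rule cone.cone_scale[OF cone_scale(3)]) (auto simp: cone_scale(2)[OF \<phi>] mult.assoc)
qed

subsection \<open>Change of variables\<close>

text \<open>For increasing maps this is the substitution rule on a compact interval; a decreasing
  map is followed by the reflection x to -x, which preserves Lebesgue measure.\<close>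

lemma nn_integral_image_Icc:
  fixes \<phi> :: "real \<Rightarrow> real"
  assumes f[measurable]: "f \<in> borel_measurable borel"
    and s: "s = 1 \<or> s = (-1::real)" and ab: "a < b"
    and d: "\<And>y. y \<in> {a..b} \<Longrightarrow> (\<phi> has_real_derivative s * w y) (at y)"
    and w: "\<And>y. y \<in> {a..b} \<Longrightarrow> 0 < w y" and cw: "continuous_on {a..b} w"
  shows "(\<integral>\<^sup>+x\<in>\<phi> ` {a..b}. f x \<partial>lborel) = (\<integral>\<^sup>+y\<in>{a..b}. f (\<phi> y) * ennreal (w y) \<partial>lborel)"
proof -
  have inc: "(\<integral>\<^sup>+x\<in>g ` {a..b}. f x \<partial>lborel) = (\<integral>\<^sup>+y\<in>{a..b}. f (g y) * ennreal (w y) \<partial>lborel)"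
    if f: "f \<in> borel_measurable borel" and d: "\<And>y. y \<in> {a..b} \<Longrightarrow> (g has_real_derivative w y) (at y)"
    for f and g :: "real \<Rightarrow> real"
  proof -
    have mono: "g x \<le> g y" if "a \<le> x" "x \<le> y" "y \<le> b" for x y
      by (rule deriv_nonneg_imp_mono[of x y g w]) (use that d w in \<open>auto intro: less_imp_le\<close>)
    have "continuous_on {a..b} g" by (rule DERIV_continuous_on[OF has_field_derivative_at_within[OF d]])
    then have "g ` {a..b} = {g a..g b}"
    proof (intro equalityI subsetI)
      fix z assume "z \<in> {g a..g b}"
      then show "z \<in> g ` {a..b}" using IVT'[of g a z b] \<open>continuous_on {a..b} g\<close> ab by auto
    qed (use mono ab in auto)
    then show ?thesis
      using nn_integral_substitution_aux[OF f _ d cw _ ab] w by (auto intro: less_imp_le)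
  qed
  show ?thesis
  proof (cases "s = 1")
    case True
    then show ?thesis using inc[OF f, of \<phi>] d by auto
  next
    case False
    with s have s: "s = -1" by auto
    have "(\<integral>\<^sup>+x\<in>(\<lambda>y. - \<phi> y) ` {a..b}. f (- x) \<partial>lborel) = (\<integral>\<^sup>+y\<in>{a..b}. f (- (- \<phi> y)) * ennreal (w y) \<partial>lborel)"
      by (rule inc) (use d s in \<open>auto intro!: derivative_eq_intros\<close>)
    moreover have "(\<integral>\<^sup>+x\<in>(\<lambda>y. - \<phi> y) ` {a..b}. f (- x) \<partial>lborel) = (\<integral>\<^sup>+x\<in>\<phi> ` {a..b}. f x \<partial>lborel)"
    proof -
      have m[measurable]: "\<phi> ` {a..b} \<in> sets borel"
      proof -
        have "continuous_on {a..b} \<phi>" by (rule DERIV_continuous_on[OF has_field_derivative_at_within[OF d]])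
        then have "compact (\<phi> ` {a..b})" by (intro compact_continuous_image) auto
        then show ?thesis by (simp add: borel_compact)
      qed
      have "(\<integral>\<^sup>+x\<in>\<phi> ` {a..b}. f x \<partial>lborel) = (\<integral>\<^sup>+x. f (- x) * indicator (\<phi> ` {a..b}) (- x) \<partial>lborel)"
        using nn_integral_real_affine[of "\<lambda>x. f x * indicator (\<phi> ` {a..b}) x" "-1" 0] by simp
      also have "\<dots> = (\<integral>\<^sup>+x\<in>(\<lambda>y. - \<phi> y) ` {a..b}. f (- x) \<partial>lborel)"
        by (intro nn_integral_cong) (auto split: split_indicator simp: image_iff)
      finally show ?thesis by simp
    qed
    ultimately show ?thesis by simp
  qed
qed

text \<open>Branches and their inverses have no controlled values outside their own intervals, so
  measurability of a composition is claimed only after multiplication with an indicator.\<close>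

lemma borel_measurable_comp_continuous_on:
  fixes \<phi> :: "real \<Rightarrow> real" and f :: "real \<Rightarrow> ennreal"
  assumes f: "f \<in> borel_measurable borel" and S: "S \<in> sets borel" and c: "continuous_on S \<phi>"
  shows "(\<lambda>y. f (\<phi> y) * indicator S y) \<in> borel_measurable borel"
proof -
  have "\<phi> \<in> borel_measurable (restrict_space borel S)" using c by (rule borel_measurable_continuous_on_restrict)
  then have "(\<lambda>y. f (\<phi> y)) \<in> borel_measurable (restrict_space borel S)"
    using f by (rule measurable_compose)
  then show ?thesis using S by (subst (asm) borel_measurable_restrict_space_iff_ennreal) (auto simp: mult.commute)
qed

text \<open>The derivative of an inverse branch may be unbounded near an endpoint. The interval is
  therefore exhausted by compact ones, and both sides, read as measures with densities, pass to the
  limit by continuity from below.\<close>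

lemma nn_integral_image_Ioo:
  fixes \<phi> :: "real \<Rightarrow> real"
  assumes f[measurable]: "f \<in> borel_measurable borel"
    and s: "s = 1 \<or> s = (-1::real)"
    and d: "\<And>y. y \<in> {a<..<b} \<Longrightarrow> (\<phi> has_real_derivative s * w y) (at y)"
    and w: "\<And>y. y \<in> {a<..<b} \<Longrightarrow> 0 < w y" and cw: "continuous_on {a<..<b} w"
  shows "(\<integral>\<^sup>+x\<in>\<phi> ` {a<..<b}. f x \<partial>lborel) = (\<integral>\<^sup>+y\<in>{a<..<b}. f (\<phi> y) * ennreal (w y) \<partial>lborel)"
proof (cases "a < b")
  case False then show ?thesis by auto
next
  case ab: True
  \<comment> \<open>The summand 3 keeps even the first interval nondegenerate, since 2/3 <
    1.\<close>
  define A where "A n = {a + (b - a) / (real n + 3) .. b - (b - a) / (real n + 3)}" for n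
  have [measurable]: "A n \<in> sets borel" for n by (simp add: A_def)
  have A_sub: "A n \<subseteq> {a<..<b}" for n 
  proof -
    have "0 < (b - a) / (real n + 3)" using ab by simp
    then show ?thesis unfolding A_def by force
  qed
  have A_ne: "a + (b - a) / (real n + 3) < b - (b - a) / (real n + 3)" for n
  proof -
    have "2 * (b - a) / (real n + 3) < b - a" 
      using ab mult_strict_left_mono[OF ab, of "real n + 1"] by (simp add: field_simps)
    then show ?thesis by (simp add: algebra_simps)
  qed
  have A_inc: "incseq A"
    unfolding A_def incseq_def using ab by (auto intro!: divide_left_mono elim!: order_trans[rotated] order_trans simp: add_mono)
  have A_UN: "(\<Union>n. A n) = {a<..<b}"
  proof (intro equalityI subsetI)
    fix y assume y: "y \<in> {a<..<b}"
    define m where "m = min (y - a) (b - y)"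
    have m: "0 < m" using y by (auto simp: m_def)
    obtain n where "(b - a) / m < real n" using reals_Archimedean2 by blast
    then have "(b - a) / m < real n + 3" by simp
    then have "(b - a) / (real n + 3) < m" using m by (simp add: divide_simps mult.commute)
    then have "(b - a) / (real n + 3) < min (y - a) (b - y)" by (simp add: m_def)
    then show "y \<in> (\<Union>n. A n)" by (auto simp: A_def intro!: exI[of _ n])
  qed (use A_sub in blast)
  have c\<phi>: "continuous_on {a<..<b} \<phi>"
    by (rule DERIV_continuous_on[OF has_field_derivative_at_within[OF d]])
  have [measurable]: "\<phi> ` A n \<in> sets borel" for n
    using compact_continuous_image[OF continuous_on_subset[OF c\<phi> A_sub], of n]
    by (auto simp: A_def intro: borel_compact)
  define g where "g y = f (\<phi> y) * indicator {a<..<b} y * ennreal (w y * indicator {a<..<b} y)" for y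
  have g[measurable]: "g \<in> borel_measurable borel"
  proof -
    have "(\<lambda>y. f (\<phi> y) * indicator {a<..<b} y) \<in> borel_measurable borel"
      by (rule borel_measurable_comp_continuous_on[OF f _ c\<phi>]) auto
    moreover have "(\<lambda>y. indicator {a<..<b} y *\<^sub>R w y) \<in> borel_measurable borel"
      by (rule borel_measurable_continuous_on_indicator[OF _ cw]) auto
    ultimately show ?thesis unfolding g_def by (auto simp: mult.commute)
  qed
  have *: "emeasure (density lborel f) (\<phi> ` A n) = emeasure (density lborel g) (A n)" for n
  proof -
    have "(\<integral>\<^sup>+x\<in>\<phi> ` A n. f x \<partial>lborel) = (\<integral>\<^sup>+y\<in>A n. f (\<phi> y) * ennreal (w y) \<partial>lborel)"
      unfolding A_def
      by (rule nn_integral_image_Icc[OF f s A_ne])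
        (use A_sub[of n] in \<open>auto simp: A_def intro!: d w intro: continuous_on_subset[OF cw]\<close>)
    also have "\<dots> = (\<integral>\<^sup>+y\<in>A n. g y \<partial>lborel)"
      using A_sub[of n] by (intro nn_integral_cong) (auto simp: g_def split: split_indicator)
    finally show ?thesis by (simp add: emeasure_density)
  qed
  have im: "\<phi> ` {a<..<b} = (\<Union>n. \<phi> ` A n)" using A_UN by blast
  then have [measurable]: "\<phi> ` {a<..<b} \<in> sets borel" by simp
  have "(\<integral>\<^sup>+x\<in>\<phi> ` {a<..<b}. f x \<partial>lborel) = emeasure (density lborel f) (\<phi> ` {a<..<b})"
    by (simp add: emeasure_density)
  also have "\<dots> = (SUP n. emeasure (density lborel f) (\<phi> ` A n))"
    unfolding im using A_inc by (intro SUP_emeasure_incseq[symmetric]) (auto simp: incseq_def intro!: image_mono)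
  also have "\<dots> = (SUP n. emeasure (density lborel g) (A n))" by (simp add: *)
  also have "\<dots> = emeasure (density lborel g) (\<Union>n. A n)"
    using A_inc by (intro SUP_emeasure_incseq) auto
  also have "\<dots> = (\<integral>\<^sup>+y\<in>{a<..<b}. g y \<partial>lborel)" by (simp add: A_UN emeasure_density)
  also have "\<dots> = (\<integral>\<^sup>+y\<in>{a<..<b}. f (\<phi> y) * ennreal (w y) \<partial>lborel)"
    by (intro nn_integral_cong) (auto simp: g_def split: split_indicator)
  finally show ?thesis .
qed

text \<open>Non-singularity: a null set containing the exceptional points has integral zero after
  the change of variables, and since the weight \<open>w\<close> is positive, its preimage is null
  as well.\<close>

lemma AE_comp_Ioo:
  fixes \<phi> :: "real \<Rightarrow> real"
  assumes s: "s = 1 \<or> s = (-1::real)"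
    and d: "\<And>y. y \<in> {a<..<b} \<Longrightarrow> (\<phi> has_real_derivative s * w y) (at y)"
    and w: "\<And>y. y \<in> {a<..<b} \<Longrightarrow> 0 < w y" and cw: "continuous_on {a<..<b} w"
    and Q: "AE x in lborel. Q x"
  shows "AE y in lborel. y \<in> {a<..<b} \<longrightarrow> Q (\<phi> y)"
proof -
  obtain N where N: "{x \<in> space lborel. \<not> Q x} \<subseteq> N" "emeasure lborel N = 0" "N \<in> sets lborel"
    using Q by (rule AE_E)
  have [measurable]: "N \<in> sets borel" using N(3) by simp
  let ?I = "{a<..<b}"
  have c\<phi>: "continuous_on ?I \<phi>" by (rule DERIV_continuous_on[OF has_field_derivative_at_within[OF d]])
  have "(\<integral>\<^sup>+y\<in>?I. indicator N (\<phi> y) * ennreal (w y) \<partial>lborel) = (\<integral>\<^sup>+x\<in>\<phi> ` ?I. indicator N x \<partial>lborel)"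
    by (rule nn_integral_image_Ioo[symmetric, OF _ s d w cw]) measurable
  also have "\<dots> \<le> (\<integral>\<^sup>+x. indicator N x \<partial>lborel)"
    by (intro nn_integral_mono) (auto split: split_indicator)
  finally have 0: "(\<integral>\<^sup>+y\<in>?I. indicator N (\<phi> y) * ennreal (w y) \<partial>lborel) = 0" using N(2) by simp
  have "(\<lambda>y. indicator N (\<phi> y) * indicator ?I y :: ennreal) \<in> borel_measurable borel"
    by (rule borel_measurable_comp_continuous_on[OF _ _ c\<phi>]) auto
  moreover have "(\<lambda>y. indicator ?I y *\<^sub>R w y) \<in> borel_measurable borel"
    by (rule borel_measurable_continuous_on_indicator[OF _ cw]) auto
  ultimately have m: "(\<lambda>y. indicator N (\<phi> y) * indicator ?I y * ennreal (indicator ?I y *\<^sub>R w y) :: ennreal) \<in> borel_measurable borel"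
    by measurable
  have "(\<integral>\<^sup>+y. indicator N (\<phi> y) * indicator ?I y * ennreal (indicator ?I y *\<^sub>R w y) \<partial>lborel) = 0"
    using 0 by (rule trans[rotated]) (intro nn_integral_cong, auto split: split_indicator)
  then have "AE y in lborel. indicator N (\<phi> y) * indicator ?I y * ennreal (indicator ?I y *\<^sub>R w y) = 0"
    using m by (subst (asm) nn_integral_0_iff_AE) auto
  then show ?thesis
  proof eventually_elim
    fix y assume "indicator N (\<phi> y) * indicator ?I y * ennreal (indicator ?I y *\<^sub>R w y) = 0"
    then show "y \<in> ?I \<longrightarrow> Q (\<phi> y)" using w[of y] N(1) by (auto simp: indicator_def split: if_splits)
  qed
qed

subsection \<open>Elementary inequalities\<close>

lemma finite_pos_lower_bound:
  fixes f :: "'a \<Rightarrow> real"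
  assumes "finite S" "\<And>x. x \<in> S \<Longrightarrow> 0 < f x"
  obtains d where "0 < d" "\<And>x. x \<in> S \<Longrightarrow> d \<le> f x"
proof
  \<comment> \<open>The inserted 1 gives the minimum a meaning for empty \<open>S\<close>.\<close>
  show "0 < Min (insert 1 (f ` S))" using assms by (subst Min_gr_iff) auto
  show "Min (insert 1 (f ` S)) \<le> f x" if "x \<in> S" for x using assms(1) that by (intro Min_le) auto
qed

lemma powr_twice_le:
  assumes "0 \<le> s" "s \<le> 1" "1 \<le> e" "e \<le> (m::real)" "0 \<le> a" "a \<le> 2 * s"
  shows "a powr (1 / e) \<le> 2 * s powr (1 / m)"
proof -
  have "a powr (1 / e) \<le> (2 * s) powr (1 / e)" using assms by (intro powr_mono2) auto
  also have "\<dots> = 2 powr (1 / e) * s powr (1 / e)" using assms by (simp add: powr_mult)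
  also have "\<dots> \<le> 2 powr 1 * s powr (1 / m)"
    using assms by (intro mult_mono powr_mono powr_mono') (auto intro: divide_left_mono simp: divide_le_eq)
  finally show ?thesis by simp
qed

lemma ennreal_archimedean:
  assumes "k \<noteq> 0" "h \<noteq> (\<infinity>::ennreal)" shows "\<exists>t. h \<le> of_nat t * k"
proof (cases "k = top")
  case True
  then have "h \<le> of_nat 1 * k" by simp
  then show ?thesis by blast
next
  case False
  then obtain a b where ab: "h = ennreal a" "0 \<le> a" "k = ennreal b" "0 \<le> b"
    using assms by (metis ennreal_cases infinity_ennreal_def)
  then have b: "0 < b" using assms by auto
  obtain t where "a / b < real t" using reals_Archimedean2 by blast
  then have "a \<le> real t * b" using b by (simp add: field_simps)
  then have "ennreal a \<le> ennreal (real t * b)" by (rule ennreal_leI)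
  then show ?thesis using ab by (auto simp: ennreal_mult ennreal_of_nat_eq_real_of_nat)
qed

text \<open>How subinvariance becomes invariance: the transfer operator preserves the integral, so
  \<open>P f \<le> f\<close> together with finite mass leaves no room for a strict inequality on a
  set of positive measure.\<close>

lemma AE_eq_of_nn_integral_le:
  fixes f g :: "'a \<Rightarrow> ennreal"
  assumes [measurable]: "f \<in> borel_measurable M" "g \<in> borel_measurable M"
    and le: "AE x in M. f x \<le> g x" and int: "(\<integral>\<^sup>+x. g x \<partial>M) \<le> (\<integral>\<^sup>+x. f x \<partial>M)"
    and fin: "(\<integral>\<^sup>+x. g x \<partial>M) \<noteq> \<infinity>"
  shows "AE x in M. f x = g x"
proof -
  have f: "(\<integral>\<^sup>+x. f x \<partial>M) \<noteq> \<infinity>" using nn_integral_mono_AE[OF le] fin by (auto simp: top_unique)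
  have "(\<integral>\<^sup>+x. g x - f x \<partial>M) = (\<integral>\<^sup>+x. g x \<partial>M) - (\<integral>\<^sup>+x. f x \<partial>M)"
    by (rule nn_integral_diff) (use f le in auto)
  also have "\<dots> = 0" using int fin f by (simp add: diff_eq_0_iff_ennreal less_top)
  finally have "AE x in M. g x - f x = 0" by (subst (asm) nn_integral_0_iff_AE) auto
  moreover have "AE x in M. g x \<noteq> \<infinity>" by (rule nn_integral_PInf_AE[OF _ fin]) measurable
  ultimately show ?thesis using le
    by eventually_elim (auto simp: diff_eq_0_iff_ennreal less_top intro: antisym)
qed

subsection \<open>A single monotone branch\<close>

text \<open>One frame for left and right branches of good and bad maps: (a,b) is the piece, (u,v)
  its image, \<open>c\<close> the critical end and \<open>z\<close> the repelling end, in either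
  order. The Schwarzian condition reaches \<open>z\<close> but not \<open>c\<close>, where
  \<open>T\<close> may be discontinuous.\<close>

locale branch =
  fixes c z a b u v :: real and T :: "real \<Rightarrow> real" and e K M :: real
  assumes ab: "0 \<le> a" "a < b" "b \<le> 1" and uv: "0 \<le> u" "u < v" "v \<le> 1"
    and cz: "(z = a \<and> c = b) \<or> (z = b \<and> c = a)"
    and bij: "bij_betw T {a<..<b} {u<..<v}"
    and schw: "nonpos_schwarzian_on T (insert z {a<..<b})"
    and e1: "1 \<le> e" and K0: "0 < K"
    and bounds: "\<And>x. x \<in> {a<..<b} \<Longrightarrow> K * \<bar>x - c\<bar> powr (e - 1) \<le> \<bar>der T x\<bar> \<and>
                      \<bar>der T x\<bar> \<le> M * \<bar>x - c\<bar> powr (e - 1)"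
    and exp: "\<bar>der T z\<bar> > 1"
    and Tz: "T z \<in> {0, 1}"
begin

abbreviation "X \<equiv> {a<..<b}"
abbreviation "Z \<equiv> {u<..<v}"
definition "\<phi> = inv_into X T"

lemma at_within_unit: "x \<in> X \<Longrightarrow> at x within {0..1} = at x"
  using ab by (intro at_within_Icc_at) auto

lemma der_iter:
  assumes x: "x \<in> X" and k: "k < 3"
  shows "((der ^^ k) T has_real_derivative (der ^^ (Suc k)) T x) (at x)"
proof -
  have "(der ^^ k) T differentiable (at x within insert z X)"
    using schw k x unfolding nonpos_schwarzian_on_def diff3_on_def differentiable_on_def by blast
  then have "(der ^^ k) T differentiable (at x within X)"
    by (rule differentiable_within_subset) auto
  then have "(der ^^ k) T differentiable (at x)"
    by (simp add: at_within_open[OF x])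
  then have "((der ^^ k) T has_vector_derivative vector_derivative ((der ^^ k) T) (at x)) (at x)"
    using vector_derivative_works by blast
  then show ?thesis
    unfolding has_real_derivative_iff_has_vector_derivative
    by (simp add: der_def[of "(der ^^ k) T"] at_within_unit[OF x])
qed

lemma deriv: "x \<in> X \<Longrightarrow> (T has_real_derivative der T x) (at x)"
  using der_iter[of x 0] by simp

lemma der_continuous: "continuous_on (insert z X) (der T)" "continuous_on (insert z X) T"
proof -
  have "(der ^^ k) T differentiable_on (insert z X)" if "k < 3" for k
    using schw that unfolding nonpos_schwarzian_on_def diff3_on_def by auto
  from this[of 1] this[of 0] show "continuous_on (insert z X) (der T)" "continuous_on (insert z X) T"
    by (auto intro: differentiable_imp_continuous_on)
qed

lemma der_nz: "x \<in> X \<Longrightarrow> der T x \<noteq> 0"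
  using schw unfolding nonpos_schwarzian_on_def by auto

lemma schw_le: "x \<in> X \<Longrightarrow> schwarzian T x \<le> 0"
  using schw unfolding nonpos_schwarzian_on_def by auto

definition "s = (if der T ((a+b)/2) > 0 then 1 else - 1 :: real)"

lemma s_cases: "s = 1 \<or> s = -1" by (auto simp: s_def)

text \<open>The derivative is continuous and has no zero on an interval, so its sign at the midpoint
  is its sign everywhere.\<close>

lemma s_der: assumes x: "x \<in> X" shows "der T x = s * \<bar>der T x\<bar>"
proof -
  let ?m = "(a+b)/2"
  have m: "?m \<in> X" using ab by auto
  have "connected (der T ` X)"
    using der_continuous(1) by (intro connected_continuous_image) (auto intro: continuous_on_subset)
  moreover have "0 \<notin> der T ` X" using der_nz by auto
  moreover have "der T x \<in> der T ` X" "der T ?m \<in> der T ` X" using x m by blast+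
  ultimately have "0 \<notin> {der T x..der T ?m}" "0 \<notin> {der T ?m..der T x}"
    using connected_contains_Icc[of "der T ` X"] by blast+
  then show ?thesis using der_nz[OF x] der_nz[OF m] by (auto simp: s_def abs_if simp del: greaterThanLessThan_iff)
qed

lemma M_pos: "0 < M"
proof -
  have "0 < \<bar>der T ((a+b)/2)\<bar>" using der_nz[of "(a+b)/2"] ab by auto
  also have "\<dots> \<le> M * \<bar>(a+b)/2 - c\<bar> powr (e - 1)" using bounds[of "(a+b)/2"] ab by auto
  finally show ?thesis by (simp add: zero_less_mult_iff)
qed

lemma der_le_M: assumes x: "x \<in> X" shows "\<bar>der T x\<bar> \<le> M"
proof -
  have "\<bar>x - c\<bar> powr (e - 1) \<le> 1"
    using x cz ab e1 by (intro powr_le1) auto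
  then have "M * \<bar>x - c\<bar> powr (e - 1) \<le> M * 1" using M_pos by (intro mult_left_mono) auto
  then show ?thesis using bounds[OF x] by auto
qed

section \<open>Continuous extension of a branch to its closed interval\<close>

lemma lip: assumes "x \<in> X" "y \<in> X" shows "\<bar>T x - T y\<bar> \<le> M * \<bar>x - y\<bar>"
  using field_differentiable_bound[of X T "der T" M x y] assms deriv der_le_M M_pos
  by (auto intro: has_field_derivative_at_within)

text \<open>The bounded derivative makes \<open>T\<close> Lipschitz on the open piece, hence
  extendable to the closure. At \<open>z\<close> the extension must agree with \<open>T\<close>,
  because \<open>T\<close> is itself continuous there from inside the piece; at \<open>c\<close> no
  such agreement is claimed.\<close>

lemma ext_exists: "\<exists>g. continuous_on {a..b} g \<and> (\<forall>x\<in>insert z X. g x = T x)"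
proof -
  have "uniformly_continuous_on X T"
    using lip M_pos by (intro lipschitz_on_uniformly_continuous[of M])
      (auto simp: lipschitz_on_def dist_real_def)
  then obtain g where g: "uniformly_continuous_on (closure X) g" "\<And>x. x \<in> X \<Longrightarrow> T x = g x"
    by (rule uniformly_continuous_on_extension_on_closure) metis
  have cl: "closure X = {a..b}" using ab by simp
  have cg: "continuous_on {a..b} g" using g(1) cl uniformly_continuous_imp_continuous by metis
  have zin: "z \<in> {a..b}" using cz ab by auto
  have "g z = T z"
  proof (rule tendsto_unique)
    have "X - {z} = X" using cz by auto
    then show "at z within X \<noteq> bot" using zin cl by (simp add: at_within_eq_bot_iff)
    have "(g \<longlongrightarrow> g z) (at z within {a..b})" using cg zin by (auto simp: continuous_on)
    then show "(g \<longlongrightarrow> g z) (at z within X)" by (rule tendsto_within_subset) auto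
    have "(T \<longlongrightarrow> T z) (at z within insert z X)" using der_continuous(2) by (auto simp: continuous_on)
    then have "(T \<longlongrightarrow> T z) (at z within X)" by (rule tendsto_within_subset) auto
    moreover have "\<forall>\<^sub>F x in at z within X. T x = g x" using g(2) by (simp add: eventually_at_filter)
    ultimately show "(g \<longlongrightarrow> T z) (at z within X)" by (rule Lim_transform_eventually)
  qed
  then show ?thesis using cg g(2) by auto
qed

definition "G = (SOME g. continuous_on {a..b} g \<and> (\<forall>x\<in>insert z X. g x = T x))"
text \<open>The one-sided limit of \<open>T\<close> at the critical end; it need not equal
  \<open>T c\<close>.\<close>

definition "\<tau> = G c"

lemma G: "continuous_on {a..b} G" "x \<in> X \<Longrightarrow> G x = T x" "G z = T z"
  using someI_ex[OF ext_exists] unfolding G_def by auto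

lemma G_deriv: assumes x: "x \<in> X" shows "(G has_real_derivative der T x) (at x)"
proof (rule has_field_derivative_transform_within_open[OF deriv[OF x] _ x])
qed (use G in auto)

lemma G_mvt:
  assumes "a \<le> x" "x < y" "y \<le> b"
  shows "\<exists>t. x < t \<and> t < y \<and> G y - G x = (y - x) * der T t"
proof -
  have "\<exists>l t. x < t \<and> t < y \<and> DERIV G t :> l \<and> G y - G x = (y - x) * l"
    using assms G(1) G_deriv by (intro MVT) (auto intro: continuous_on_subset simp: real_differentiable_def, (meson G_deriv assms greaterThanLessThan_iff le_less_trans less_le_trans))
  then obtain l t where t: "x < t" "t < y" "DERIV G t :> l" "G y - G x = (y - x) * l" by blast
  then have "l = der T t" using DERIV_unique[OF t(3) G_deriv] assms by auto
  then show ?thesis using t by auto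
qed

lemma G_mvt_abs:
  assumes "x \<in> {a..b}" "y \<in> {a..b}" "x \<noteq> y"
  obtains t where "t \<in> X" "min x y < t" "t < max x y" "\<bar>G x - G y\<bar> = \<bar>x - y\<bar> * \<bar>der T t\<bar>"
proof -
  have "\<exists>t. min x y < t \<and> t < max x y \<and> \<bar>G x - G y\<bar> = \<bar>x - y\<bar> * \<bar>der T t\<bar>"
  proof (cases "x < y")
    case True
    then obtain t where "x < t" "t < y" "G y - G x = (y - x) * der T t" using G_mvt[of x y] assms by auto
    then have "\<bar>G y - G x\<bar> = \<bar>y - x\<bar> * \<bar>der T t\<bar>" by (simp add: abs_mult)
    then show ?thesis using True \<open>x < t\<close> \<open>t < y\<close> by (auto simp: abs_minus_commute intro!: exI[of _ t])
  next
    case False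
    then obtain t where "y < t" "t < x" "G x - G y = (x - y) * der T t" using G_mvt[of y x] assms by auto
    then have "\<bar>G x - G y\<bar> = \<bar>x - y\<bar> * \<bar>der T t\<bar>" by (simp add: abs_mult)
    then show ?thesis using False \<open>y < t\<close> \<open>t < x\<close> by (auto intro!: exI[of _ t])
  qed
  then obtain t where t: "min x y < t" "t < max x y" "\<bar>G x - G y\<bar> = \<bar>x - y\<bar> * \<bar>der T t\<bar>" by blast
  moreover have "t \<in> X" using t(1,2) assms by auto
  ultimately show ?thesis using that by blast
qed

lemma cz_in: "c \<in> {a..b}" "z \<in> {a..b}" using cz ab by auto

lemma G_strict:
  assumes "a \<le> x" "x < y" "y \<le> b" shows "s * G x < s * G y"
proof -
  obtain t where t: "x < t" "t < y" "G y - G x = (y - x) * der T t" using G_mvt[OF assms] by blast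
  have tX: "t \<in> X" using t assms by auto
  have "s * (G y - G x) = (y - x) * (s * (s * \<bar>der T t\<bar>))" using s_der[OF tX] t(3) by (metis mult.left_commute)
  also have "\<dots> = (y - x) * \<bar>der T t\<bar>" using s_cases by auto
  also have "\<dots> > 0" using der_nz[OF tX] assms by auto
  finally show ?thesis by (simp add: algebra_simps)
qed

lemma G_mono: "a \<le> x \<Longrightarrow> x \<le> y \<Longrightarrow> y \<le> b \<Longrightarrow> s * G x \<le> s * G y"
  using G_strict[of x y] by (cases "x = y") auto

text \<open>A strictly monotone continuous function maps the open piece onto the open interval
  between its boundary values. That image is known to be (u,v), and a nonempty open interval
  determines its ends.\<close>

lemma G_ends: "{G a, G b} = {u, v}"
proof -
  have im: "G ` X = Z" using bij G(2) by (auto simp: bij_betw_def)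
  define lo hi where "lo = min (G a) (G b)" and "hi = max (G a) (G b)"
  have "G ` X = {lo<..<hi}"
  proof (intro equalityI subsetI)
    fix y assume "y \<in> G ` X"
    then obtain x where "x \<in> X" "y = G x" by blast
    then have "s * G a < s * y" "s * y < s * G b" using G_strict[of a x] G_strict[of x b] by auto
    then show "y \<in> {lo<..<hi}" using s_cases by (auto simp: lo_def hi_def)
  next
    fix y assume y: "y \<in> {lo<..<hi}"
    have "G ` {a..b} = {lo..hi} \<or> y \<in> G ` {a..b}"
      using IVT'[of G a y b] IVT2'[of G b y a] G(1) y ab by (auto simp: lo_def hi_def min_def max_def split: if_splits)
    then have "y \<in> G ` {a..b}" using y by auto
    then obtain x where "x \<in> {a..b}" "y = G x" by blast
    moreover have "x \<noteq> a" "x \<noteq> b" using y \<open>y = G x\<close> by (auto simp: lo_def hi_def)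
    ultimately show "y \<in> G ` X" by auto
  qed
  with im have eq: "{lo<..<hi} = Z" by simp
  have "lo < hi" using eq uv by (metis greaterThanLessThan_empty_iff not_less)
  then have "lo = u" "hi = v" using eq uv by (metis cInf_greaterThanLessThan, metis cSup_greaterThanLessThan)
  then show ?thesis by (auto simp: lo_def hi_def min_def max_def split: if_splits)
qed

text \<open>Identifies \<open>\<tau>\<close> from the image alone: for a good map both values are 0
  or 1, while for a bad map \<open>T z\<close> takes the end lying in {0,1} and leaves
  \<open>c\<close> for \<open>\<tau>\<close>.\<close>

lemma ends: "{T z, \<tau>} = {u, v}"
proof -
  have "{h z, h c} = {h a, h b}" for h :: "real \<Rightarrow> real" using cz by auto
  from this[of G] show ?thesis by (simp only: G_ends G(3) \<tau>_def)
qed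

lemma G_abs_mono:
  assumes "x \<in> {a..b}" "y \<in> {a..b}" "w \<in> {a..b}" "x \<le> y \<and> y \<le> w \<or> w \<le> y \<and> y \<le> x"
  shows "\<bar>G x - G y\<bar> \<le> \<bar>G x - G w\<bar>"
proof -
  from assms(4) show ?thesis
  proof
    assume *: "x \<le> y \<and> y \<le> w"
    have "s * G x \<le> s * G y" "s * G y \<le> s * G w" using * assms by (auto intro: G_mono)
    then show ?thesis using s_cases by auto
  next
    assume *: "w \<le> y \<and> y \<le> x"
    have "s * G y \<le> s * G x" "s * G w \<le> s * G y" using * assms by (auto intro: G_mono)
    then show ?thesis using s_cases by auto
  qed
qed

lemma Tz_upper: assumes x: "x \<in> X" shows "\<bar>T x - T z\<bar> \<le> M * \<bar>x - z\<bar>"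
proof -
  have "x \<noteq> z" using x cz by auto
  then obtain t where "t \<in> X" "\<bar>G x - G z\<bar> = \<bar>x - z\<bar> * \<bar>der T t\<bar>"
    using G_mvt_abs[of x z] x cz_in by auto
  then show ?thesis using mult_right_mono[OF der_le_M[of t], of "\<bar>x - z\<bar>"] x by (auto simp: G mult.commute)
qed

text \<open>The rate \<open>1 / \<rho>\<close> is the mean of 1 and the absolute derivative at
  \<open>z\<close>, so it persists near \<open>z\<close> by continuity. By monotonicity the second
  estimate reaches all points at distance at least \<open>d\<close>, even those far away from
  \<open>z\<close>.\<close>

lemma expanding_end:
  obtains \<delta> \<rho> where "0 < \<delta>" "0 < \<rho>" "\<rho> < 1"
    "\<And>x. x \<in> X \<Longrightarrow> \<bar>x - z\<bar> < \<delta> \<Longrightarrow> 1 / \<rho> \<le> \<bar>der T x\<bar>"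
    "\<And>x d. x \<in> X \<Longrightarrow> 0 < d \<Longrightarrow> d < \<delta> \<Longrightarrow> d \<le> \<bar>x - z\<bar> \<Longrightarrow> d / \<rho> \<le> \<bar>T x - T z\<bar>"
proof -
  define k where "k = (1 + \<bar>der T z\<bar>) / 2"
  have k: "1 < k" "k < \<bar>der T z\<bar>" using exp by (auto simp: k_def)
  have "(der T \<longlongrightarrow> der T z) (at z within insert z X)"
    using der_continuous(1) by (auto simp: continuous_on)
  then have "((\<lambda>x. \<bar>der T x\<bar>) \<longlongrightarrow> \<bar>der T z\<bar>) (at z within insert z X)" by (rule tendsto_rabs)
  then have "\<forall>\<^sub>F x in at z within insert z X. k < \<bar>der T x\<bar>" using k(2) by (rule order_tendstoD)
  then obtain \<delta> where \<delta>: "0 < \<delta>" "\<And>x. x \<in> insert z X \<Longrightarrow> x \<noteq> z \<Longrightarrow> dist x z < \<delta> \<Longrightarrow> k < \<bar>der T x\<bar>"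
    unfolding eventually_at by blast
  have zX: "z \<notin> X" using cz by auto
  show thesis
  proof
    show "0 < \<delta>" "0 < 1 / k" "1 / k < 1" using \<delta> k by auto
    show 1: "1 / (1 / k) \<le> \<bar>der T x\<bar>" if "x \<in> X" "\<bar>x - z\<bar> < \<delta>" for x
      using \<delta>(2)[of x] that zX by (auto simp: dist_real_def)
    show "d / (1 / k) \<le> \<bar>T x - T z\<bar>" if x: "x \<in> X" "0 < d" "d < \<delta>" "d \<le> \<bar>x - z\<bar>" for x d
    proof -
      \<comment> \<open>The point at distance exactly \<open>d\<close> from \<open>z\<close>, passed
        on the way from \<open>z\<close> to \<open>x\<close>.\<close>
      define y where "y = (if z = a then a + d else b - d)"
      have y: "y \<in> X" "\<bar>y - z\<bar> = d" "z \<le> y \<and> y \<le> x \<or> x \<le> y \<and> y \<le> z"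
        using cz x ab unfolding y_def by (auto split: if_splits)
      have "y \<noteq> z" using y x by auto
      then obtain t where t: "t \<in> X" "min y z < t" "t < max y z" "\<bar>G y - G z\<bar> = \<bar>y - z\<bar> * \<bar>der T t\<bar>"
        using G_mvt_abs[of y z] y(1) cz_in by auto
      have "\<bar>t - z\<bar> < \<delta>" using t y x by (auto simp: min_def max_def split: if_splits)
      then have "k \<le> \<bar>der T t\<bar>" using 1[OF t(1)] by simp
      then have "d * k \<le> \<bar>G z - G y\<bar>" using t y x by (auto simp: abs_minus_commute)
      also have "\<dots> \<le> \<bar>G z - G x\<bar>" using y x cz_in by (intro G_abs_mono) auto
      finally show ?thesis using x G by (auto simp: abs_minus_commute)
    qed
  qed
qed

lemma tau_upper: assumes x: "x \<in> X" shows "\<bar>T x - \<tau>\<bar> \<le> M * \<bar>x - c\<bar> powr e"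
proof -
  have "x \<noteq> c" using x cz by auto
  then obtain t where t: "t \<in> X" "min x c < t" "t < max x c" "\<bar>G x - G c\<bar> = \<bar>x - c\<bar> * \<bar>der T t\<bar>"
    using G_mvt_abs[of x c] x cz_in by auto
  have tc: "\<bar>t - c\<bar> \<le> \<bar>x - c\<bar>" using t(2,3) by (auto simp: min_def max_def split: if_splits)
  have "\<bar>der T t\<bar> \<le> M * \<bar>t - c\<bar> powr (e - 1)" using bounds[OF t(1)] by simp
  also have "\<dots> \<le> M * \<bar>x - c\<bar> powr (e - 1)"
    using tc e1 M_pos by (intro mult_left_mono powr_mono2) auto
  finally have "\<bar>x - c\<bar> * \<bar>der T t\<bar> \<le> \<bar>x - c\<bar> * (M * \<bar>x - c\<bar> powr (e - 1))" by (intro mult_left_mono) auto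
  also have "\<dots> = M * \<bar>x - c\<bar> powr e" using \<open>x \<noteq> c\<close> by (simp add: powr_diff)
  finally show ?thesis using t(4) x by (simp add: G \<tau>_def)
qed

text \<open>The derivative may degenerate towards \<open>c\<close>, so the mean value theorem is
  applied on the half of the interval away from \<open>c\<close>; this is the origin of the division
  by 2. Monotonicity then replaces the midpoint by \<open>c\<close>.\<close>

lemma tau_lower: assumes x: "x \<in> X" shows "K * (\<bar>x - c\<bar> / 2) powr e \<le> \<bar>T x - \<tau>\<bar>"
proof -
  define y where "y = (x + c) / 2"
  have y: "y \<in> X" "\<bar>y - c\<bar> = \<bar>x - c\<bar> / 2" "\<bar>x - y\<bar> = \<bar>x - c\<bar> / 2" "x \<noteq> c" "x \<noteq> y"
    using x cz by (auto simp: y_def abs_if field_simps)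
  obtain t where t: "t \<in> X" "min x y < t" "t < max x y" "\<bar>G x - G y\<bar> = \<bar>x - y\<bar> * \<bar>der T t\<bar>"
    using G_mvt_abs[of x y] x y by auto
  have "x < y \<and> y < c \<or> c < y \<and> y < x" using x cz by (auto simp: y_def)
  then have tc: "\<bar>y - c\<bar> \<le> \<bar>t - c\<bar>" using t(2,3) by auto
  have "K * \<bar>y - c\<bar> powr (e - 1) \<le> K * \<bar>t - c\<bar> powr (e - 1)"
    using tc e1 K0 by (intro mult_left_mono powr_mono2) auto
  also have "\<dots> \<le> \<bar>der T t\<bar>" using bounds[OF t(1)] by simp
  finally have "\<bar>x - y\<bar> * (K * \<bar>y - c\<bar> powr (e - 1)) \<le> \<bar>x - y\<bar> * \<bar>der T t\<bar>" by (intro mult_left_mono) auto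
  then have "(\<bar>x - c\<bar> / 2) * (K * (\<bar>x - c\<bar> / 2) powr (e - 1)) \<le> \<bar>G x - G y\<bar>" unfolding t(4) y(2) y(3) .
  moreover have "(\<bar>x - c\<bar> / 2) * (K * (\<bar>x - c\<bar> / 2) powr (e - 1)) = K * (\<bar>x - c\<bar> / 2) powr e"
    using y by (simp add: powr_diff)
  moreover have "\<bar>G x - G y\<bar> \<le> \<bar>G x - G c\<bar>" using x y(1) cz cz_in by (intro G_abs_mono) (auto simp: y_def)
  ultimately have "K * (\<bar>x - c\<bar> / 2) powr e \<le> \<bar>G x - G c\<bar>" by linarith
  then show ?thesis using x by (simp add: G \<tau>_def)
qed

section \<open>The inverse branch, its derivative and its change of variables\<close>

lemma phi_in: "y \<in> Z \<Longrightarrow> \<phi> y \<in> X" and T_phi: "y \<in> Z \<Longrightarrow> T (\<phi> y) = y"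
  and phi_T: "x \<in> X \<Longrightarrow> \<phi> (T x) = x" and T_in: "x \<in> X \<Longrightarrow> T x \<in> Z"
  using bij bij_betw_inv_into[OF bij] unfolding \<phi>_def bij_betw_def
  by (auto intro: inv_into_into f_inv_into_f inv_into_f_f)

lemma phi_image: "\<phi> ` Z = X"
  using bij bij_betw_inv_into[OF bij] unfolding \<phi>_def bij_betw_def by auto

lemma T_image: "T ` X = Z" using bij by (auto simp: bij_betw_def)

text \<open>The square root is the normalisation that \<open>conc_compose\<close> expects: the
  derivative of \<open>\<phi>\<close> is \<open>s / q^2\<close>.\<close>

definition "q y = sqrt \<bar>der T (\<phi> y)\<bar>"
definition "w y = 1 / \<bar>der T (\<phi> y)\<bar>"

lemma w_q: "w y = 1 / (q y)\<^sup>2" by (simp add: w_def q_def)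

lemma w_pos: "y \<in> Z \<Longrightarrow> 0 < w y"
  using der_nz phi_in by (auto simp: w_def)

lemma phi_deriv: assumes y: "y \<in> Z" shows "(\<phi> has_real_derivative s / (q y)\<^sup>2) (at y)"
proof -
  have "(\<phi> has_real_derivative inverse (der T (\<phi> y))) (at (T (\<phi> y)))"
  proof -
    have "(\<phi> has_derivative (*) (inverse (der T (\<phi> y)))) (at (T (\<phi> y)))"
    proof (rule has_derivative_inverse_strong[where S = X and f = T and x = "\<phi> y" and f' = "(*) (der T (\<phi> y))"])
      show "(T has_derivative (*) (der T (\<phi> y))) (at (\<phi> y))"
        using deriv[OF phi_in[OF y]] by (simp add: has_field_derivative_def)
      show "(*) (der T (\<phi> y)) \<circ> (*) (inverse (der T (\<phi> y))) = id"
        using der_nz[OF phi_in[OF y]] by (auto simp: fun_eq_iff)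
      show "continuous_on X T" using der_continuous(2) by (rule continuous_on_subset) auto
    qed (use phi_in[OF y] phi_T in auto)
    then show ?thesis by (simp add: has_field_derivative_def)
  qed
  moreover have "inverse (der T (\<phi> y)) = s / (q y)\<^sup>2"
    using s_der[OF phi_in[OF y]] s_cases by (auto simp: q_def divide_simps)
  ultimately show ?thesis by (simp add: T_phi[OF y])
qed

lemma phi_deriv': "y \<in> Z \<Longrightarrow> (\<phi> has_real_derivative s * w y) (at y)"
  using phi_deriv[of y] by (simp add: w_q)

text \<open>Non-positive Schwarzian of \<open>T\<close> means that \<open>\<bar>DT\<bar>\<^sup>1\<^sup>/\<^sup>2 \<circ> \<phi>\<close> is concave.\<close>

lemma q_conc: "conc u v q"
proof -
  define D where "D x = \<bar>der T x\<bar>" for x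
  define D1 where "D1 x = s * (der ^^ 2) T x" for x
  define D2 where "D2 x = s * (der ^^ 3) T x" for x
  define q1 where "q1 y = s * D1 (\<phi> y) / (2 * D (\<phi> y) * q y)" for y
  \<comment> \<open>The second derivative of \<open>q\<close>: a positive multiple of the Schwarzian
    at the preimage, so its sign is the hypothesis.\<close>
  define q2 where "q2 y = (1/2) * schwarzian T (\<phi> y) / (q y)^3" for y
  have der_eq: "der T x = s * D x" if "x \<in> X" for x using s_der[OF that] by (simp add: D_def)
  have D_eq: "D x = s * der T x" if "x \<in> X" for x using der_eq[OF that] s_cases by auto
  have Dpos: "0 < D x" if "x \<in> X" for x using der_nz[OF that] by (simp add: D_def)
  have dD: "(D has_real_derivative D1 x) (at x)" if x: "x \<in> X" for x
  proof (rule has_field_derivative_transform_within_open[of "\<lambda>x. s * der T x" _ _ X])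
    show "((\<lambda>x. s * der T x) has_real_derivative D1 x) (at x)"
      unfolding D1_def using der_iter[OF x, of 1] by (intro DERIV_cmult) (simp add: numeral_2_eq_2)
  qed (use x D_eq in auto)
  have dD1: "(D1 has_real_derivative D2 x) (at x)" if x: "x \<in> X" for x
    unfolding D1_def D2_def using der_iter[OF x, of 2] by (intro DERIV_cmult) (simp add: numeral_3_eq_3)
  have "\<forall>y\<in>Z. 0 < q y \<and> (q has_real_derivative q1 y) (at y) \<and> (q1 has_real_derivative q2 y) (at y) \<and> q2 y \<le> 0"
  proof (intro ballI conjI)
    fix y assume y: "y \<in> Z"
    let ?x = "\<phi> y"
    have x: "?x \<in> X" using phi_in[OF y] .
    have qy: "q y = sqrt (D ?x)" by (simp add: q_def D_def)
    show q0: "0 < q y" using Dpos[OF x] by (simp add: qy)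
    have qq: "(q y)\<^sup>2 = D ?x" using Dpos[OF x] by (simp add: qy)
    have d1: "((\<lambda>y. D (\<phi> y)) has_real_derivative D1 ?x * (s / (q y)\<^sup>2)) (at y)"
      by (rule DERIV_chain2[OF dD[OF x] phi_deriv[OF y]])
    have d2: "((\<lambda>y. D1 (\<phi> y)) has_real_derivative D2 ?x * (s / (q y)\<^sup>2)) (at y)"
      by (rule DERIV_chain2[OF dD1[OF x] phi_deriv[OF y]])
    have "((\<lambda>y. sqrt (D (\<phi> y))) has_real_derivative inverse (sqrt (D ?x)) / 2 * (D1 ?x * (s / (q y)\<^sup>2))) (at y)"
      by (rule DERIV_chain2[OF DERIV_real_sqrt[OF Dpos[OF x]] d1])
    moreover have "inverse (sqrt (D ?x)) / 2 * (D1 ?x * (s / (q y)\<^sup>2)) = q1 y"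
      using q0 by (simp add: q1_def qq qy[symmetric] divide_simps)
    moreover have "(\<lambda>y. sqrt (D (\<phi> y))) = q" by (auto simp: q_def D_def)
    ultimately show dq: "(q has_real_derivative q1 y) (at y)" by simp
    have nz: "2 * D ?x * q y \<noteq> 0" using Dpos[OF x] q0 by simp
    have "((\<lambda>y. s * D1 (\<phi> y)) has_real_derivative s * (D2 ?x * (s / (q y)\<^sup>2))) (at y)"
      by (rule DERIV_cmult[OF d2])
    moreover have "((\<lambda>y. 2 * D (\<phi> y) * q y) has_real_derivative
        2 * (D1 ?x * (s / (q y)\<^sup>2)) * q y + q1 y * (2 * D ?x)) (at y)"
      by (rule DERIV_mult[OF DERIV_cmult[OF d1] dq])
    ultimately have "(q1 has_real_derivative
       ((s * (D2 ?x * (s / (q y)\<^sup>2))) * (2 * D ?x * q y) -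
        (s * D1 ?x) * (2 * (D1 ?x * (s / (q y)\<^sup>2)) * q y + q1 y * (2 * D ?x))) /
        ((2 * D ?x * q y) * (2 * D ?x * q y))) (at y)"
      unfolding q1_def[abs_def] using nz by (intro DERIV_divide) auto
    moreover have "((s * (D2 ?x * (s / (q y)\<^sup>2))) * (2 * D ?x * q y) -
        (s * D1 ?x) * (2 * (D1 ?x * (s / (q y)\<^sup>2)) * q y + q1 y * (2 * D ?x))) /
        ((2 * D ?x * q y) * (2 * D ?x * q y)) = q2 y"
    proof -
      have 2: "schwarzian T ?x = D2 ?x / (q y)\<^sup>2 - 3/2 * (D1 ?x / (q y)\<^sup>2)\<^sup>2"
        using s_cases der_eq[OF x] by (auto simp: schwarzian_def D1_def D2_def qq)
      show ?thesis unfolding q2_def 2 q1_def qq[symmetric]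
        using q0 s_cases by (auto simp: field_simps power2_eq_square power3_eq_cube)
    qed
    ultimately show "(q1 has_real_derivative q2 y) (at y)" by simp
    show "q2 y \<le> 0" unfolding q2_def using q0 schw_le[OF x] by (simp add: divide_nonpos_pos mult_nonneg_nonpos)
  qed
  then show ?thesis unfolding conc_def by blast
qed

lemma phi_cont: "continuous_on Z \<phi>"
  by (rule DERIV_continuous_on[OF has_field_derivative_at_within[OF phi_deriv']])

lemma w_cont: "continuous_on Z w"
proof -
  have "continuous_on Z (\<lambda>y. der T (\<phi> y))"
    by (rule continuous_on_compose2[OF continuous_on_subset[OF der_continuous(1), of X] phi_cont]) (use phi_in in auto)
  then show ?thesis unfolding w_def[abs_def] using der_nz[OF phi_in]
    by (intro continuous_intros) auto
qed

lemma cv_phi: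
  assumes f: "f \<in> borel_measurable borel"
  shows "(\<integral>\<^sup>+x\<in>X. f x \<partial>lborel) = (\<integral>\<^sup>+y\<in>Z. f (\<phi> y) * ennreal (w y) \<partial>lborel)"
  using nn_integral_image_Ioo[OF f s_cases phi_deriv' w_pos w_cont] by (simp add: phi_image)

lemma T_deriv_abs: "x \<in> X \<Longrightarrow> (T has_real_derivative s * \<bar>der T x\<bar>) (at x)"
  using deriv[of x] s_der[of x] by simp

lemma der_abs_cont: "continuous_on X (\<lambda>x. \<bar>der T x\<bar>)"
  by (intro continuous_intros continuous_on_subset[OF der_continuous(1)]) auto

lemma cv_T:
  assumes f: "f \<in> borel_measurable borel"
  shows "(\<integral>\<^sup>+y\<in>Z. f y \<partial>lborel) = (\<integral>\<^sup>+x\<in>X. f (T x) * ennreal \<bar>der T x\<bar> \<partial>lborel)"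
  using nn_integral_image_Ioo[OF f s_cases T_deriv_abs _ der_abs_cont] der_nz by (simp add: T_image)

lemma AE_phi: "AE x in lborel. Q x \<Longrightarrow> AE y in lborel. y \<in> Z \<longrightarrow> Q (\<phi> y)"
  by (rule AE_comp_Ioo[OF s_cases phi_deriv' w_pos w_cont])

lemma AE_T: "AE y in lborel. Q y \<Longrightarrow> AE x in lborel. x \<in> X \<longrightarrow> Q (T x)"
  by (rule AE_comp_Ioo[OF s_cases T_deriv_abs _ der_abs_cont]) (auto simp: der_nz)

end

subsection \<open>The random system and its transfer operator\<close>

locale rmap =
  fixes c :: real and N :: nat
    and T :: "nat \<Rightarrow> real \<Rightarrow> real" and p r l :: "nat \<Rightarrow> real"
    and SigmaG SigmaB :: "nat set"
  assumes c01: "0 < c" "c < 1"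
    and maps: "\<forall>j\<in>{1..N}. good_map c (T j) \<or> bad_map c (T j)"
    and G_def: "SigmaG = {j\<in>{1..N}. good_map c (T j)}" and G_ne: "SigmaG \<noteq> {}"
    and B_def: "SigmaB = {j\<in>{1..N}. bad_map c (T j)}" and B_ne: "SigmaB \<noteq> {}"
    and r_exp: "\<forall>g\<in>SigmaG. good_exponent c (T g) (r g)"
    and l_exp: "\<forall>b\<in>SigmaB. bad_exponent c (T b) (l b)"
    and p_pos: "\<forall>j\<in>{1..N}. 0 < p j" and p_sum: "(\<Sum>j\<in>{1..N}. p j) = 1"
begin

definition "J = {1..N}"
definition lo :: "bool \<Rightarrow> real" where "lo i = (if i then 0 else c)"
definition hi :: "bool \<Rightarrow> real" where "hi i = (if i then c else 1)"
definition outer :: "bool \<Rightarrow> real" where "outer i = (if i then 0 else 1)"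
abbreviation "pc i \<equiv> {lo i<..<hi i}"
definition "U = pc True \<union> pc False"
text \<open>Ends of the image of a piece. The default values 0 and 1 serve the full branches of good
  maps and the outer end of the image in the bad case.\<close>

definition "iu j i = (if T j ` pc i = {c<..<1} then c else 0)"
definition "iv j i = (if T j ` pc i = {0<..<c} then c else 1)"
abbreviation "Z j i \<equiv> {iu j i<..<iv j i}"
definition "ee j = (if j \<in> SigmaG then r j else l j)"
definition "KM j = (SOME (K, M). 0 < K \<and> derivative_bounds c (T j) (ee j) K M)"
abbreviation "Phi j i \<equiv> branch.\<phi> (lo i) (hi i) (T j)"
abbreviation "W j i \<equiv> branch.w (lo i) (hi i) (T j)"

lemma lohi: "0 \<le> lo i" "lo i < hi i" "hi i \<le> 1" using c01 by (auto simp: lo_def hi_def)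

lemma fin_J[simp]: "finite J" by (simp add: J_def)

lemma maps_J: "j \<in> J \<Longrightarrow> good_map c (T j) \<or> bad_map c (T j)" using maps by (simp add: J_def)

lemma GB_J: "SigmaG \<union> SigmaB = J" using maps G_def B_def by (auto simp: J_def)

lemma G_J: "g \<in> SigmaG \<Longrightarrow> g \<in> J" and B_J: "b \<in> SigmaB \<Longrightarrow> b \<in> J" using GB_J by auto

lemma fin_GB: "finite SigmaG" "finite SigmaB" using GB_J by (metis finite_Un fin_J)+

lemma good_image: "g \<in> SigmaG \<Longrightarrow> T g ` pc i = {0<..<1}"
  unfolding G_def good_map_def C3_diffeo_def bij_betw_def by (auto simp: lo_def hi_def)

lemma bad_image: "b \<in> SigmaB \<Longrightarrow> T b ` pc i = {0<..<c} \<or> T b ` pc i = {c<..<1}"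
  unfolding B_def bad_map_def C3_diffeo_def bij_betw_def by (auto simp: lo_def hi_def)

lemma intervals_ne: "{0<..<1} \<noteq> {0<..<c}" "{0<..<1} \<noteq> {c<..<1}" "{0<..<c} \<noteq> {c<..<1}"
proof -
  have "(c + 1) / 2 \<in> {0<..<1}" "(c + 1) / 2 \<notin> {0<..<c}" "c / 2 \<in> {0<..<1}" "c / 2 \<in> {0<..<c}" "c / 2 \<notin> {c<..<1}"
    using c01 by auto
  then show "{0<..<1} \<noteq> {0<..<c}" "{0<..<1} \<noteq> {c<..<1}" "{0<..<c} \<noteq> {c<..<1}" by blast+
qed

lemma GB_disj: "j \<in> SigmaG \<Longrightarrow> j \<notin> SigmaB"
  using good_image[of j True] bad_image[of j True] intervals_ne by auto

lemma inj_pc: "j \<in> J \<Longrightarrow> inj_on (T j) (pc i)"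
  using maps_J[of j] unfolding good_map_def bad_map_def C3_diffeo_def bij_betw_def by (auto simp: lo_def hi_def)

lemma image_Z: assumes "j \<in> J" shows "T j ` pc i = Z j i"
proof -
  consider "j \<in> SigmaG" | "j \<in> SigmaB" using GB_J assms by blast
  then show ?thesis
  proof cases
    case 1
    then show ?thesis using good_image[OF 1, of i] intervals_ne by (simp add: iu_def iv_def)
  next
    case 2
    then show ?thesis using bad_image[OF 2, of i] intervals_ne by (auto simp: iu_def iv_def)
  qed
qed

lemma iuv_G: "g \<in> SigmaG \<Longrightarrow> iu g i = 0 \<and> iv g i = 1"
  using good_image[of g i] intervals_ne by (simp add: iu_def iv_def)

lemma iuv_B: "b \<in> SigmaB \<Longrightarrow> iu b i = 0 \<and> iv b i = c \<or> iu b i = c \<and> iv b i = 1"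
  using bad_image[of b i] intervals_ne by (auto simp: iu_def iv_def)

lemma ee_exp:
  assumes "j \<in> J"
  shows "1 \<le> ee j \<and> (\<exists>K M. 0 < K \<and> derivative_bounds c (T j) (ee j) K M)"
proof (cases "j \<in> SigmaG")
  case True
  then have "good_exponent c (T j) (r j)" using r_exp by auto
  then have "1 \<le> r j \<and> (\<exists>K M. 0 < K \<and> derivative_bounds c (T j) (r j) K M)"
    unfolding good_exponent_def by blast
  then show ?thesis using True unfolding ee_def by auto
next
  case False
  then have "j \<in> SigmaB" using GB_J assms by auto
  then have "bad_exponent c (T j) (l j)" using l_exp by auto
  then have "1 < l j \<and> (\<exists>K M. 0 < K \<and> derivative_bounds c (T j) (l j) K M)"
    unfolding bad_exponent_def by blast
  then show ?thesis using False unfolding ee_def by auto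
qed

lemma KM: assumes "j \<in> J" shows "0 < fst (KM j)" "derivative_bounds c (T j) (ee j) (fst (KM j)) (snd (KM j))"
proof -
  obtain K M where "0 < K \<and> derivative_bounds c (T j) (ee j) K M" using ee_exp[OF assms] by blast
  then have "case (K, M) of (K, M) \<Rightarrow> 0 < K \<and> derivative_bounds c (T j) (ee j) K M" by simp
  then have "case KM j of (K, M) \<Rightarrow> 0 < K \<and> derivative_bounds c (T j) (ee j) K M"
    unfolding KM_def by (rule someI)
  then show "0 < fst (KM j)" "derivative_bounds c (T j) (ee j) (fst (KM j)) (snd (KM j))"
    by (auto simp: case_prod_beta)
qed

lemma ee_G: "g \<in> SigmaG \<Longrightarrow> ee g = r g" and ee_B: "b \<in> SigmaB \<Longrightarrow> ee b = l b"
  using GB_disj by (auto simp: ee_def)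

lemma l_gt1: "b \<in> SigmaB \<Longrightarrow> 1 < l b" using l_exp by (auto simp: bad_exponent_def)
lemma r_ge1: "g \<in> SigmaG \<Longrightarrow> 1 \<le> r g" using r_exp by (auto simp: good_exponent_def)

lemma T_outer: "j \<in> J \<Longrightarrow> T j (outer i) \<in> {0, 1}"
  using maps_J[of j] unfolding good_map_def bad_map_def outer_def by auto

lemma branch_inst:
  assumes j: "j \<in> J"
  shows "branch c (outer i) (lo i) (hi i) (iu j i) (iv j i) (T j) (ee j) (fst (KM j)) (snd (KM j))"
proof
  show "0 \<le> lo i" "lo i < hi i" "hi i \<le> 1" by (rule lohi)+
  show "0 \<le> iu j i" "iv j i \<le> 1" using c01 by (auto simp: iu_def iv_def)
  show "iu j i < iv j i"
    using c01 intervals_ne by (auto simp: iu_def iv_def)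
  show "outer i = lo i \<and> c = hi i \<or> outer i = hi i \<and> c = lo i" by (auto simp: lo_def hi_def outer_def)
  show "bij_betw (T j) (pc i) (Z j i)" using inj_pc[OF j] image_Z[OF j] by (auto simp: bij_betw_def)
  have "insert (0::real) {0<..<c} = {0..<c}" "insert (1::real) {c<..<1} = {c<..1}" using c01 by auto
  then show "nonpos_schwarzian_on (T j) (insert (outer i) (pc i))"
    using maps_J[OF j] unfolding good_map_def bad_map_def by (cases i) (auto simp: lo_def hi_def outer_def)
  show "1 \<le> ee j" using ee_exp[OF j] by simp
  show "0 < fst (KM j)" by (rule KM[OF j])
  show "fst (KM j) * \<bar>x - c\<bar> powr (ee j - 1) \<le> \<bar>der (T j) x\<bar> \<and> \<bar>der (T j) x\<bar> \<le> snd (KM j) * \<bar>x - c\<bar> powr (ee j - 1)"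
    if "x \<in> pc i" for x
  proof -
    have "x \<in> {0..1} - {c}" using that c01 by (cases i) (auto simp: lo_def hi_def)
    then show ?thesis using KM(2)[OF j] unfolding derivative_bounds_def by blast
  qed
  show "\<bar>der (T j) (outer i)\<bar> > 1"
    using maps_J[OF j] unfolding good_map_def bad_map_def by (cases i) (auto simp: outer_def)
  show "T j (outer i) \<in> {0, 1}" by (rule T_outer[OF j])
qed

lemma Z_sub: assumes "j \<in> J" shows "Z j i \<subseteq> {0<..<1}"
  using branch.uv[OF branch_inst[OF assms, of i]] by auto

lemma U_alt: "U = {0<..<1} - {c}" using c01 by (auto simp: U_def lo_def hi_def)

lemma pc_U: "pc i \<subseteq> U" by (cases i) (auto simp: U_def)

lemma U_cases: "x \<in> U \<Longrightarrow> (\<And>i. x \<in> pc i \<Longrightarrow> thesis) \<Longrightarrow> thesis" by (auto simp: U_def)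

lemma U_borel[measurable]: "U \<in> sets borel" by (simp add: U_alt)

lemma AE_U: "AE x in lborel. x \<in> {0<..<1} \<longrightarrow> x \<in> U"
proof -
  have "AE x in lborel. x \<noteq> c" by (rule AE_lborel_singleton)
  then show ?thesis by eventually_elim (auto simp: U_alt)
qed

lemma pc_disj: "indicator U x = (\<Sum>i\<in>UNIV. indicator (pc i) x :: ennreal)"
  using c01 by (auto simp: U_def UNIV_bool lo_def hi_def split: split_indicator)

text \<open>The contribution of a single inverse branch to the transfer operator. The indicator
  suppresses the points outside the image, where \<open>Phi\<close> and \<open>W\<close> carry no
  information.\<close>

definition Bop :: "nat \<Rightarrow> bool \<Rightarrow> (real \<Rightarrow> ennreal) \<Rightarrow> real \<Rightarrow> ennreal" where
  "Bop j i f y = f (Phi j i y) * ennreal (W j i y) * indicator (Z j i) y"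

definition P :: "(real \<Rightarrow> ennreal) \<Rightarrow> real \<Rightarrow> ennreal" where
  "P f y = (\<Sum>j\<in>J. \<Sum>i\<in>UNIV. ennreal (p j) * Bop j i f y)"

lemma Bop_measurable[measurable (raw)]:
  assumes j: "j \<in> J" and f: "f \<in> borel_measurable borel"
  shows "Bop j i f \<in> borel_measurable borel"
proof -
  interpret b: branch c "outer i" "lo i" "hi i" "iu j i" "iv j i" "T j" "ee j" "fst (KM j)" "snd (KM j)"
    by (rule branch_inst[OF j])
  have "(\<lambda>y. f (Phi j i y) * indicator (Z j i) y) \<in> borel_measurable borel"
    by (rule borel_measurable_comp_continuous_on[OF f _ b.phi_cont]) auto
  moreover have "(\<lambda>y. indicator (Z j i) y *\<^sub>R W j i y) \<in> borel_measurable borel"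
    by (rule borel_measurable_continuous_on_indicator[OF _ b.w_cont]) auto
  ultimately have "(\<lambda>y. (f (Phi j i y) * indicator (Z j i) y) * ennreal (indicator (Z j i) y *\<^sub>R W j i y)) \<in> borel_measurable borel"
    by measurable
  moreover have "(f (Phi j i y) * indicator (Z j i) y) * ennreal (indicator (Z j i) y *\<^sub>R W j i y) = Bop j i f y" for y
    by (auto simp: Bop_def split: split_indicator)
  ultimately show ?thesis by simp
qed

lemma P_measurable[measurable (raw)]:
  assumes [measurable]: "f \<in> borel_measurable borel" shows "P f \<in> borel_measurable borel"
  unfolding P_def by measurable

lemma T_comp_measurable:
  assumes j: "j \<in> J" and f: "f \<in> borel_measurable borel"
  shows "(\<lambda>x. f (T j x) * indicator (pc i) x :: ennreal) \<in> borel_measurable borel"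
proof -
  interpret b: branch c "outer i" "lo i" "hi i" "iu j i" "iv j i" "T j" "ee j" "fst (KM j)" "snd (KM j)"
    by (rule branch_inst[OF j])
  show ?thesis
    by (rule borel_measurable_comp_continuous_on[OF f]) (auto intro: continuous_on_subset[OF b.der_continuous(2)])
qed

lemma T_comp_measurable_U:
  assumes j: "j \<in> J" and f: "f \<in> borel_measurable borel"
  shows "(\<lambda>x. f (T j x) * indicator U x :: ennreal) \<in> borel_measurable borel"
  unfolding pc_disj sum_distrib_left by (intro borel_measurable_sum T_comp_measurable[OF j f])

lemma Bop_dual:
  assumes j: "j \<in> J" and f[measurable]: "f \<in> borel_measurable borel" and psi[measurable]: "\<psi> \<in> borel_measurable borel"
  shows "(\<integral>\<^sup>+y. \<psi> y * Bop j i f y \<partial>lborel) = (\<integral>\<^sup>+x\<in>pc i. \<psi> (T j x) * f x \<partial>lborel)"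
proof -
  interpret b: branch c "outer i" "lo i" "hi i" "iu j i" "iv j i" "T j" "ee j" "fst (KM j)" "snd (KM j)"
    by (rule branch_inst[OF j])
  let ?h = "\<lambda>x. \<psi> (T j x) * indicator (pc i) x * f x"
  note [measurable] = T_comp_measurable[OF j psi, of i]
  have "(\<integral>\<^sup>+x\<in>pc i. \<psi> (T j x) * f x \<partial>lborel) = (\<integral>\<^sup>+x\<in>pc i. ?h x \<partial>lborel)"
    by (intro nn_integral_cong) (auto split: split_indicator)
  also have "\<dots> = (\<integral>\<^sup>+y\<in>Z j i. ?h (Phi j i y) * ennreal (W j i y) \<partial>lborel)"
    by (rule b.cv_phi) measurable
  also have "\<dots> = (\<integral>\<^sup>+y. \<psi> y * Bop j i f y \<partial>lborel)"
    using b.phi_in b.T_phi by (intro nn_integral_cong) (auto simp: Bop_def mult_ac split: split_indicator)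
  finally show ?thesis by simp
qed

text \<open>All contact between \<open>P\<close> and the dynamics goes through this duality: the
  constant 1 as test function gives conservation of mass, indicators give the evolution of sets, and
  logarithmic distances give the drift inequalities.\<close>

lemma P_dual:
  assumes [measurable]: "f \<in> borel_measurable borel" and psi[measurable]: "\<psi> \<in> borel_measurable borel"
  shows "(\<integral>\<^sup>+y. \<psi> y * P f y \<partial>lborel) = (\<Sum>j\<in>J. ennreal (p j) * (\<integral>\<^sup>+x\<in>U. \<psi> (T j x) * f x \<partial>lborel))"
proof -
  have "(\<integral>\<^sup>+y. \<psi> y * P f y \<partial>lborel) = (\<integral>\<^sup>+y. (\<Sum>j\<in>J. \<Sum>i\<in>UNIV. ennreal (p j) * (\<psi> y * Bop j i f y)) \<partial>lborel)"
    unfolding P_def sum_distrib_left by (intro nn_integral_cong sum.cong refl) (simp add: mult_ac)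
  also have "\<dots> = (\<Sum>j\<in>J. \<Sum>i\<in>UNIV. ennreal (p j) * (\<integral>\<^sup>+y. \<psi> y * Bop j i f y \<partial>lborel))"
    by (simp add: nn_integral_sum nn_integral_cmult Bop_measurable)
  also have "\<dots> = (\<Sum>j\<in>J. ennreal (p j) * (\<integral>\<^sup>+x\<in>U. \<psi> (T j x) * f x \<partial>lborel))"
  proof (intro sum.cong refl)
    fix j assume j: "j \<in> J"
    note [measurable] = T_comp_measurable[OF j psi]
    have "(\<integral>\<^sup>+x\<in>U. \<psi> (T j x) * f x \<partial>lborel) = (\<integral>\<^sup>+x. (\<Sum>i\<in>UNIV. \<psi> (T j x) * indicator (pc i) x * f x) \<partial>lborel)"
      unfolding pc_disj by (intro nn_integral_cong) (simp add: sum_distrib_left mult_ac)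
    also have "\<dots> = (\<Sum>i\<in>UNIV. \<integral>\<^sup>+x. \<psi> (T j x) * indicator (pc i) x * f x \<partial>lborel)"
      by (rule nn_integral_sum) measurable
    also have "\<dots> = (\<Sum>i\<in>UNIV. \<integral>\<^sup>+y. \<psi> y * Bop j i f y \<partial>lborel)"
      using j by (intro sum.cong refl) (simp add: Bop_dual mult_ac)
    finally show "(\<Sum>i\<in>UNIV. ennreal (p j) * (\<integral>\<^sup>+y. \<psi> y * Bop j i f y \<partial>lborel)) = ennreal (p j) * (\<integral>\<^sup>+x\<in>U. \<psi> (T j x) * f x \<partial>lborel)"
      by (simp add: sum_distrib_left)
  qed
  finally show ?thesis .
qed

lemma p_ge0: "j \<in> J \<Longrightarrow> 0 \<le> p j" using p_pos by (auto simp: J_def intro: less_imp_le)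

lemma p_sum_ennreal: "(\<Sum>j\<in>J. ennreal (p j)) = 1"
  using p_ge0 p_sum by (subst sum_ennreal) (auto simp: J_def)

lemma P_mass:
  assumes "f \<in> borel_measurable borel"
  shows "(\<integral>\<^sup>+y. P f y \<partial>lborel) = (\<integral>\<^sup>+x\<in>U. f x \<partial>lborel)"
  using P_dual[OF assms, of "\<lambda>_. 1"] p_sum_ennreal by (simp add: sum_distrib_right[symmetric])

lemma Phi_U: "j \<in> J \<Longrightarrow> y \<in> Z j i \<Longrightarrow> Phi j i y \<in> pc i"
  by (rule branch.phi_in[OF branch_inst])

lemma P_mono: "(\<And>x. x \<in> U \<Longrightarrow> f x \<le> g x) \<Longrightarrow> P f y \<le> P g y"
proof -
  assume *: "\<And>x. x \<in> U \<Longrightarrow> f x \<le> g x"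
  have "Bop j i f y \<le> Bop j i g y" if "j \<in> J" for j i
    unfolding Bop_def using *[of "Phi j i y"] Phi_U[OF that, of y i] pc_U[of i]
    by (auto split: split_indicator intro!: mult_right_mono)
  then show ?thesis unfolding P_def by (intro sum_mono mult_left_mono) auto
qed

lemma P_outside: "y \<notin> {0<..<1} \<Longrightarrow> P f y = 0"
proof -
  assume "y \<notin> {0<..<1}"
  then have "Bop j i f y = 0" if "j \<in> J" for j i
    unfolding Bop_def using Z_sub[OF that, of i] by (auto simp: indicator_def)
  then show ?thesis unfolding P_def by simp
qed

lemma P_add: "P (\<lambda>x. f x + g x) y = P f y + P g y"
  unfolding P_def Bop_def by (simp add: sum.distrib distrib_left distrib_right)

lemma P_cmult: "P (\<lambda>x. k * f x) y = k * P f y"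
  unfolding P_def Bop_def by (simp add: sum_distrib_left mult_ac)

lemma P_zero: "P (\<lambda>x. 0) y = 0"
  unfolding P_def Bop_def by simp

lemma P_sum: "finite I \<Longrightarrow> P (\<lambda>x. \<Sum>k\<in>I. f k x) y = (\<Sum>k\<in>I. P (f k) y)"
  by (induction I rule: finite_induct) (auto simp: P_add P_zero)

text \<open>The Markov property of the partition at \<open>c\<close>. It is the reason for attaching
  cones to the two pieces separately: a bad branch ends at \<open>c\<close> and may create a jump
  there.\<close>

lemma Z_cases: assumes "j \<in> J" shows "pc i' \<subseteq> Z j i \<or> pc i' \<inter> Z j i = {}"
proof -
  consider "j \<in> SigmaG" | "j \<in> SigmaB" using GB_J assms by blast
  then show ?thesis
    using iuv_G[of j i] iuv_B[of j i] c01 by cases (auto simp: lo_def hi_def)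
qed

lemma Bop_cone_sub:
  assumes j: "j \<in> J" and f: "cone (lo i) (hi i) f" and sub: "{a<..<b} \<subseteq> Z j i" "iu j i \<le> a" "b \<le> iv j i"
  shows "cone a b (Bop j i f)"
proof -
  interpret b: branch c "outer i" "lo i" "hi i" "iu j i" "iv j i" "T j" "ee j" "fst (KM j)" "snd (KM j)"
    by (rule branch_inst[OF j])
  have "cone a b (\<lambda>y. f (Phi j i y) * ennreal (1 / (b.q y)\<^sup>2))"
    by (rule cone_branch[OF f conc_subinterval[OF b.q_conc sub(2,3)] b.s_cases])
      (use sub b.phi_in b.phi_deriv in auto)
  then show ?thesis
    by (rule cone_cong) (use sub in \<open>auto simp: Bop_def b.w_q\<close>)
qed

text \<open>A good branch is full, so what it transports has no break at \<open>c\<close> and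
  belongs to the cone of the whole interval. This later gives bounds across
  \<open>c\<close>.\<close>

lemma Bop_cone_good:
  assumes "g \<in> SigmaG" "cone (lo i) (hi i) f" shows "cone 0 1 (Bop g i f)"
  using assms iuv_G[of g i] by (intro Bop_cone_sub) (auto simp: G_J)

lemma P_cone:
  assumes f: "\<And>i. cone (lo i) (hi i) f" shows "cone (lo i') (hi i') (P f)"
  unfolding P_def[abs_def]
proof (intro cone_sum)
  fix j i assume j: "j \<in> J"
  have "cone (lo i') (hi i') (Bop j i f)"
  proof (cases "pc i' \<subseteq> Z j i")
    case True
    then have "iu j i \<le> lo i'" "hi i' \<le> iv j i"
      using lohi[of i'] by (auto simp: greaterThanLessThan_subseteq_greaterThanLessThan)
    then show ?thesis using True by (intro Bop_cone_sub[OF j f])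
  next
    case False
    then have "pc i' \<inter> Z j i = {}" using Z_cases[OF j] by blast
    then have "Bop j i f y = 0" if "y \<in> pc i'" for y using that by (auto simp: Bop_def indicator_def)
    then show ?thesis by (intro cone_cong[OF cone_zero]) auto
  qed
  then show "cone (lo i') (hi i') (\<lambda>y. ennreal (p j) * Bop j i f y)" by (rule cone_scale) simp
qed auto

subsection \<open>Invariant densities have full support\<close>

lemma T_U: "j \<in> J \<Longrightarrow> x \<in> U \<Longrightarrow> T j x \<in> {0<..<1}"
  using branch.T_in[OF branch_inst] Z_sub by (blast elim: U_cases)

text \<open>Each branch pulls null sets back to null sets; by induction the points that leave
  \<open>U\<close> at some time form a null set.\<close>

lemma AE_orbit:
  assumes g: "g \<in> SigmaG"
  shows "AE x in lborel. x \<in> {0<..<1} \<longrightarrow> (\<forall>n. (T g ^^ n) x \<in> U)"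
proof -
  note gJ = G_J[OF g]
  have "AE x in lborel. x \<in> {0<..<1} \<longrightarrow> (T g ^^ n) x \<in> U" for n
  proof (induction n)
    case 0 then show ?case using AE_U by simp
  next
    case (Suc n)
    from branch.AE_T[OF branch_inst[OF gJ, of True] Suc] branch.AE_T[OF branch_inst[OF gJ, of False] Suc] AE_U
    show ?case
    proof eventually_elim
      case (elim x)
      show ?case
      proof
        assume "x \<in> {0<..<1}"
        then have "x \<in> U" using elim by auto
        then obtain i where "x \<in> pc i" by (rule U_cases)
        then have "(T g ^^ n) (T g x) \<in> U" using elim T_U[OF gJ \<open>x \<in> U\<close>] by (cases i) auto
        then show "(T g ^^ Suc n) x \<in> U" by (simp add: funpow_swap1)
      qed
    qed
  qed
  then have "AE x in lborel. \<forall>n. x \<in> {0<..<1} \<longrightarrow> (T g ^^ n) x \<in> U"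
    by (simp only: AE_all_countable) blast
  then show ?thesis by eventually_elim auto
qed

text \<open>The endpoints are repelling, so orbits return to the middle of the interval forever.\<close>

lemma recurrent:
  assumes g: "g \<in> SigmaG"
  obtains \<delta>0 where "0 < \<delta>0" "\<And>\<delta> x n. 0 < \<delta> \<Longrightarrow> \<delta> \<le> \<delta>0 \<Longrightarrow> (\<forall>n. (T g ^^ n) x \<in> U) \<Longrightarrow>
     \<exists>m\<ge>n. (T g ^^ m) x \<in> {\<delta>..1-\<delta>}"
proof -
  note gJ = G_J[OF g]
  define M where "M = snd (KM g)"
  have M: "0 < M" unfolding M_def by (rule branch.M_pos[OF branch_inst[OF gJ]])
  have "\<exists>\<delta> \<rho>. 0 < \<delta> \<and> 0 < \<rho> \<and> \<rho> < 1 \<and> (\<forall>x\<in>pc i. \<bar>x - outer i\<bar> < \<delta> \<longrightarrow> \<bar>x - outer i\<bar> / \<rho> \<le> \<bar>T g x - T g (outer i)\<bar>)" for i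
  proof -
    interpret b: branch c "outer i" "lo i" "hi i" "iu g i" "iv g i" "T g" "ee g" "fst (KM g)" "snd (KM g)"
      by (rule branch_inst[OF gJ])
    obtain \<delta> \<rho> where 1: "0 < \<delta>" "0 < \<rho>" "\<rho> < 1"
       "\<And>x d. x \<in> pc i \<Longrightarrow> 0 < d \<Longrightarrow> d < \<delta> \<Longrightarrow> d \<le> \<bar>x - outer i\<bar> \<Longrightarrow> d / \<rho> \<le> \<bar>T g x - T g (outer i)\<bar>"
      by (rule b.expanding_end) blast
    have "\<bar>x - outer i\<bar> > 0" if "x \<in> pc i" for x using that c01 by (cases i) (auto simp: outer_def lo_def hi_def)
    then show ?thesis using 1 by blast
  qed
  then obtain \<delta> \<rho> where dr: "\<And>i::bool. 0 < \<delta> i" "\<And>i. 0 < \<rho> i" "\<And>i. \<rho> i < 1"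
    "\<And>i x. x \<in> pc i \<Longrightarrow> \<bar>x - outer i\<bar> < \<delta> i \<Longrightarrow> \<bar>x - outer i\<bar> / \<rho> i \<le> \<bar>T g x - T g (outer i)\<bar>" by metis
  define R where "R = max (\<rho> True) (\<rho> False)"
  have R: "0 < R" "R < 1" "\<rho> i \<le> R" for i using dr(2,3)[of True] dr(2,3)[of False] unfolding R_def by (auto, cases i, auto)
  \<comment> \<open>The entry \<open>1 / (2 * M)\<close> keeps the image within 1/2 of the image of
    the endpoint, so that its distance from that endpoint is its distance from {0,1}.\<close>
  define \<delta>0 where "\<delta>0 = Min {\<delta> True, \<delta> False, c, 1 - c, 1/2, 1 / (2 * M)}"
  have d0: "0 < \<delta>0" "\<delta>0 \<le> \<delta> i" "\<delta>0 \<le> c" "\<delta>0 \<le> 1 - c" "\<delta>0 \<le> 1/2" "\<delta>0 \<le> 1 / (2 * M)" for i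
  proof -
    show "0 < \<delta>0" unfolding \<delta>0_def using dr(1) c01 M by (subst Min_gr_iff) auto
    show "\<delta>0 \<le> \<delta> i" unfolding \<delta>0_def by (cases i; rule Min_le; simp)
    show "\<delta>0 \<le> c" "\<delta>0 \<le> 1 - c" "\<delta>0 \<le> 1/2" "\<delta>0 \<le> 1 / (2 * M)" unfolding \<delta>0_def by (rule Min_le; simp)+
  qed
  define d where "d y = min y (1 - y :: real)" for y
  have step: "d y / R \<le> d (T g y)" if y: "y \<in> U" "d y < \<delta>0" for y
  proof -
    obtain i where i: "y \<in> pc i" "\<bar>y - outer i\<bar> = d y"
    proof (cases "y < 1/2")
      case True
      then have "y < \<delta>0" "0 < y" using y by (auto simp: d_def U_alt)
      then show ?thesis using that[of True] d0 True by (auto simp: lo_def hi_def outer_def d_def)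
    next
      case False
      then have "1 - y < \<delta>0" "y < 1" using y by (auto simp: d_def U_alt)
      then show ?thesis using that[of False] d0 False by (auto simp: lo_def hi_def outer_def d_def)
    qed
    have dpos: "0 < d y" using y by (auto simp: d_def U_alt)
    have 1: "d y / \<rho> i \<le> \<bar>T g y - T g (outer i)\<bar>" using dr(4)[OF i(1)] i(2) y(2) d0(2)[of i] by auto
    have "\<bar>T g y - T g (outer i)\<bar> \<le> M * \<bar>y - outer i\<bar>"
      unfolding M_def by (rule branch.Tz_upper[OF branch_inst[OF gJ] i(1)])
    also have "\<dots> \<le> M * (1 / (2 * M))" using i(2) y(2) d0(6) M by (intro mult_left_mono) auto
    also have "\<dots> = 1/2" using M by simp
    finally have 2: "\<bar>T g y - T g (outer i)\<bar> \<le> 1/2" .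
    have "T g y \<in> {0<..<1}" by (rule T_U[OF gJ y(1)])
    then have "d (T g y) = \<bar>T g y - T g (outer i)\<bar>"
      using 2 T_outer[OF gJ, of i] by (auto simp: d_def)
    moreover have "d y / R \<le> d y / \<rho> i" using R dr(2)[of i] dpos by (intro divide_left_mono) auto
    ultimately show ?thesis using 1 by simp
  qed
  show thesis
  proof (rule that[OF d0(1)])
    fix \<delta> x n assume \<delta>: "0 < \<delta>" "\<delta> \<le> \<delta>0" and x: "\<forall>n. (T g ^^ n) x \<in> U"
    show "\<exists>m\<ge>n. (T g ^^ m) x \<in> {\<delta>..1-\<delta>}"
    proof (rule ccontr)
      assume no: "\<not> ?thesis"
      have out: "d ((T g ^^ m) x) < \<delta>" if "n \<le> m" for m
      proof -
        have "(T g ^^ m) x \<notin> {\<delta>..1-\<delta>}" using no that by blast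
        then show ?thesis by (auto simp: d_def min_less_iff_disj)
      qed
      have grow: "d ((T g ^^ n) x) / R ^ k \<le> d ((T g ^^ (n + k)) x)" for k
      proof (induction k)
        case (Suc k)
        have "d ((T g ^^ n) x) / R ^ Suc k = (d ((T g ^^ n) x) / R ^ k) / R" by simp
        also have "\<dots> \<le> d ((T g ^^ (n + k)) x) / R" using Suc R by (intro divide_right_mono) auto
        also have "\<dots> \<le> d (T g ((T g ^^ (n + k)) x))" using step x out[of "n + k"] \<delta> by auto
        finally show ?case by simp
      qed simp
      have pos: "0 < d ((T g ^^ n) x)" using x by (auto simp: d_def U_alt)
      obtain k where "R ^ k < d ((T g ^^ n) x) / \<delta>" using real_arch_pow_inv[of "d ((T g ^^ n) x) / \<delta>" R] R pos \<delta> by auto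
      then have "\<delta> < d ((T g ^^ n) x) / R ^ k" using \<delta> R by (simp add: field_simps)
      then show False using grow[of k] out[of "n + k"] by simp
    qed
  qed
qed

text \<open>Iterated inverse branches of a good map along a symbol sequence, and the reciprocal square
  roots of their derivatives.\<close>

primrec wb :: "nat \<Rightarrow> (nat \<Rightarrow> bool) \<Rightarrow> nat \<Rightarrow> real \<Rightarrow> real" where
  "wb g \<iota> 0 y = y"
| "wb g \<iota> (Suc n) y = wb g \<iota> n (Phi g (\<iota> n) y)"

primrec wq :: "nat \<Rightarrow> (nat \<Rightarrow> bool) \<Rightarrow> nat \<Rightarrow> real \<Rightarrow> real" where
  "wq g \<iota> 0 y = 1"
| "wq g \<iota> (Suc n) y = wq g \<iota> n (Phi g (\<iota> n) y) * branch.q (lo (\<iota> n)) (hi (\<iota> n)) (T g) y"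

text \<open>Composition keeps the reciprocal square root of the derivative concave without any loss
  in \<open>n\<close>, so one distortion constant serves branches of every length.\<close>

lemma wb_props:
  assumes g: "g \<in> SigmaG"
  shows "conc 0 1 (wq g \<iota> n) \<and> (\<exists>s. (s = 1 \<or> s = -1) \<and>
    (\<forall>y\<in>{0<..<1}. wb g \<iota> n y \<in> {0<..<1} \<and> (wb g \<iota> n has_real_derivative s / (wq g \<iota> n y)\<^sup>2) (at y)))"
proof (induction n)
  case 0
  have "wq g \<iota> 0 = (\<lambda>_. 1)" "wb g \<iota> 0 = (\<lambda>y. y)" by auto
  then show ?case using conc_const[of 1 0 1] by (auto intro!: exI[of _ 1] derivative_eq_intros)
next
  case (Suc n)
  note gJ = G_J[OF g]
  let ?i = "\<iota> n"
  interpret b: branch c "outer ?i" "lo ?i" "hi ?i" "iu g ?i" "iv g ?i" "T g" "ee g" "fst (KM g)" "snd (KM g)"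
    by (rule branch_inst[OF gJ])
  have Z: "{iu g ?i<..<iv g ?i} = {0<..<1}" "iu g ?i = 0" "iv g ?i = 1" using iuv_G[OF g, of ?i] by auto
  have ph: "Phi g ?i y \<in> {0<..<1}" if "y \<in> {0<..<1}" for y
    using b.phi_in[of y] that Z lohi[of ?i] by auto
  have dph: "(b.\<phi> has_real_derivative b.s / (b.q y)\<^sup>2) (at y)" if "y \<in> {0<..<1}" for y
    using b.phi_deriv[of y] that Z by auto
  obtain s where s: "s = 1 \<or> s = -1" "\<And>y. y\<in>{0<..<1} \<Longrightarrow> wb g \<iota> n y \<in> {0<..<1} \<and>
      (wb g \<iota> n has_real_derivative s / (wq g \<iota> n y)\<^sup>2) (at y)" using Suc by blast
  have q: "conc 0 1 b.q" using b.q_conc Z by simp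
  have "conc 0 1 (\<lambda>y. wq g \<iota> n (Phi g ?i y) * b.q y)"
    by (rule conc_compose[OF _ q b.s_cases ph dph]) (use Suc in auto)
  moreover have "wq g \<iota> (Suc n) = (\<lambda>y. wq g \<iota> n (Phi g ?i y) * b.q y)" by auto
  moreover have "wb g \<iota> (Suc n) = (\<lambda>y. wb g \<iota> n (Phi g ?i y))" by auto
  moreover have "wb g \<iota> n (Phi g ?i y) \<in> {0<..<1} \<and>
     ((\<lambda>y. wb g \<iota> n (Phi g ?i y)) has_real_derivative (s * b.s) / (wq g \<iota> n (Phi g ?i y) * b.q y)\<^sup>2) (at y)"
    if y: "y \<in> {0<..<1}" for y
    using s(2)[OF ph[OF y]] DERIV_chain2[of "wb g \<iota> n" "s / (wq g \<iota> n (Phi g ?i y))\<^sup>2" b.\<phi> y, OF _ dph[OF y]]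
    by (simp add: power_mult_distrib)
  moreover have "s * b.s = 1 \<or> s * b.s = -1" using s(1) b.s_cases by auto
  ultimately show ?case by (intro conjI exI[of _ "s * b.s"] ballI) simp_all
qed

lemma wq_pos: "g \<in> SigmaG \<Longrightarrow> y \<in> {0<..<1} \<Longrightarrow> 0 < wq g \<iota> n y"
  using wb_props conc_pos by blast

lemma wq_cont: assumes g: "g \<in> SigmaG" shows "continuous_on {0<..<1} (\<lambda>y. 1 / (wq g \<iota> n y)\<^sup>2)"
proof -
  have "continuous_on {0<..<1} (wq g \<iota> n)"
  proof -
    obtain v' where "\<And>y. y \<in> {0<..<1} \<Longrightarrow> (wq g \<iota> n has_real_derivative v' y) (at y)"
      using wb_props[OF g, of \<iota> n] unfolding conc_def by blast
    then show ?thesis by (rule DERIV_continuous_on[OF has_field_derivative_at_within])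
  qed
  then show ?thesis using wq_pos[OF g] by (intro continuous_intros) (auto simp: less_imp_neq[symmetric])
qed

text \<open>The image of \<open>(0,1)\<close> under an iterated inverse branch loses a definite proportion of
  the middle part at every step, and so the derivative of the branches at \<open>1/2\<close> is summable.\<close>

lemma wq_half_tendsto:
  assumes g: "g \<in> SigmaG"
  shows "(\<lambda>n. 1 / (wq g \<iota> n (1/2))\<^sup>2) \<longlonglongrightarrow> 0"
proof -
  note gJ = G_J[OF g]
  define e where "e = min c (1 - c) / 2"
  have e: "0 < e" "e < c" "e < 1 - c" "e < 1/2" "e + e \<le> c" "e + e \<le> 1 - c" using c01 by (auto simp: e_def)
  define \<kappa> where "\<kappa> n = 1 / (wq g \<iota> n (1/2))\<^sup>2" for n
  define h where "h n y = ennreal (1 / (wq g \<iota> n y)\<^sup>2) * indicator {0<..<1} y" for n y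
  have h[measurable]: "h n \<in> borel_measurable borel" for n
  proof -
    have "(\<lambda>y. indicator {0<..<1} y *\<^sub>R (1 / (wq g \<iota> n y)\<^sup>2)) \<in> borel_measurable borel"
      by (rule borel_measurable_continuous_on_indicator[OF _ wq_cont[OF g]]) auto
    then have "(\<lambda>y. ennreal (indicator {0<..<1} y *\<^sub>R (1 / (wq g \<iota> n y)\<^sup>2))) \<in> borel_measurable borel" by measurable
    moreover have "h n = (\<lambda>y. ennreal (indicator {0<..<1} y *\<^sub>R (1 / (wq g \<iota> n y)\<^sup>2)))"
      by (auto simp: h_def fun_eq_iff split: split_indicator)
    ultimately show ?thesis by simp
  qed
  \<comment> \<open>The length of the image of (0,1) under \<open>wb g \<iota> n\<close>.\<close>
  define A where "A n = (\<integral>\<^sup>+y. h n y \<partial>lborel)" for n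
  have A_split: "A n = (\<integral>\<^sup>+y\<in>pc i. h n y \<partial>lborel) + (\<integral>\<^sup>+y\<in>pc (\<not> i). h n y \<partial>lborel)" for n i
  proof -
    have "(\<integral>\<^sup>+y\<in>pc i. h n y \<partial>lborel) + (\<integral>\<^sup>+y\<in>pc (\<not> i). h n y \<partial>lborel) = (\<integral>\<^sup>+y. h n y * indicator (pc i) y + h n y * indicator (pc (\<not> i)) y \<partial>lborel)"
      by (rule nn_integral_add[symmetric]) measurable
    also have "\<dots> = A n"
      unfolding A_def
    proof (rule nn_integral_cong_AE)
      show "AE x in lborel. h n x * indicator (pc i) x + h n x * indicator (pc (\<not> i)) x = h n x"
        using AE_U by eventually_elim (cases i, auto simp: h_def U_def lo_def hi_def split: split_indicator)
    qed
    finally show ?thesis by simp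
  qed
  have A_Suc: "A (Suc n) = (\<integral>\<^sup>+y\<in>pc (\<iota> n). h n y \<partial>lborel)" for n
  proof -
    let ?i = "\<iota> n"
    interpret b: branch c "outer ?i" "lo ?i" "hi ?i" "iu g ?i" "iv g ?i" "T g" "ee g" "fst (KM g)" "snd (KM g)"
      by (rule branch_inst[OF gJ])
    have Z: "{iu g ?i<..<iv g ?i} = {0<..<1}" using iuv_G[OF g, of ?i] by auto
    have "(\<integral>\<^sup>+y\<in>pc ?i. h n y \<partial>lborel) = (\<integral>\<^sup>+y\<in>Z g ?i. h n (b.\<phi> y) * ennreal (b.w y) \<partial>lborel)"
      by (rule b.cv_phi) measurable
    also have "\<dots> = A (Suc n)"
      unfolding A_def
    proof (intro nn_integral_cong)
      fix y
      have "b.\<phi> y \<in> {0<..<1}" if "y \<in> {0<..<1}" using b.phi_in[of y] that Z lohi[of ?i] by auto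
      then show "h n (b.\<phi> y) * ennreal (b.w y) * indicator (Z g ?i) y = h (Suc n) y"
        unfolding Z by (auto simp: h_def b.w_q ennreal_mult'[symmetric] power_mult_distrib split: split_indicator)
    qed
    finally show ?thesis by simp
  qed
  \<comment> \<open>Both halves of the interval contribute: each contains an interval of length at
    least \<open>e\<close> on which, by distortion, the derivative is at least \<open>e^2\<close>
    times its value at 1/2. One half is lost in the next step.\<close>
  have low: "ennreal (e^3 * \<kappa> n) \<le> (\<integral>\<^sup>+y\<in>pc i. h n y \<partial>lborel)" for n i
  proof -
    define I where "I = (if i then {e..c} else {c..1-e})"
    have "ennreal (e^3 * \<kappa> n) = ennreal (e\<^sup>2 * \<kappa> n) * ennreal e"
      using e by (simp add: ennreal_mult'[symmetric] power2_eq_square power3_eq_cube mult_ac)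
    also have "\<dots> \<le> ennreal (e\<^sup>2 * \<kappa> n) * emeasure lborel I"
      using e by (intro mult_left_mono) (auto simp: I_def ennreal_leI)
    also have "\<dots> = (\<integral>\<^sup>+y\<in>I. ennreal (e\<^sup>2 * \<kappa> n) \<partial>lborel)" by (simp add: I_def nn_integral_cmult_indicator)
    also have "\<dots> \<le> (\<integral>\<^sup>+y\<in>pc i. h n y \<partial>lborel)"
    proof (rule nn_integral_mono_AE)
      have "AE y in lborel. y \<noteq> c" by (rule AE_lborel_singleton)
      then show "AE y in lborel. ennreal (e\<^sup>2 * \<kappa> n) * indicator I y \<le> h n y * indicator (pc i) y"
      proof eventually_elim
        case (elim y)
        show ?case
        proof (cases "y \<in> I")
          case True
          then have y: "y \<in> pc i" "y \<in> {0<..<1}" "y \<in> {0+e..1-e}" using elim e by (auto simp: I_def lo_def hi_def split: if_splits)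
          have "wq g \<iota> n y \<le> (1 - 0) / e * wq g \<iota> n (1/2)"
            by (rule conc_ratio[OF _ e(1)]) (use wb_props[OF g] y e in auto)
          then have "e * wq g \<iota> n y \<le> wq g \<iota> n (1/2)" using e by (simp add: field_simps)
          then have "(e * wq g \<iota> n y)\<^sup>2 \<le> (wq g \<iota> n (1/2))\<^sup>2"
            using e wq_pos[OF g y(2)] by (intro power_mono) (auto intro: less_imp_le)
          then have "e\<^sup>2 * \<kappa> n \<le> 1 / (wq g \<iota> n y)\<^sup>2"
            using wq_pos[OF g y(2), of \<iota> n] wq_pos[OF g, of "1/2" \<iota> n] by (simp add: \<kappa>_def field_simps power_mult_distrib)
          then show ?thesis using y True by (simp add: h_def ennreal_leI)
        qed auto
      qed
    qed
    finally show ?thesis .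
  qed
  have \<kappa>0: "0 \<le> \<kappa> n" for n by (simp add: \<kappa>_def)
  have A0: "A 0 = 1" by (simp add: A_def h_def)
  have sum: "(\<Sum>n<k. ennreal (e^3 * \<kappa> n)) + A k \<le> 1" for k
  proof (induction k)
    case (Suc k)
    have "ennreal (e^3 * \<kappa> k) + A (Suc k) \<le> A k"
      unfolding A_split[of k "\<iota> k"] A_Suc using low[of k "\<not> \<iota> k"] by (simp add: add.commute add_left_mono)
    then have "(\<Sum>n<Suc k. ennreal (e^3 * \<kappa> n)) + A (Suc k) \<le> (\<Sum>n<k. ennreal (e^3 * \<kappa> n)) + A k"
      by (simp add: add.assoc add_left_mono)
    also have "\<dots> \<le> 1" by (rule Suc)
    finally show ?case .
  qed (simp add: A0)
  have "(\<Sum>n<k. e^3 * \<kappa> n) \<le> 1" for k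
  proof -
    have "ennreal (\<Sum>n<k. e^3 * \<kappa> n) \<le> 1"
    proof -
      have "ennreal (\<Sum>n<k. e^3 * \<kappa> n) = (\<Sum>n<k. ennreal (e^3 * \<kappa> n))"
        using e \<kappa>0 by (subst sum_ennreal) auto
      also have "\<dots> \<le> (\<Sum>n<k. ennreal (e^3 * \<kappa> n)) + A k" by simp
      also have "\<dots> \<le> 1" by (rule sum)
      finally show ?thesis .
    qed
    then show ?thesis by (simp add: ennreal_le_1)
  qed
  then have "summable (\<lambda>n. e^3 * \<kappa> n)"
    using e \<kappa>0 by (intro summableI_nonneg_bounded[of _ 1]) auto
  then have "(\<lambda>n. e^3 * \<kappa> n) \<longlonglongrightarrow> 0" by (rule summable_LIMSEQ_zero)
  then have "(\<lambda>n. (1 / e^3) * (e^3 * \<kappa> n)) \<longlonglongrightarrow> (1 / e^3) * 0" by (intro tendsto_mult_left)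
  then show ?thesis using e by (simp add: \<kappa>_def[abs_def])
qed

lemma wb_orbit:
  assumes g: "g \<in> SigmaG" and x: "\<forall>n. (T g ^^ n) x \<in> U"
  shows "wb g (\<lambda>n. (T g ^^ n) x < c) n ((T g ^^ n) x) = x"
proof (induction n)
  case (Suc n)
  let ?i = "(T g ^^ n) x < c"
  have "(T g ^^ n) x \<in> pc ?i" using x[rule_format, of n] by (auto simp: U_alt lo_def hi_def)
  then have "Phi g ?i (T g ((T g ^^ n) x)) = (T g ^^ n) x"
    by (rule branch.phi_T[OF branch_inst[OF G_J[OF g]]])
  then show ?case using Suc by simp
qed simp

lemma AE_wb:
  assumes g: "g \<in> SigmaG"
    and B: "\<And>i. AE y in lborel. y \<in> {0<..<1} \<and> y \<in> B \<longrightarrow> Phi g i y \<in> B"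
  shows "AE y in lborel. y \<in> {0<..<1} \<and> y \<in> B \<longrightarrow> wb g \<iota> n y \<in> B"
proof (induction n)
  case (Suc n)
  let ?i = "\<iota> n"
  have "AE y in lborel. y \<in> Z g ?i \<longrightarrow> (Phi g ?i y \<in> {0<..<1} \<and> Phi g ?i y \<in> B \<longrightarrow> wb g \<iota> n (Phi g ?i y) \<in> B)"
    by (rule branch.AE_phi[OF branch_inst[OF G_J[OF g]] Suc])
  with B[of ?i] show ?case
  proof eventually_elim
    case (elim y)
    have "Phi g ?i y \<in> {0<..<1}" if "y \<in> {0<..<1}"
      using Phi_U[OF G_J[OF g], of y ?i] that iuv_G[OF g, of ?i] lohi[of ?i] by auto
    then show ?case using elim iuv_G[OF g, of ?i] by auto
  qed
qed simp

text \<open>By distortion the derivative on the middle interval lies between \<delta>^2 \<kappa> and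
  \<kappa> / \<delta>^2, where \<kappa> is its value at 1/2. So the image has length at most
  \<kappa> / \<delta>^2, while the image of the part in \<open>B\<close> stays in \<open>B\<close>
  and has measure at least \<delta>^2 \<kappa> \<beta>; the quotient is \<delta>^4 \<beta>, whatever
  the word.\<close>

lemma wb_image_estimate:
  assumes g: "g \<in> SigmaG" and \<delta>: "0 < \<delta>" "\<delta> < 1/2"
    and B[measurable]: "B \<in> sets borel" "B \<subseteq> {0<..<1}"
    and inv: "\<And>i. AE y in lborel. y \<in> {0<..<1} \<and> y \<in> B \<longrightarrow> Phi g i y \<in> B"
    and \<beta>: "emeasure lborel (B \<inter> {\<delta>..1-\<delta>}) = ennreal \<beta>" "0 \<le> \<beta>"
  obtains u v where "wb g \<iota> n ` {\<delta>..1-\<delta>} = {u..v}" "u < v" "0 < u" "v < 1"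
    "v - u \<le> 1 / \<delta>\<^sup>2 * (1 / (wq g \<iota> n (1/2))\<^sup>2)"
    "ennreal (\<delta>^4 * \<beta> * (v - u)) \<le> emeasure lborel (B \<inter> {u..v})"
proof -
  define q where "q = wq g \<iota> n"
  define \<phi> where "\<phi> = wb g \<iota> n"
  define \<kappa> where "\<kappa> = 1 / (q (1/2))\<^sup>2"
  define w where "w y = 1 / (q y)\<^sup>2" for y
  define I where "I = {\<delta>..1-\<delta>}"
  have I01: "I \<subseteq> {0<..<1}" using \<delta> by (auto simp: I_def)
  obtain s where s: "s = 1 \<or> s = -1" "\<And>y. y\<in>{0<..<1} \<Longrightarrow> \<phi> y \<in> {0<..<1} \<and> (\<phi> has_real_derivative s * w y) (at y)"
    using wb_props[OF g, of \<iota> n] unfolding q_def \<phi>_def w_def times_divide_eq_right mult_1_right by blast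
  have qpos: "0 < q y" if "y \<in> {0<..<1}" for y unfolding q_def by (rule wq_pos[OF g that])
  have \<kappa>: "0 < \<kappa>" using qpos[of "1/2"] by (simp add: \<kappa>_def)
  have wpos: "0 < w y" if "y \<in> I" for y using qpos[of y] that I01 by (auto simp: w_def)
  have conc: "conc 0 1 q" unfolding q_def using wb_props[OF g] by blast
  have wb: "\<delta>\<^sup>2 * \<kappa> \<le> w y" "w y \<le> \<kappa> / \<delta>\<^sup>2" if y: "y \<in> I" for y
  proof -
    have h: "(1/2::real) \<in> {0+\<delta>..1-\<delta>}" "y \<in> {0+\<delta>..1-\<delta>}" using \<delta> y by (auto simp: I_def)
    have p: "0 < q y" "0 < q (1/2)" using qpos[of y] qpos[of "1/2"] y I01 by auto
    have "q y \<le> (1 - 0) / \<delta> * q (1/2)" by (rule conc_ratio[OF conc \<delta>(1) h])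
    then have "\<delta> * q y \<le> q (1/2)" using \<delta> by (simp add: field_simps)
    then have "(\<delta> * q y)\<^sup>2 \<le> (q (1/2))\<^sup>2" using \<delta> p by (intro power_mono) auto
    then show "\<delta>\<^sup>2 * \<kappa> \<le> w y" using p by (simp add: \<kappa>_def w_def field_simps power_mult_distrib)
    have "q (1/2) \<le> (1 - 0) / \<delta> * q y" by (rule conc_ratio[OF conc \<delta>(1) h(2,1)])
    then have "\<delta> * q (1/2) \<le> q y" using \<delta> by (simp add: field_simps)
    then have "(\<delta> * q (1/2))\<^sup>2 \<le> (q y)\<^sup>2" using \<delta> p by (intro power_mono) auto
    then show "w y \<le> \<kappa> / \<delta>\<^sup>2" using p \<delta> by (simp add: \<kappa>_def w_def field_simps power_mult_distrib)
  qed
  have cw: "continuous_on I w" unfolding w_def[abs_def] q_def by (rule continuous_on_subset[OF wq_cont[OF g] I01])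
  have c\<phi>: "continuous_on I \<phi>"
    by (rule DERIV_continuous_on[OF has_field_derivative_at_within[OF s(2)[THEN conjunct2]]]) (use I01 in auto)
  have cv: "(\<integral>\<^sup>+x\<in>\<phi> ` I. f x \<partial>lborel) = (\<integral>\<^sup>+y\<in>I. f (\<phi> y) * ennreal (w y) \<partial>lborel)"
    if "f \<in> borel_measurable borel" for f
    unfolding I_def
    by (rule nn_integral_image_Icc[OF that s(1)]) (use \<delta> s(2) wpos cw I01 in \<open>auto simp: I_def\<close>)
  have ne: "I \<noteq> {}" using \<delta> by (auto simp: I_def)
  have "connected (\<phi> ` I)" "compact (\<phi> ` I)"
    using c\<phi> by (auto intro!: connected_continuous_image compact_continuous_image simp: I_def)
  then obtain u v where uv: "\<phi> ` I = {u..v}" using connected_compact_interval_1 by metis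
  have sub: "{u..v} \<subseteq> {0<..<1}" using uv[symmetric] s(2) I01 by auto
  have le: "u \<le> v" using uv ne by (metis atLeastatMost_empty_iff image_is_empty)
  have len: "ennreal (v - u) = (\<integral>\<^sup>+y\<in>I. ennreal (w y) \<partial>lborel)"
    using cv[of "\<lambda>_. 1"] le by (simp add: uv)
  have up: "v - u \<le> \<kappa> / \<delta>\<^sup>2"
  proof -
    have "ennreal (v - u) \<le> (\<integral>\<^sup>+y. ennreal (\<kappa> / \<delta>\<^sup>2) * indicator {0..1::real} y \<partial>lborel)"
      unfolding len using wb(2) \<delta> by (intro nn_integral_mono) (auto simp: I_def ennreal_leI split: split_indicator)
    also have "\<dots> = ennreal (\<kappa> / \<delta>\<^sup>2)" by (simp add: nn_integral_cmult_indicator)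
    finally show ?thesis using \<kappa> by (simp add: ennreal_le_iff)
  qed
  have lt: "u < v"
  proof -
    have "0 < ennreal (\<delta>\<^sup>2 * \<kappa>) * emeasure lborel I" using \<delta> \<kappa> by (simp add: I_def ennreal_mult'[symmetric])
    also have "\<dots> = (\<integral>\<^sup>+y\<in>I. ennreal (\<delta>\<^sup>2 * \<kappa>) \<partial>lborel)" by (simp add: I_def nn_integral_cmult_indicator)
    also have "\<dots> \<le> ennreal (v - u)" unfolding len using wb(1)
      by (intro nn_integral_mono) (auto simp: ennreal_leI split: split_indicator)
    finally show ?thesis by simp
  qed
  have "ennreal (\<delta>^4 * \<beta> * (v - u)) \<le> ennreal (\<delta>^4 * \<beta> * (\<kappa> / \<delta>\<^sup>2))"
    using up \<beta> \<delta> by (intro ennreal_leI mult_left_mono) auto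
  also have "\<dots> = ennreal (\<delta>\<^sup>2 * \<kappa>) * ennreal \<beta>"
    using \<delta> \<kappa> \<beta> by (simp add: ennreal_mult'[symmetric] power2_eq_square power4_eq_xxxx mult_ac)
  also have "\<dots> = (\<integral>\<^sup>+y. ennreal (\<delta>\<^sup>2 * \<kappa>) * indicator (B \<inter> I) y \<partial>lborel)"
    using B(1) by (subst nn_integral_cmult_indicator) (auto simp: \<beta>(1) I_def)
  also have "\<dots> \<le> (\<integral>\<^sup>+y\<in>I. indicator B (\<phi> y) * ennreal (w y) \<partial>lborel)"
  proof (rule nn_integral_mono_AE)
    show "AE y in lborel. ennreal (\<delta>\<^sup>2 * \<kappa>) * indicator (B \<inter> I) y \<le> indicator B (\<phi> y) * ennreal (w y) * indicator I y"
      using AE_wb[OF g inv, of \<iota> n]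
    proof eventually_elim
      case (elim y)
      then show ?case using wb(1)[of y] B(2) by (auto simp: \<phi>_def ennreal_leI split: split_indicator)
    qed
  qed
  also have "\<dots> = (\<integral>\<^sup>+x\<in>\<phi> ` I. indicator B x \<partial>lborel)" by (rule cv[symmetric]) measurable
  also have "\<dots> = emeasure lborel (B \<inter> {u..v})"
    using B(1) by (simp add: uv indicator_inter_arith[symmetric])
  finally show thesis
  proof (intro that[of u v])
    have "u \<in> {u..v}" "v \<in> {u..v}" using le by auto
    then show "0 < u" "v < 1" using sub by (auto simp: subset_iff simp del: atLeastAtMost_iff)
    show "v - u \<le> 1 / \<delta>\<^sup>2 * (1 / (wq g \<iota> n (1/2))\<^sup>2)" using up by (simp add: \<kappa>_def q_def mult.commute)
  qed (use uv lt in \<open>auto simp: \<phi>_def I_def\<close>)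
qed

text \<open>A set whose complement is invariant meets every small image of the middle interval in a
  definite proportion; as these images form a Vitali cover, the complement is null.\<close>

lemma full_support_aux:
  assumes g: "g \<in> SigmaG" and A[measurable]: "A \<in> sets borel" "A \<subseteq> {0<..<1}"
    and B_def: "B = {0<..<1} - A"
    and inv: "\<And>i. AE y in lborel. y \<in> {0<..<1} \<and> y \<in> B \<longrightarrow> Phi g i y \<in> B"
    and B0: "emeasure lborel B \<noteq> 0"
  shows "emeasure lborel A = 0"
proof (rule ccontr)
  assume A0: "emeasure lborel A \<noteq> 0"
  have B[measurable]: "B \<in> sets borel" "B \<subseteq> {0<..<1}" using B_def by auto
  obtain \<delta>0 where \<delta>0: "0 < \<delta>0" "\<And>\<delta> x n. 0 < \<delta> \<Longrightarrow> \<delta> \<le> \<delta>0 \<Longrightarrow> (\<forall>n. (T g ^^ n) x \<in> U) \<Longrightarrow>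
     \<exists>m\<ge>n. (T g ^^ m) x \<in> {\<delta>..1-\<delta>}" by (rule recurrent[OF g]) blast
  \<comment> \<open>\<open>B\<close> is a countable union of its parts in such middle intervals, so
    one of them has positive measure.\<close>
  obtain \<delta> where \<delta>: "0 < \<delta>" "\<delta> \<le> \<delta>0" "\<delta> < 1/2" "emeasure lborel (B \<inter> {\<delta>..1-\<delta>}) \<noteq> 0"
  proof (rule ccontr)
    assume no: "\<not> thesis"
    define d where "d k = min \<delta>0 (1/3) / real (Suc k)" for k
    have d: "0 < d k" "d k \<le> \<delta>0" "d k < 1/2" for k
    proof -
      show "0 < d k" using \<delta>0 by (simp add: d_def)
      have "d k \<le> min \<delta>0 (1/3) / 1" unfolding d_def using \<delta>0(1) by (intro divide_left_mono) auto
      then show "d k \<le> \<delta>0" "d k < 1/2" by auto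
    qed
    have "B \<inter> {d k..1 - d k} \<in> null_sets lborel" for k
      using that[OF d, of k] no by (auto intro!: null_setsI)
    then have "(\<Union>k. B \<inter> {d k..1 - d k}) \<in> null_sets lborel" by (rule null_sets_UN)
    moreover have "B = (\<Union>k. B \<inter> {d k..1 - d k})"
    proof (intro equalityI subsetI)
      fix x assume x: "x \<in> B"
      define m where "m = min x (1 - x)"
      have m: "0 < m" using x B(2) by (auto simp: m_def)
      obtain k where "min \<delta>0 (1/3) / m < real k" using reals_Archimedean2 by blast
      then have "min \<delta>0 (1/3) / m < real (Suc k)" by simp
      then have "d k < m" unfolding d_def using m by (simp add: divide_simps mult.commute)
      then have "x \<in> {d k..1 - d k}" by (auto simp: m_def)
      then show "x \<in> (\<Union>k. B \<inter> {d k..1 - d k})" using x by blast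
    qed auto
    ultimately show False using B0 by (auto dest: null_setsD1)
  qed
  have fin: "emeasure lborel S \<noteq> \<infinity>" if "S \<subseteq> {0<..<1}" for S :: "real set"
  proof -
    have "emeasure lborel S \<le> emeasure lborel {0<..<1::real}" using that by (intro emeasure_mono) auto
    then show ?thesis by (auto simp: top_unique)
  qed
  define \<beta> where "\<beta> = measure lborel (B \<inter> {\<delta>..1-\<delta>})"
  have \<beta>: "emeasure lborel (B \<inter> {\<delta>..1-\<delta>}) = ennreal \<beta>"
    unfolding \<beta>_def using fin[of "B \<inter> {\<delta>..1-\<delta>}"] B(2) by (intro emeasure_eq_ennreal_measure) auto
  have \<beta>0: "0 < \<beta>" using \<delta>(4) unfolding \<beta> by (simp add: \<beta>_def zero_less_measure_iff) 
  define \<epsilon> where "\<epsilon> = \<delta>^4 * \<beta>"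
  have \<epsilon>: "0 < \<epsilon>" using \<delta> \<beta>0 by (simp add: \<epsilon>_def)
  obtain N where N: "{x \<in> space lborel. \<not> (x \<in> {0<..<1} \<longrightarrow> (\<forall>n. (T g ^^ n) x \<in> U))} \<subseteq> N"
     "emeasure lborel N = 0" "N \<in> sets lborel"
    using AE_orbit[OF g] by (rule AE_E)
  define S where "S = A - N"
  have S[measurable]: "S \<in> sets borel" using N(3) by (simp add: S_def)
  have eS: "emeasure lborel S = emeasure lborel A"
    unfolding S_def using N by (intro emeasure_Diff_null_set) (auto simp: null_sets_def)
  have S_orbit: "\<forall>n. (T g ^^ n) x \<in> U" if "x \<in> S" for x
  proof -
    have "x \<in> {0<..<1}" "x \<notin> N" using that A(2) by (auto simp: S_def)
    then show ?thesis using N(1) by auto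
  qed
  define \<alpha> where "\<alpha> = measure lborel S"
  have \<alpha>: "emeasure lborel S = ennreal \<alpha>"
    unfolding \<alpha>_def using fin[of S] A(2) by (intro emeasure_eq_ennreal_measure) (auto simp: S_def)
  have "\<alpha> \<noteq> 0" using A0 eS \<alpha> by (metis ennreal_0)
  then have \<alpha>0: "0 < \<alpha>" by (simp add: \<alpha>_def zero_less_measure_iff)
  \<comment> \<open>The excess \<open>V - S\<close> is made smaller than the amount \<epsilon>
    \<alpha> that \<open>B\<close> will turn out to occupy in it.\<close>
  obtain V where V: "open V" "S \<subseteq> V" "emeasure lborel (V - S) < ennreal (\<epsilon> * \<alpha>)"
    using outer_regular_lborel[OF S, of "\<epsilon> * \<alpha>"] \<epsilon> \<alpha>0 by auto
  \<comment> \<open>The Vitali family: intervals inside \<open>V\<close> in which \<open>B\<close>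
    has proportion at least \<open>\<epsilon>\<close>. At a point of \<open>S\<close> arbitrarily
    small ones arise whenever its orbit visits the middle interval.\<close>
  define K where "K = {(y, \<rho>). 0 < \<rho> \<and> cball y \<rho> \<subseteq> V \<and> ennreal (\<epsilon> * (2 * \<rho>)) \<le> emeasure lborel (B \<inter> cball y \<rho>)}"
  have vit: "\<exists>i. i \<in> K \<and> x \<in> cball (fst i) (snd i) \<and> snd i < d" if x: "x \<in> S" and d: "0 < d" for x d
  proof -
    obtain e where e: "0 < e" "ball x e \<subseteq> V" using V(1,2) x by (meson openE subsetD)
    define \<iota> where "\<iota> = (\<lambda>n. (T g ^^ n) x < c)"
    have "\<forall>\<^sub>F n in sequentially. 1 / (wq g \<iota> n (1/2))\<^sup>2 < \<delta>\<^sup>2 * min d e"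
      using wq_half_tendsto[OF g, of \<iota>] d e \<delta> by (intro order_tendstoD) auto
    then obtain n0 where n0: "\<And>n. n \<ge> n0 \<Longrightarrow> 1 / (wq g \<iota> n (1/2))\<^sup>2 < \<delta>\<^sup>2 * min d e"
      by (auto simp: eventually_sequentially)
    obtain n where n: "n \<ge> n0" "(T g ^^ n) x \<in> {\<delta>..1-\<delta>}" using \<delta>0(2)[OF \<delta>(1,2) S_orbit[OF x]] by blast
    obtain u v where uv: "wb g \<iota> n ` {\<delta>..1-\<delta>} = {u..v}" "u < v" "0 < u" "v < 1"
      "v - u \<le> 1 / \<delta>\<^sup>2 * (1 / (wq g \<iota> n (1/2))\<^sup>2)"
      "ennreal (\<delta>^4 * \<beta> * (v - u)) \<le> emeasure lborel (B \<inter> {u..v})"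
      by (rule wb_image_estimate[OF g \<delta>(1,3) B inv \<beta>]) (use \<beta>0 in auto)
    have "1 / \<delta>\<^sup>2 * (1 / (wq g \<iota> n (1/2))\<^sup>2) < 1 / \<delta>\<^sup>2 * (\<delta>\<^sup>2 * min d e)"
      using n0[OF n(1)] \<delta> by (intro mult_strict_left_mono) auto
    then have small: "v - u < min d e" using uv(5) \<delta> by simp
    have xin: "x \<in> {u..v}" using wb_orbit[OF g S_orbit[OF x], of n] n(2) uv(1) unfolding \<iota>_def by (metis image_eqI)
    have cb: "cball ((u+v)/2) ((v-u)/2) = {u..v}" by (auto simp: cball_eq_atLeastAtMost field_simps)
    have "{u..v} \<subseteq> V" using e(2) small xin by (auto simp: ball_def dist_real_def subset_iff)
    moreover have "\<epsilon> * (2 * ((v - u) / 2)) = \<delta>^4 * \<beta> * (v - u)" by (simp add: \<epsilon>_def)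
    ultimately have "((u+v)/2, (v-u)/2) \<in> K"
      using uv(2,6) unfolding K_def by (simp only: mem_Collect_eq case_prod_conv cb) simp
    moreover have "x \<in> cball ((u+v)/2) ((v-u)/2)" using xin cb by simp
    moreover have "(v-u)/2 < d" using small uv(2) by auto
    ultimately show ?thesis by (intro exI[of _ "((u+v)/2, (v-u)/2)"]) auto
  qed
  have Kpos: "0 < snd i" if "i \<in> K" for i using that by (auto simp: K_def)
  obtain C where C: "countable C" "C \<subseteq> K"
     "pairwise (\<lambda>i j. disjnt (cball (fst i) (snd i)) (cball (fst j) (snd j))) C"
     "negligible (S - (\<Union>i \<in> C. cball (fst i) (snd i)))"
    by (rule Vitali_covering_theorem_cballs[of K snd S fst, OF Kpos vit])
  define CB where "CB i = cball (fst i) (snd i :: real)" for i :: "real \<times> real"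
  have CBm[measurable]: "CB i \<in> sets borel" for i by (simp add: CB_def)
  have disj: "disjoint_family_on CB C"
    using C(3) unfolding disjoint_family_on_def pairwise_def disjnt_def CB_def by blast
  have m: "(\<Union>i\<in>C. CB i) \<in> sets borel" using C(1) by (intro sets.countable_UN') auto
  have "S - (\<Union>i\<in>C. CB i) \<in> null_sets lborel"
    using C(4) m S unfolding CB_def negligible_iff_null_sets by (simp add: null_sets_completion_iff)
  then have "emeasure lborel S \<le> emeasure lborel (\<Union>i\<in>C. CB i)"
  proof -
    assume n: "S - (\<Union>i\<in>C. CB i) \<in> null_sets lborel"
    have "emeasure lborel S \<le> emeasure lborel ((S - (\<Union>i\<in>C. CB i)) \<union> (\<Union>i\<in>C. CB i))"
      using m by (intro emeasure_mono) auto
    also have "\<dots> = emeasure lborel (\<Union>i\<in>C. CB i)" by (subst Un_commute, rule emeasure_Un_null_set) (use n m in auto)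
    finally show ?thesis .
  qed
  also have "\<dots> = (\<integral>\<^sup>+i. emeasure lborel (CB i) \<partial>count_space C)"
    using C(1) disj by (intro emeasure_UN_countable) auto
  finally have 1: "emeasure lborel S \<le> (\<integral>\<^sup>+i. emeasure lborel (CB i) \<partial>count_space C)" .
  \<comment> \<open>The selected disjoint intervals cover \<open>S\<close> up to a null set, so
    \<open>B\<close> fills at least \<epsilon> \<alpha> of their union; but \<open>B\<close> is
    disjoint from \<open>S\<close>, so this part lies in \<open>V - S\<close>.\<close>
  have "ennreal (\<epsilon> * \<alpha>) = ennreal \<epsilon> * emeasure lborel S" using \<epsilon> \<alpha>0 by (simp add: \<alpha> ennreal_mult)
  also have "\<dots> \<le> ennreal \<epsilon> * (\<integral>\<^sup>+i. emeasure lborel (CB i) \<partial>count_space C)" using 1 by (intro mult_left_mono) auto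
  also have "\<dots> = (\<integral>\<^sup>+i. ennreal \<epsilon> * emeasure lborel (CB i) \<partial>count_space C)" by (simp add: nn_integral_cmult)
  also have "\<dots> \<le> (\<integral>\<^sup>+i. emeasure lborel (B \<inter> CB i) \<partial>count_space C)"
  proof (intro nn_integral_mono)
    fix i assume "i \<in> space (count_space C)"
    then have i: "i \<in> K" using C(2) by auto
    then have "0 < snd i" "ennreal (\<epsilon> * (2 * snd i)) \<le> emeasure lborel (B \<inter> CB i)"
      by (auto simp: K_def CB_def)
    moreover have "emeasure lborel (CB i) = ennreal (2 * snd i)"
      using \<open>0 < snd i\<close> by (simp add: CB_def cball_eq_atLeastAtMost)
    ultimately show "ennreal \<epsilon> * emeasure lborel (CB i) \<le> emeasure lborel (B \<inter> CB i)"
      using \<epsilon> by (simp add: ennreal_mult'[symmetric])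
  qed
  also have "\<dots> = emeasure lborel (\<Union>i\<in>C. B \<inter> CB i)"
  proof (intro emeasure_UN_countable[symmetric] C(1))
    show "disjoint_family_on (\<lambda>i. B \<inter> CB i) C" using disj unfolding disjoint_family_on_def by blast
  qed auto
  also have "\<dots> \<le> emeasure lborel (V - S)"
  proof (intro emeasure_mono)
    show "(\<Union>i\<in>C. B \<inter> CB i) \<subseteq> V - S"
    proof -
      have "CB i \<subseteq> V" if "i \<in> C" for i
      proof -
        have "i \<in> K" using that C(2) by blast
        then show ?thesis unfolding K_def CB_def by (simp add: case_prod_beta)
      qed
      moreover have "B \<inter> S = {}" by (auto simp: B_def S_def)
      ultimately show ?thesis by blast
    qed
    show "V - S \<in> sets lborel" using V(1) S by simp
  qed
  finally show False using V(3) by simp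
qed

text \<open>Where \<open>f\<close> vanishes, so does the sum \<open>P f\<close> of non-negative
  terms, hence \<open>f\<close> also vanishes at the preimages under any chosen good map. The zero
  set is thus invariant under the inverse branches of that one map, and no other map is
  considered.\<close>

theorem full_support:
  assumes f[measurable]: "f \<in> borel_measurable borel"
    and inv: "AE y in lborel. y \<in> {0<..<1} \<longrightarrow> P f y = f y"
    and nz: "\<not> (AE y in lborel. y \<in> {0<..<1} \<longrightarrow> f y = 0)"
  shows "AE y in lborel. y \<in> {0<..<1} \<longrightarrow> f y \<noteq> 0"
proof -
  obtain g where g: "g \<in> SigmaG" using G_ne by auto
  note gJ = G_J[OF g]
  define A where "A = {y \<in> {0<..<1}. f y \<noteq> 0}"
  define B where "B = {0<..<1} - A"
  have A: "A \<in> sets borel" "A \<subseteq> {0<..<1}" unfolding A_def by (measurable, auto)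
  have B: "B \<in> sets borel" using A by (simp add: B_def)
  have invB: "AE y in lborel. y \<in> {0<..<1} \<and> y \<in> B \<longrightarrow> Phi g i y \<in> B" for i
    using inv
  proof eventually_elim
    case (elim y)
    show ?case
    proof
      assume y: "y \<in> {0<..<1} \<and> y \<in> B"
      then have "P f y = 0" using elim by (auto simp: B_def A_def)
      then have "ennreal (p g) * Bop g i f y = 0"
        unfolding P_def using gJ by (simp add: UNIV_bool) (cases i, auto)
      moreover have "0 < p g" using p_pos gJ by (simp add: J_def)
      ultimately have 0: "Bop g i f y = 0" by simp
      have yZ: "y \<in> Z g i" using y iuv_G[OF g, of i] by auto
      then have "0 < W g i y" by (rule branch.w_pos[OF branch_inst[OF gJ]])
      then have "f (Phi g i y) = 0" using 0 yZ by (auto simp: Bop_def)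
      then show "Phi g i y \<in> B" using Phi_U[OF gJ yZ] lohi[of i] by (auto simp: B_def A_def)
    qed
  qed
  have "emeasure lborel A \<noteq> 0"
  proof
    assume "emeasure lborel A = 0"
    then have "AE y in lborel. y \<notin> A" using A by (intro AE_not_in) (auto simp: null_sets_def)
    then have "AE y in lborel. y \<in> {0<..<1} \<longrightarrow> f y = 0" by eventually_elim (auto simp: A_def)
    then show False using nz by simp
  qed
  then have "emeasure lborel B = 0" using full_support_aux[OF g A B_def invB] by blast
  then have "AE y in lborel. y \<notin> B" using B by (intro AE_not_in) (auto simp: null_sets_def)
  then show ?thesis by eventually_elim (auto simp: B_def A_def)
qed

subsection \<open>Densities of stationary measures\<close>

text \<open>Radon-Nikodym turns the measure into a density, and \<sigma>-finiteness into its
  finiteness almost everywhere. Stationarity says that \<open>h\<close> and \<open>P h\<close>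
  define the same measure, so they agree almost everywhere.\<close>

lemma stationary_density:
  assumes acs: "acs_measure {1..N} p T \<mu>"
  obtains h where "h \<in> borel_measurable borel"
    "\<And>A. A \<in> sets borel \<Longrightarrow> A \<subseteq> {0..1} \<Longrightarrow> emeasure \<mu> A = (\<integral>\<^sup>+x\<in>A. h x \<partial>lborel)"
    "AE x in lborel. x \<in> {0<..<1} \<longrightarrow> h x \<noteq> \<infinity>"
    "AE y in lborel. y \<in> {0<..<1} \<longrightarrow> P h y = h y"
    "\<not> (AE y in lborel. y \<in> {0<..<1} \<longrightarrow> h y = 0)"
proof -
  define R where "R = restrict_space lborel {0..1::real}"
  have sp: "space \<mu> = {0..1}" and sets: "sets \<mu> = sets R"
    and st: "\<And>A. A \<in> sets \<mu> \<Longrightarrow> (\<Sum>j\<in>J. ennreal (p j) * emeasure \<mu> (T j -` A \<inter> {0..1})) = emeasure \<mu> A"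
    and sf: "sigma_finite_measure \<mu>" and ac: "absolutely_continuous R \<mu>" and nz: "emeasure \<mu> {0..1} \<noteq> 0"
    using acs unfolding acs_measure_def stationary_def borel_measure_on_unit_def R_def J_def
    by (auto simp: sets_restrict_space)
  interpret R: sigma_finite_measure R
    unfolding R_def by (intro sigma_finite_measure_restrict_space lborel.sigma_finite_measure_axioms) auto
  obtain h0 where h0: "h0 \<in> borel_measurable R" "density R h0 = \<mu>"
    using R.Radon_Nikodym[OF ac sets] by blast
  define h where "h x = h0 x * indicator {0..1} x" for x
  have h[measurable]: "h \<in> borel_measurable borel"
    using h0(1) unfolding R_def h_def[abs_def] by (subst (asm) borel_measurable_restrict_space_iff_ennreal) auto
  have A_sets: "A \<in> sets R \<longleftrightarrow> A \<in> sets borel \<and> A \<subseteq> {0..1}" for A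
    unfolding R_def by (subst sets_restrict_space_iff) auto
  have em: "emeasure \<mu> A = (\<integral>\<^sup>+x\<in>A. h x \<partial>lborel)" if A: "A \<in> sets borel" "A \<subseteq> {0..1}" for A
  proof -
    have "emeasure \<mu> A = (\<integral>\<^sup>+x\<in>A. h0 x \<partial>R)"
      unfolding h0(2)[symmetric] using A A_sets h0(1) by (subst emeasure_density) auto
    also have "\<dots> = (\<integral>\<^sup>+x\<in>A. h x \<partial>lborel)"
      unfolding R_def h_def by (subst nn_integral_restrict_space) (auto simp: mult_ac)
    finally show ?thesis .
  qed
  have fin: "AE x in lborel. x \<in> {0<..<1} \<longrightarrow> h x \<noteq> \<infinity>"
  proof -
    have "AE x in R. h0 x \<noteq> \<infinity>"
      using R.sigma_finite_iff_density_finite[OF h0(1)] sf h0(2) by simp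
    then have "AE x in lborel. x \<in> {0..1} \<longrightarrow> h0 x \<noteq> \<infinity>"
      unfolding R_def by (subst (asm) AE_restrict_space_iff) auto
    then show ?thesis by eventually_elim (auto simp: h_def)
  qed
  have Ph: "AE y in lborel. y \<in> {0<..<1} \<longrightarrow> P h y = h y"
  proof -
    have "density lborel (P h) = density lborel (\<lambda>x. h x * indicator {0<..<1} x)"
    proof (rule measure_eqI)
      fix A assume "A \<in> sets (density lborel (P h))"
      then have A[measurable]: "A \<in> sets borel" by simp
      define A' where "A' = A \<inter> {0<..<1}"
      have A'[measurable]: "A' \<in> sets borel" "A' \<subseteq> {0..1}" by (auto simp: A'_def)
      have "emeasure (density lborel (P h)) A = (\<integral>\<^sup>+y. indicator A' y * P h y \<partial>lborel)"
        unfolding A'_def using P_outside by (subst emeasure_density) (auto intro!: nn_integral_cong split: split_indicator)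
      also have "\<dots> = (\<Sum>j\<in>J. ennreal (p j) * (\<integral>\<^sup>+x\<in>U. indicator A' (T j x) * h x \<partial>lborel))"
        by (rule P_dual) auto
      also have "\<dots> = (\<Sum>j\<in>J. ennreal (p j) * emeasure \<mu> (T j -` A' \<inter> {0..1}))"
      proof (intro sum.cong refl arg_cong2[where f = "(*)"])
        fix j assume j: "j \<in> J"
        let ?E = "T j -` A' \<inter> {0..1}"
        have "(\<lambda>x. indicator A' (T j x) * indicator U x :: ennreal) \<in> borel_measurable borel"
          by (rule T_comp_measurable_U[OF j]) auto
        then have "(\<lambda>x. indicator (?E \<inter> U) x :: ennreal) \<in> borel_measurable borel"
          by (rule measurable_cong[THEN iffD1, rotated]) (auto simp: U_alt split: split_indicator)
        then have EU: "?E \<inter> U \<in> sets borel" by (simp add: borel_measurable_indicator_iff)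
        \<comment> \<open>Measurability of \<open>T j\<close> is known only on \<open>U\<close>; the
          three remaining points add a finite set.\<close>
        have "?E = (?E \<inter> U) \<union> (?E \<inter> {0,c,1})" by (auto simp: U_alt)
        moreover have "?E \<inter> {0,c,1} \<in> sets borel" by (intro borel_closed finite_imp_closed) auto
        ultimately have E: "?E \<in> sets borel" using EU by (metis sets.Un)
        have "AE x in lborel. x \<noteq> 0 \<and> x \<noteq> c \<and> x \<noteq> 1"
          by (intro AE_conjI AE_lborel_singleton)
        then have "(\<integral>\<^sup>+x\<in>?E. h x \<partial>lborel) = (\<integral>\<^sup>+x\<in>U. indicator A' (T j x) * h x \<partial>lborel)"
          by (intro nn_integral_cong_AE, eventually_elim) (auto simp: U_alt split: split_indicator)
        then show "(\<integral>\<^sup>+x\<in>U. indicator A' (T j x) * h x \<partial>lborel) = emeasure \<mu> ?E"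
          using em[OF E] by simp
      qed
      also have "\<dots> = emeasure \<mu> A'" using st[of A'] sets A_sets[of A'] A' by auto
      also have "\<dots> = (\<integral>\<^sup>+x\<in>A'. h x \<partial>lborel)" using em A' by blast
      also have "\<dots> = emeasure (density lborel (\<lambda>x. h x * indicator {0<..<1} x)) A"
        unfolding A'_def by (subst emeasure_density) (auto intro!: nn_integral_cong split: split_indicator)
      finally show "emeasure (density lborel (P h)) A = emeasure (density lborel (\<lambda>x. h x * indicator {0<..<1} x)) A" .
    qed simp
    then have "AE y in lborel. P h y = h y * indicator {0<..<1} y"
      by (intro sigma_finite_measure.density_unique[OF sigma_finite_lborel]) auto
    then show ?thesis by eventually_elim auto
  qed
  have "\<not> (AE y in lborel. y \<in> {0<..<1} \<longrightarrow> h y = 0)"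
  proof
    assume 0: "AE y in lborel. y \<in> {0<..<1} \<longrightarrow> h y = 0"
    have "AE x in lborel. x \<noteq> 0 \<and> x \<noteq> (1::real)" by (intro AE_conjI AE_lborel_singleton)
    with 0 have "AE y in lborel. h y * indicator {0..1} y = 0"
      by eventually_elim (auto split: split_indicator)
    then have "emeasure \<mu> {0..1} = 0" by (subst em) (auto simp: nn_integral_0_iff_AE)
    then show False using nz by simp
  qed
  then show thesis using that h em fin Ph by blast
qed

lemma stationary_integral:
  assumes [measurable]: "h \<in> borel_measurable borel" "\<psi> \<in> borel_measurable borel"
    and Ph: "AE y in lborel. y \<in> {0<..<1} \<longrightarrow> P h y = h y"
  shows "(\<integral>\<^sup>+x\<in>U. \<psi> x * h x \<partial>lborel) = (\<Sum>j\<in>J. ennreal (p j) * (\<integral>\<^sup>+x\<in>U. \<psi> (T j x) * h x \<partial>lborel))"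
proof -
  have "(\<integral>\<^sup>+x\<in>U. \<psi> x * h x \<partial>lborel) = (\<integral>\<^sup>+y. \<psi> y * P h y \<partial>lborel)"
    using Ph AE_U
    by (intro nn_integral_cong_AE, eventually_elim) (auto simp: U_alt P_outside split: split_indicator)
  then show ?thesis by (simp add: P_dual)
qed

subsection \<open>A finite stationary measure forces \<open>\<theta> < 1\<close>\<close>

definition dist01 :: "real \<Rightarrow> real" where "dist01 x = min x (1 - x)"
definition log_dist_c :: "real \<Rightarrow> real" where "log_dist_c x = - ln \<bar>x - c\<bar>"
definition log_dist_ends :: "real \<Rightarrow> real" where "log_dist_ends x = - ln (dist01 x)"

lemma dist01_U: "x \<in> {0<..<1} \<Longrightarrow> 0 < dist01 x \<and> dist01 x \<le> 1" by (auto simp: dist01_def)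

lemma dist01_le: "y \<in> {0, 1} \<Longrightarrow> dist01 x \<le> \<bar>x - y\<bar>" by (auto simp: dist01_def)

lemma log_dist_ends_nonneg: "x \<in> {0<..<1} \<Longrightarrow> 0 \<le> log_dist_ends x" using dist01_U[of x] by (auto simp: log_dist_ends_def)

lemma log_dist_c_nonneg: "x \<in> U \<Longrightarrow> 0 \<le> log_dist_c x" using c01 by (auto simp: log_dist_c_def U_alt)

lemma tau_good: assumes g: "g \<in> SigmaG" shows "branch.\<tau> c (outer i) (lo i) (hi i) (T g) \<in> {0, 1}"
  using branch.ends[OF branch_inst[OF G_J[OF g], of i]] iuv_G[OF g, of i] by auto

lemma tau_bad: assumes b: "b \<in> SigmaB" shows "branch.\<tau> c (outer i) (lo i) (hi i) (T b) = c"
proof -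
  have "{T b (outer i), branch.\<tau> c (outer i) (lo i) (hi i) (T b)} = {iu b i, iv b i}"
    by (rule branch.ends[OF branch_inst[OF B_J[OF b]]])
  then show ?thesis using iuv_B[OF b, of i] T_outer[OF B_J[OF b], of i] c01 by (auto simp: doubleton_eq_iff)
qed

definition "deriv_bound = 1 + (\<Sum>j\<in>J. snd (KM j))"

lemma deriv_bound: "1 \<le> deriv_bound" "j \<in> J \<Longrightarrow> snd (KM j) \<le> deriv_bound"
proof -
  have pos: "0 \<le> snd (KM j)" if "j \<in> J" for j
    using branch.M_pos[OF branch_inst[OF that]] by simp
  then show "1 \<le> deriv_bound" unfolding deriv_bound_def by (simp add: sum_nonneg)
  assume "j \<in> J"
  then have "snd (KM j) \<le> (\<Sum>j\<in>J. snd (KM j))" using pos by (intro member_le_sum) auto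
  then show "snd (KM j) \<le> deriv_bound" by (simp add: deriv_bound_def)
qed

text \<open>Four comparisons of distances, written with logarithms. Endpoints go to endpoints, so
  the distance from them grows at most by a factor; a good map sends points close to
  \<open>c\<close> close to {0,1}; no point is close to both; and near \<open>c\<close> a bad map
  raises the distance to the power \<open>l b\<close> up to a factor. The constant
  \<open>2 / m\<close> handles the points that are not close.\<close>

lemma drift_estimates:
  obtains C where "0 \<le> C"
    "\<And>j x. j \<in> J \<Longrightarrow> x \<in> U \<Longrightarrow> log_dist_ends x - C \<le> log_dist_ends (T j x)"
    "\<And>g x. g \<in> SigmaG \<Longrightarrow> x \<in> U \<Longrightarrow> log_dist_c x - C \<le> log_dist_ends (T g x)"
    "\<And>x. x \<in> U \<Longrightarrow> min (log_dist_ends x) (log_dist_c x) \<le> C"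
    "\<And>b x. b \<in> SigmaB \<Longrightarrow> x \<in> U \<Longrightarrow> l b * log_dist_c x - C \<le> log_dist_c (T b x)"
proof -
  define m where "m = min c (1 - c)"
  have m: "0 < m" "m \<le> c" "m \<le> 1 - c" "m \<le> 1" using c01 by (auto simp: m_def)
  define D where "D = max deriv_bound (2 / m)"
  have "2 \<le> 2 / m" using m by (simp add: field_simps)
  then have D: "deriv_bound \<le> D" "2 / m \<le> D" "1 \<le> D" by (auto simp: D_def)
  define C where "C = ln D"
  have C: "0 \<le> C" using D by (simp add: C_def)
  have log_le: "- ln y - C \<le> - ln x" if "0 < x" "0 < y" "x \<le> D * y" for x y
  proof -
    have "ln x \<le> ln (D * y)" using that D by (subst ln_le_cancel_iff) auto
    then show ?thesis using that D by (simp add: ln_mult C_def)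
  qed
  show thesis
  proof (rule that[OF C])
    fix j x assume j: "j \<in> J" and x: "x \<in> U"
    obtain i where i: "x \<in> pc i" using x by (rule U_cases)
    have Tx: "T j x \<in> {0<..<1}" by (rule T_U[OF j x])
    have "dist01 (T j x) \<le> D * dist01 x"
    proof (cases "dist01 x = \<bar>x - outer i\<bar>")
      case True
      have "dist01 (T j x) \<le> \<bar>T j x - T j (outer i)\<bar>" by (rule dist01_le[OF T_outer[OF j]])
      also have "\<dots> \<le> snd (KM j) * \<bar>x - outer i\<bar>" by (rule branch.Tz_upper[OF branch_inst[OF j] i])
      also have "\<dots> \<le> D * dist01 x" unfolding True using deriv_bound(2)[OF j] D by (intro mult_right_mono) auto
      finally show ?thesis .
    next
      case False
      then have "m \<le> dist01 x" using i m by (cases i) (auto simp: dist01_def outer_def lo_def hi_def min_def split: if_splits)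
      then have "1 \<le> (2 / m) * dist01 x" using m by (simp add: field_simps)
      also have "\<dots> \<le> D * dist01 x" using D x dist01_U[of x] by (intro mult_right_mono) (auto simp: U_alt)
      finally show ?thesis using dist01_U[OF Tx] by simp
    qed
    then show "log_dist_ends x - C \<le> log_dist_ends (T j x)" unfolding log_dist_ends_def using dist01_U[OF Tx] dist01_U[of x] x
      by (intro log_le) (auto simp: U_alt)
  next
    fix g x assume g: "g \<in> SigmaG" and x: "x \<in> U"
    note j = G_J[OF g]
    obtain i where i: "x \<in> pc i" using x by (rule U_cases)
    interpret b: branch c "outer i" "lo i" "hi i" "iu g i" "iv g i" "T g" "ee g" "fst (KM g)" "snd (KM g)"
      by (rule branch_inst[OF j])
    have Tx: "T g x \<in> {0<..<1}" by (rule T_U[OF j x])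
    have xc: "0 < \<bar>x - c\<bar>" "\<bar>x - c\<bar> \<le> 1" using x c01 by (auto simp: U_alt)
    have "dist01 (T g x) \<le> \<bar>T g x - b.\<tau>\<bar>" by (rule dist01_le[OF tau_good[OF g]])
    also have "\<dots> \<le> snd (KM g) * \<bar>x - c\<bar> powr ee g" by (rule b.tau_upper[OF i])
    also have "\<dots> \<le> D * \<bar>x - c\<bar> powr 1"
      using deriv_bound(2)[OF j] D b.e1 xc by (intro mult_mono powr_mono') auto
    finally have "dist01 (T g x) \<le> D * \<bar>x - c\<bar>" using xc by simp
    then show "log_dist_c x - C \<le> log_dist_ends (T g x)" unfolding log_dist_ends_def log_dist_c_def using dist01_U[OF Tx] xc by (intro log_le) auto
  next
    fix x assume x: "x \<in> U"
    have "m / 2 \<le> dist01 x \<or> m / 2 \<le> \<bar>x - c\<bar>" using m by (auto simp: dist01_def min_def abs_if)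
    moreover have "- ln y \<le> C" if "m / 2 \<le> y" for y
    proof -
      have "1 = (2 / m) * (m / 2)" using m by simp
      also have "\<dots> \<le> D * y" using that m D by (intro mult_mono) auto
      finally show ?thesis using log_le[of 1 y] that m by simp
    qed
    ultimately show "min (log_dist_ends x) (log_dist_c x) \<le> C" unfolding log_dist_ends_def log_dist_c_def by (meson min.coboundedI1 min.coboundedI2)
  next
    fix b x assume b: "b \<in> SigmaB" and x: "x \<in> U"
    note j = B_J[OF b]
    obtain i where i: "x \<in> pc i" using x by (rule U_cases)
    interpret b: branch c "outer i" "lo i" "hi i" "iu b i" "iv b i" "T b" "ee b" "fst (KM b)" "snd (KM b)"
      by (rule branch_inst[OF j])
    have xc: "0 < \<bar>x - c\<bar>" using x by (auto simp: U_alt)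
    have "T b x \<noteq> c" using b.T_in[OF i] iuv_B[OF b, of i] by auto
    have "\<bar>T b x - c\<bar> \<le> snd (KM b) * \<bar>x - c\<bar> powr l b" using b.tau_upper[OF i] by (simp add: tau_bad[OF b] ee_B[OF b])
    also have "\<dots> \<le> D * \<bar>x - c\<bar> powr l b" using deriv_bound(2)[OF j] D by (intro mult_right_mono) auto
    finally have "- ln (\<bar>x - c\<bar> powr l b) - C \<le> - ln \<bar>T b x - c\<bar>"
      using xc \<open>T b x \<noteq> c\<close> by (intro log_le) auto
    then show "l b * log_dist_c x - C \<le> log_dist_c (T b x)" using xc by (simp add: log_dist_c_def ln_powr)
  qed
qed

lemma log_dist_c_measurable[measurable]: "log_dist_c \<in> borel_measurable borel"
  unfolding log_dist_c_def[abs_def] by measurable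
lemma log_dist_ends_measurable[measurable]: "log_dist_ends \<in> borel_measurable borel"
  unfolding log_dist_ends_def[abs_def] dist01_def[abs_def] by measurable

theorem finite_imp_theta_less_1:
  assumes h[measurable]: "h \<in> borel_measurable borel"
    and Ph: "AE y in lborel. y \<in> {0<..<1} \<longrightarrow> P h y = h y"
    and nz: "\<not> (AE y in lborel. y \<in> {0<..<1} \<longrightarrow> h y = 0)"
    and fin: "(\<integral>\<^sup>+x\<in>U. h x \<partial>lborel) \<noteq> \<infinity>"
  shows "(\<Sum>b\<in>SigmaB. p b * l b) < 1"
proof (rule ccontr)
  assume \<theta>: "\<not> (\<Sum>b\<in>SigmaB. p b * l b) < 1"
  obtain C where C: "0 \<le> C"
    "\<And>j x. j \<in> J \<Longrightarrow> x \<in> U \<Longrightarrow> log_dist_ends x - C \<le> log_dist_ends (T j x)"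
    "\<And>g x. g \<in> SigmaG \<Longrightarrow> x \<in> U \<Longrightarrow> log_dist_c x - C \<le> log_dist_ends (T g x)"
    "\<And>x. x \<in> U \<Longrightarrow> min (log_dist_ends x) (log_dist_c x) \<le> C"
    "\<And>b x. b \<in> SigmaB \<Longrightarrow> x \<in> U \<Longrightarrow> l b * log_dist_c x - C \<le> log_dist_c (T b x)" by (rule drift_estimates) blast
  obtain g where g: "g \<in> SigmaG" using G_ne by auto
  have pg: "0 < p g" using p_pos G_J[OF g] by (simp add: J_def)
  define F where "F = (\<integral>\<^sup>+x\<in>U. h x \<partial>lborel)"
  \<comment> \<open>Truncation at \<open>t\<close> makes the integral of \<open>w\<close> finite, so
    that it can be cancelled from both sides of the stationarity equation; the resulting bound does
    not involve \<open>t\<close>.\<close>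
  have Vt: "ennreal (p g) * (\<integral>\<^sup>+x\<in>U. ennreal (min (log_dist_c x) (real t)) * h x \<partial>lborel) \<le> ennreal (2 * C) * F" for t :: nat
  proof -
    define w where "w x = ennreal (min (log_dist_ends x) (real t))" for x
    define v where "v x = ennreal (min (log_dist_c x) (real t))" for x
    have [measurable]: "w \<in> borel_measurable borel" "v \<in> borel_measurable borel"
      unfolding w_def[abs_def] v_def[abs_def] by measurable
    have pt: "w x + ennreal (p g) * v x \<le> (\<Sum>j\<in>J. ennreal (p j) * w (T j x)) + ennreal (2 * C)" if x: "x \<in> U" for x
    proof -
      define a where "a = min (log_dist_ends x) (real t)"
      define e where "e = min (log_dist_c x) (real t)"
      have nn: "0 \<le> a" "0 \<le> e" using log_dist_ends_nonneg[of x] log_dist_c_nonneg[OF x] x by (auto simp: a_def e_def U_alt)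
      have wT: "0 \<le> min (log_dist_ends (T j x)) (real t)" if "j \<in> J" for j
        using log_dist_ends_nonneg[OF T_U[OF that x]] by simp
      have j1: "a - 2 * C \<le> min (log_dist_ends (T j x)) (real t)" if "j \<in> J" for j
        using C(2)[OF that x] C(1) by (auto simp: a_def)
      \<comment> \<open>One of the two logarithms is at most \<open>C\<close>, so their sum exceeds
        the other by at most \<open>C\<close>; applying \<open>g\<close> costs a second
        \<open>C\<close>.\<close>
      have g1: "a + e - 2 * C \<le> min (log_dist_ends (T g x)) (real t)"
        using C(2)[OF G_J[OF g] x] C(3)[OF g x] C(4)[OF x] C(1) by (auto simp: a_def e_def min_def split: if_splits)
      have "p g * (a + e - 2 * C) + (\<Sum>j\<in>J-{g}. p j * (a - 2 * C)) \<le>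
          p g * min (log_dist_ends (T g x)) (real t) + (\<Sum>j\<in>J-{g}. p j * min (log_dist_ends (T j x)) (real t))"
        using g1 j1 p_ge0 pg by (intro add_mono sum_mono mult_left_mono) auto
      also have "\<dots> = (\<Sum>j\<in>J. p j * min (log_dist_ends (T j x)) (real t))"
        using G_J[OF g] by (simp add: sum.remove[of J g])
      finally have "p g * e + (\<Sum>j\<in>J. p j * (a - 2 * C)) \<le> (\<Sum>j\<in>J. p j * min (log_dist_ends (T j x)) (real t))"
        using G_J[OF g] by (simp add: sum.remove[of J g] algebra_simps)
      then have "a + p g * e \<le> (\<Sum>j\<in>J. p j * min (log_dist_ends (T j x)) (real t)) + 2 * C"
        using p_sum by (simp add: sum_distrib_right[symmetric] J_def)
      then have "ennreal (a + p g * e) \<le> ennreal ((\<Sum>j\<in>J. p j * min (log_dist_ends (T j x)) (real t)) + 2 * C)"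
        by (rule ennreal_leI)
      also have "\<dots> = (\<Sum>j\<in>J. ennreal (p j * min (log_dist_ends (T j x)) (real t))) + ennreal (2 * C)"
        using C(1) wT p_ge0 by (subst ennreal_plus) (auto intro!: sum_nonneg sum_ennreal[symmetric])
      also have "\<dots> = (\<Sum>j\<in>J. ennreal (p j) * w (T j x)) + ennreal (2 * C)"
        unfolding w_def using p_ge0 by (simp add: ennreal_mult')
      finally show ?thesis using nn pg by (simp add: w_def v_def a_def e_def ennreal_mult')
    qed
    have wfin: "(\<integral>\<^sup>+x\<in>U. w x * h x \<partial>lborel) \<noteq> \<infinity>"
    proof -
      have "(\<integral>\<^sup>+x\<in>U. w x * h x \<partial>lborel) \<le> (\<integral>\<^sup>+x. ennreal (real t) * (h x * indicator U x) \<partial>lborel)"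
        by (intro nn_integral_mono) (auto simp: w_def mult.assoc[symmetric] ennreal_leI intro!: mult_right_mono)
      also have "\<dots> = ennreal (real t) * F" unfolding F_def by (rule nn_integral_cmult) measurable
      also have "\<dots> < \<infinity>" using fin by (simp add: F_def ennreal_mult_less_top less_top)
      finally show ?thesis by simp
    qed
    note [measurable] = T_comp_measurable_U
    have "(\<integral>\<^sup>+x\<in>U. w x * h x \<partial>lborel) + ennreal (p g) * (\<integral>\<^sup>+x\<in>U. v x * h x \<partial>lborel)
       = (\<integral>\<^sup>+x\<in>U. (w x + ennreal (p g) * v x) * h x \<partial>lborel)"
      by (subst nn_integral_cmult[symmetric], measurable, subst nn_integral_add[symmetric], measurable)
        (auto intro!: nn_integral_cong simp: distrib_left distrib_right mult_ac split: split_indicator)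
    also have "\<dots> \<le> (\<integral>\<^sup>+x. (\<Sum>j\<in>J. ennreal (p j) * ((w (T j x) * indicator U x) * h x)) + ennreal (2 * C) * (h x * indicator U x) \<partial>lborel)"
    proof (intro nn_integral_mono)
      fix x
      show "(w x + ennreal (p g) * v x) * h x * indicator U x \<le>
        (\<Sum>j\<in>J. ennreal (p j) * ((w (T j x) * indicator U x) * h x)) + ennreal (2 * C) * (h x * indicator U x)"
      proof (cases "x \<in> U")
        case True
        have "(w x + ennreal (p g) * v x) * h x \<le> ((\<Sum>j\<in>J. ennreal (p j) * w (T j x)) + ennreal (2 * C)) * h x"
          by (rule mult_right_mono[OF pt[OF True]]) simp
        also have "\<dots> = (\<Sum>j\<in>J. ennreal (p j) * (w (T j x) * h x)) + ennreal (2 * C) * h x"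
          by (simp add: distrib_right sum_distrib_right mult.assoc)
        finally show ?thesis using True by simp
      qed simp
    qed
    also have "\<dots> = (\<Sum>j\<in>J. ennreal (p j) * (\<integral>\<^sup>+x. (w (T j x) * indicator U x) * h x \<partial>lborel)) + ennreal (2 * C) * F"
    proof -
      have m: "(\<lambda>x. (w (T j x) * indicator U x) * h x) \<in> borel_measurable lborel" if "j \<in> J" for j
        using T_comp_measurable_U[OF that, of w] by measurable
      then show ?thesis unfolding F_def
        by (subst nn_integral_add) (auto simp: nn_integral_sum nn_integral_cmult intro!: borel_measurable_sum borel_measurable_times_ennreal)
    qed
    also have "\<dots> = (\<integral>\<^sup>+x\<in>U. w x * h x \<partial>lborel) + ennreal (2 * C) * F"
      by (subst stationary_integral[OF h _ Ph, of w]) (auto simp: mult_ac)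
    finally show ?thesis using wfin by (simp add: v_def ennreal_add_left_cancel_le)
  qed
  have Vfin: "(\<integral>\<^sup>+x\<in>U. ennreal (log_dist_c x) * h x \<partial>lborel) \<noteq> \<infinity>"
  proof -
    have "(\<integral>\<^sup>+x\<in>U. ennreal (log_dist_c x) * h x \<partial>lborel) = (\<integral>\<^sup>+x. (SUP t. ennreal (min (log_dist_c x) (real t)) * h x * indicator U x) \<partial>lborel)"
    proof (intro nn_integral_cong)
      fix x
      have "(SUP t. ennreal (min (log_dist_c x) (real t))) = ennreal (log_dist_c x)"
      proof (intro antisym SUP_least)
        obtain t where "log_dist_c x \<le> real t" using real_arch_simple by blast
        then show "ennreal (log_dist_c x) \<le> (SUP t. ennreal (min (log_dist_c x) (real t)))"
          by (intro SUP_upper2[of t]) (auto simp: min_def)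
      qed (auto intro: ennreal_leI)
      then show "ennreal (log_dist_c x) * h x * indicator U x = (SUP t. ennreal (min (log_dist_c x) (real t)) * h x * indicator U x)"
        unfolding SUP_mult_right_ennreal[symmetric] mult.assoc by simp
    qed
    also have "\<dots> = (SUP t. \<integral>\<^sup>+x\<in>U. ennreal (min (log_dist_c x) (real t)) * h x \<partial>lborel)"
      by (rule nn_integral_monotone_convergence_SUP)
        (auto simp: incseq_def le_fun_def intro!: mult_right_mono ennreal_leI)
    also have "\<dots> \<le> ennreal (2 * C) * F / ennreal (p g)"
    proof (rule SUP_least)
      fix t
      have "(\<integral>\<^sup>+x\<in>U. ennreal (min (log_dist_c x) (real t)) * h x \<partial>lborel) =
          ennreal (p g) * (\<integral>\<^sup>+x\<in>U. ennreal (min (log_dist_c x) (real t)) * h x \<partial>lborel) / ennreal (p g)"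
        using pg by (subst mult.commute, subst mult_divide_eq_ennreal) auto
      also have "\<dots> \<le> ennreal (2 * C) * F / ennreal (p g)" by (rule divide_right_mono_ennreal[OF Vt])
      finally show "(\<integral>\<^sup>+x\<in>U. ennreal (min (log_dist_c x) (real t)) * h x \<partial>lborel) \<le> ennreal (2 * C) * F / ennreal (p g)" .
    qed
    also have "\<dots> < \<infinity>" using fin pg by (simp add: F_def ennreal_divide_eq_top_iff ennreal_mult_eq_top_iff less_top[symmetric])
    finally show ?thesis by simp
  qed
  \<comment> \<open>Beyond the level \<open>K\<close> the gain \<open>(l b - 1) * K\<close>
    outweighs the loss \<open>C\<close> with 1 to spare, for every bad map at once; a sum of
    non-negative terms takes the place of a maximum.\<close>
  define K where "K = (\<Sum>b\<in>SigmaB. (C + 1) / (l b - 1))"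
  have K: "C + 1 \<le> (l b - 1) * K" if b: "b \<in> SigmaB" for b
  proof -
    have "(C + 1) / (l b - 1) \<le> K" unfolding K_def
      using b fin_GB C(1) l_gt1 by (intro member_le_sum) (auto intro!: divide_nonneg_pos)
    then show ?thesis using l_gt1[OF b] by (simp add: field_simps)
  qed
  have K0: "0 \<le> K" unfolding K_def using C(1) l_gt1 by (intro sum_nonneg divide_nonneg_pos) auto
  define vk where "vk x = ennreal (log_dist_c x - K)" for x
  define D where "D = {x. K < log_dist_c x}"
  have [measurable]: "vk \<in> borel_measurable borel" unfolding vk_def[abs_def] by measurable
  have [measurable]: "D \<in> sets borel" unfolding D_def by measurable
  have vT: "ennreal (l b) * vk x + indicator D x \<le> vk (T b x)" if b: "b \<in> SigmaB" and x: "x \<in> U" for b x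
  proof (cases "x \<in> D")
    case True
    have "l b * (log_dist_c x - K) + 1 \<le> log_dist_c (T b x) - K"
      using C(5)[OF b x] K[OF b] by (simp add: algebra_simps)
    then have "ennreal (l b * (log_dist_c x - K) + 1) \<le> vk (T b x)" unfolding vk_def by (rule ennreal_leI)
    moreover have "0 < log_dist_c x - K" using True by (simp add: D_def)
    ultimately show ?thesis using l_gt1[OF b] True by (simp add: vk_def ennreal_mult')
  next
    case False
    then have "vk x = 0" by (simp add: vk_def D_def ennreal_neg)
    then show ?thesis using False by simp
  qed
  define I where "I = (\<integral>\<^sup>+x\<in>U. vk x * h x \<partial>lborel)"
  define m where "m = (\<integral>\<^sup>+x\<in>U. indicator D x * h x \<partial>lborel)"
  have Ifin: "I \<noteq> \<infinity>"
  proof -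
    have "I \<le> (\<integral>\<^sup>+x\<in>U. ennreal (log_dist_c x) * h x \<partial>lborel)"
      unfolding I_def vk_def using K0 by (intro nn_integral_mono mult_right_mono ennreal_leI) auto
    then show ?thesis using Vfin by (auto simp: top_unique)
  qed
  have one: "ennreal (l b) * I + m \<le> (\<integral>\<^sup>+x\<in>U. vk (T b x) * h x \<partial>lborel)" if b: "b \<in> SigmaB" for b
  proof -
    have "ennreal (l b) * I + m = (\<integral>\<^sup>+x\<in>U. (ennreal (l b) * vk x + indicator D x) * h x \<partial>lborel)"
      unfolding I_def m_def
      by (subst nn_integral_cmult[symmetric], measurable, subst nn_integral_add[symmetric], measurable)
        (auto intro!: nn_integral_cong simp: distrib_left distrib_right mult_ac split: split_indicator)
    also have "\<dots> \<le> (\<integral>\<^sup>+x\<in>U. vk (T b x) * h x \<partial>lborel)"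
    proof (intro nn_integral_mono)
      fix x
      show "(ennreal (l b) * vk x + indicator D x) * h x * indicator U x \<le> vk (T b x) * h x * indicator U x"
        using mult_right_mono[OF vT[OF b], of x "h x"] by (cases "x \<in> U") auto
    qed
    finally show ?thesis .
  qed
  have "(\<Sum>b\<in>SigmaB. ennreal (p b) * (ennreal (l b) * I + m)) \<le> (\<Sum>b\<in>SigmaB. ennreal (p b) * (\<integral>\<^sup>+x\<in>U. vk (T b x) * h x \<partial>lborel))"
    using one by (intro sum_mono mult_left_mono) auto
  also have "\<dots> \<le> (\<Sum>b\<in>J. ennreal (p b) * (\<integral>\<^sup>+x\<in>U. vk (T b x) * h x \<partial>lborel))"
    using B_J by (intro sum_mono2) auto
  also have "\<dots> = I" unfolding I_def by (rule stationary_integral[OF h _ Ph, symmetric]) measurable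
  finally have le: "(\<Sum>b\<in>SigmaB. ennreal (p b) * (ennreal (l b) * I + m)) \<le> I" .
  \<comment> \<open>With \<theta> \<ge> 1 the integral \<open>I\<close> of the excess over
    \<open>K\<close> would increase by at least a multiple of \<open>m\<close>. As \<open>I\<close>
    is finite, \<open>m\<close> must be 0.\<close>
  have "I + ennreal (\<Sum>b\<in>SigmaB. p b) * m \<le> ennreal (\<Sum>b\<in>SigmaB. p b * l b) * I + ennreal (\<Sum>b\<in>SigmaB. p b) * m"
    using \<theta> mult_right_mono[of 1 "ennreal (\<Sum>b\<in>SigmaB. p b * l b)" I] by (intro add_right_mono) auto
  also have "\<dots> = (\<Sum>b\<in>SigmaB. ennreal (p b) * (ennreal (l b) * I + m))"
  proof -
    have "ennreal (\<Sum>b\<in>SigmaB. p b * l b) = (\<Sum>b\<in>SigmaB. ennreal (p b) * ennreal (l b))"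
    proof -
      have nn: "0 \<le> p b" "0 \<le> l b" if "b \<in> SigmaB" for b using p_ge0[OF B_J[OF that]] l_gt1[OF that] by auto
      then have "(\<Sum>b\<in>SigmaB. ennreal (p b) * ennreal (l b)) = (\<Sum>b\<in>SigmaB. ennreal (p b * l b))"
        by (intro sum.cong refl) (simp add: ennreal_mult)
      also have "\<dots> = ennreal (\<Sum>b\<in>SigmaB. p b * l b)" using nn by (intro sum_ennreal) auto
      finally show ?thesis by simp
    qed
    moreover have "ennreal (\<Sum>b\<in>SigmaB. p b) = (\<Sum>b\<in>SigmaB. ennreal (p b))"
      using p_ge0 B_J by (subst sum_ennreal[symmetric]) auto
    ultimately show ?thesis by (simp add: sum_distrib_right distrib_left sum.distrib mult.assoc)
  qed
  finally have "I + ennreal (\<Sum>b\<in>SigmaB. p b) * m \<le> I" using le by (rule order_trans)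
  then have "I + ennreal (\<Sum>b\<in>SigmaB. p b) * m \<le> I + 0" by (simp only: add_0_right)
  then have "ennreal (\<Sum>b\<in>SigmaB. p b) * m \<le> 0" using Ifin by (subst (asm) ennreal_add_left_cancel_le) auto
  moreover have "0 < (\<Sum>b\<in>SigmaB. p b)"
    using p_pos B_J B_ne fin_GB by (intro sum_pos) (auto simp: J_def)
  ultimately have "m = 0" by simp
  then have "AE x in lborel. indicator D x * h x * indicator U x = 0"
    unfolding m_def by (subst (asm) nn_integral_0_iff_AE) auto
  with full_support[OF h Ph nz] AE_U have "AE x in lborel. \<not> (x \<in> D \<and> x \<in> {0<..<1})"
    by eventually_elim (auto simp: indicator_def split: if_splits)
  then have "emeasure lborel {x. x \<in> D \<and> x \<in> {0<..<1}} = 0"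
    by (subst (asm) AE_iff_measurable[OF _ refl]) (auto simp: conj_ac)
  \<comment> \<open>\<open>D\<close> contains a one-sided neighbourhood of \<open>c\<close>, where
    \<open>h\<close> is positive almost everywhere; so \<open>m = 0\<close> is impossible.\<close>
  moreover have "{c<..<min 1 (c + exp (- K))} \<subseteq> {x. x \<in> D \<and> x \<in> {0<..<1}}"
  proof
    fix x assume x: "x \<in> {c<..<min 1 (c + exp (- K))}"
    then have "ln (x - c) < ln (exp (- K))" by (subst ln_less_cancel_iff) auto
    then show "x \<in> {x. x \<in> D \<and> x \<in> {0<..<1}}" using x c01 by (auto simp: D_def log_dist_c_def)
  qed
  then have "emeasure lborel {c<..<min 1 (c + exp (- K))} \<le> emeasure lborel {x. x \<in> D \<and> x \<in> {0<..<1}}"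
    by (intro emeasure_mono) auto
  ultimately show False using c01 by (auto simp: min_def split: if_splits)
qed

subsection \<open>Iterates of Lebesgue measure\<close>

definition fn :: "nat \<Rightarrow> real \<Rightarrow> ennreal" where "fn n = (P ^^ n) (\<lambda>_. 1)"
definition F :: "nat \<Rightarrow> real set \<Rightarrow> ennreal" where "F n A = (\<integral>\<^sup>+x\<in>A. fn n x \<partial>lborel)"
definition pre :: "nat \<Rightarrow> real set \<Rightarrow> real set" where "pre j A = {x \<in> U. T j x \<in> A}"

lemma fn_Suc: "fn (Suc n) = P (fn n)" by (simp add: fn_def)

lemma fn_measurable[measurable]: "fn n \<in> borel_measurable borel"
  by (induction n) (auto simp: fn_Suc, simp add: fn_def)

lemma fn_cone: "cone (lo i) (hi i) (fn n)"
proof (induction n arbitrary: i)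
  case 0 then show ?case using cone_one by (simp add: fn_def)
next
  case (Suc n) then show ?case unfolding fn_Suc by (rule P_cone)
qed

lemma F_U: "F n U = 1"
proof (induction n)
  case 0
  have "emeasure lborel U = emeasure lborel ({0<..<1::real})"
    unfolding U_alt by (rule emeasure_Diff_null_set) (auto intro: null_setsI)
  then show ?case by (simp add: F_def fn_def)
next
  case (Suc n)
  have "F (Suc n) U = (\<integral>\<^sup>+x. P (fn n) x \<partial>lborel)"
    unfolding F_def fn_Suc using AE_U
    by (intro nn_integral_cong_AE, eventually_elim) (auto simp: U_alt P_outside split: split_indicator)
  also have "\<dots> = F n U" unfolding F_def by (rule P_mass) measurable
  finally show ?case using Suc by simp
qed

lemma F_mono: "A \<subseteq> B \<Longrightarrow> F n A \<le> F n B"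
  unfolding F_def by (intro nn_integral_mono) (auto split: split_indicator)

lemma F_Un: "A \<in> sets borel \<Longrightarrow> B \<in> sets borel \<Longrightarrow> F n (A \<union> B) \<le> F n A + F n B"
  unfolding F_def
  by (subst nn_integral_add[symmetric]) (auto intro!: nn_integral_mono split: split_indicator)

lemma F_le: assumes [measurable]: "A \<in> sets borel" and k: "\<And>x. x \<in> A \<Longrightarrow> fn n x \<le> k"
  shows "F n A \<le> k * emeasure lborel A"
proof -
  have "F n A \<le> (\<integral>\<^sup>+x. k * indicator A x \<partial>lborel)"
    unfolding F_def using k by (intro nn_integral_mono) (auto split: split_indicator)
  then show ?thesis by (simp add: nn_integral_cmult_indicator)
qed

lemma pre_U: "pre j A \<subseteq> U" by (auto simp: pre_def)

lemma pre_borel: assumes j: "j \<in> J" and A: "A \<in> sets borel" shows "pre j A \<in> sets borel"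
proof -
  have "(\<lambda>x. indicator A (T j x) * indicator U x :: ennreal) \<in> borel_measurable borel"
    by (rule T_comp_measurable_U[OF j]) (use A in auto)
  then have "(\<lambda>x. indicator (pre j A) x :: ennreal) \<in> borel_measurable borel"
    by (rule measurable_cong[THEN iffD1, rotated]) (auto simp: pre_def split: split_indicator)
  then show ?thesis by (simp add: borel_measurable_indicator_iff)
qed

lemma F_Suc: assumes A: "A \<in> sets borel" shows "F (Suc n) A = (\<Sum>j\<in>J. ennreal (p j) * F n (pre j A))"
proof -
  have "F (Suc n) A = (\<integral>\<^sup>+y. indicator A y * P (fn n) y \<partial>lborel)"
    unfolding F_def fn_Suc by (simp add: mult.commute)
  also have "\<dots> = (\<Sum>j\<in>J. ennreal (p j) * (\<integral>\<^sup>+x\<in>U. indicator A (T j x) * fn n x \<partial>lborel))"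
    by (rule P_dual) (use A in auto)
  also have "\<dots> = (\<Sum>j\<in>J. ennreal (p j) * F n (pre j A))"
  proof (intro sum.cong refl)
    fix j
    have "(\<integral>\<^sup>+x\<in>U. indicator A (T j x) * fn n x \<partial>lborel) = F n (pre j A)"
      unfolding F_def pre_def by (intro nn_integral_cong) (auto split: split_indicator)
    then show "ennreal (p j) * (\<integral>\<^sup>+x\<in>U. indicator A (T j x) * fn n x \<partial>lborel) = ennreal (p j) * F n (pre j A)" by simp
  qed
  finally show ?thesis .
qed

lemma emeasure_U_fin: "S \<subseteq> U \<Longrightarrow> emeasure lborel S \<noteq> \<infinity>" "S \<subseteq> U \<Longrightarrow> emeasure lborel S \<le> 1"
proof -
  assume "S \<subseteq> U"
  then have "emeasure lborel S \<le> emeasure lborel {0<..<1::real}" by (intro emeasure_mono) (auto simp: U_alt)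
  then show "emeasure lborel S \<noteq> \<infinity>" "emeasure lborel S \<le> 1" by (auto simp: top_unique)
qed

lemma emeasure_U: "S \<subseteq> U \<Longrightarrow> emeasure lborel S = ennreal (measure lborel S)"
  using emeasure_U_fin(1) by (intro emeasure_eq_ennreal_measure) auto

lemma fmeasurable_U: "S \<in> sets borel \<Longrightarrow> S \<subseteq> U \<Longrightarrow> S \<in> fmeasurable lborel"
  using emeasure_U_fin(1)[of S] by (intro fmeasurableI) (auto simp: less_top)

lemma measure_U_le1: "S \<subseteq> U \<Longrightarrow> measure lborel S \<le> 1"
  using emeasure_U_fin(2)[of S] emeasure_U[of S] by (simp add: ennreal_le_1)

text \<open>The point is uniformity in \<open>n\<close>: every \<open>fn n\<close> lies in the cone
  of its piece and has mass at most 1 there, so \<open>cone_bound\<close> applies with constants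
  depending on \<open>e\<close> alone.\<close>

lemma fn_middle:
  assumes e: "0 < e" "e \<le> min c (1 - c) / 4"
  obtains C where "0 \<le> C" "\<And>n i x. x \<in> pc i \<Longrightarrow> e \<le> \<bar>x - c\<bar> \<Longrightarrow> e \<le> \<bar>x - outer i\<bar> \<Longrightarrow> fn n x \<le> ennreal C"
proof -
  define D where "D i = ((hi i - lo i) / e)\<^sup>2 / (hi i - lo i - 2 * e)" for i
  have len: "2 * e < hi i - lo i" for i using e c01 by (cases i) (auto simp: lo_def hi_def)
  have D: "0 \<le> D i" for i using len[of i] e by (auto simp: D_def)
  show thesis
  proof (rule that[of "D True + D False"])
    show "0 \<le> D True + D False" using D by simp
    fix n i x assume x: "x \<in> pc i" "e \<le> \<bar>x - c\<bar>" "e \<le> \<bar>x - outer i\<bar>"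
    have "(\<integral>\<^sup>+x\<in>pc i. fn n x \<partial>lborel) \<le> F n U" unfolding F_def using pc_U[of i]
      by (intro nn_integral_mono) (auto split: split_indicator)
    then have "fn n x \<le> ennreal (D i)"
      unfolding D_def F_U using x len[of i]
      by (intro cone_bound[OF fn_cone _ e(1)]) (cases i, auto simp: lo_def hi_def outer_def)
    also have "\<dots> \<le> ennreal (D True + D False)" using D by (intro ennreal_leI) (cases i, auto)
    finally show "fn n x \<le> ennreal (D True + D False)" .
  qed
qed

text \<open>At \<open>c\<close> there is no uniform bound for \<open>fn n\<close> itself, but there
  is one for the part that arrives through a good map in the last step: it belongs to the cone of
  (0,1), for which \<open>c\<close> is an interior point.\<close>

lemma good_middle:
  assumes e: "0 < e" "e < 1/2"
  obtains C where "0 \<le> C"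
    "\<And>n g A. g \<in> SigmaG \<Longrightarrow> A \<in> sets borel \<Longrightarrow> A \<subseteq> {e..1-e} \<Longrightarrow> F n (pre g A) \<le> ennreal C * emeasure lborel A"
proof -
  define D where "D = (1 / e)\<^sup>2 / (1 - 2 * e)"
  have D: "0 \<le> D" using e by (simp add: D_def)
  show thesis
  proof (rule that[of "2 * D"])
    show "0 \<le> 2 * D" using D by simp
    fix n g A assume g: "g \<in> SigmaG" and A[measurable]: "A \<in> sets borel" and sub: "A \<subseteq> {e..1-e}"
    note gJ = G_J[OF g]
    have pt: "Bop g i (fn n) y \<le> ennreal D" if y: "y \<in> A" for i y
    proof -
      have "(\<integral>\<^sup>+x\<in>{0<..<1}. Bop g i (fn n) x \<partial>lborel) \<le> (\<integral>\<^sup>+x. 1 * Bop g i (fn n) x \<partial>lborel)"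
        by (intro nn_integral_mono) (auto split: split_indicator)
      also have "\<dots> = (\<integral>\<^sup>+x\<in>pc i. 1 * fn n x \<partial>lborel)" by (rule Bop_dual[OF gJ]) auto
      also have "\<dots> \<le> F n U" unfolding F_def using pc_U[of i]
        by (intro nn_integral_mono) (auto split: split_indicator)
      finally have m: "(\<integral>\<^sup>+x\<in>{0<..<1}. Bop g i (fn n) x \<partial>lborel) \<le> 1" by (simp add: F_U)
      have "Bop g i (fn n) y \<le> ennreal (((1 - 0) / e)\<^sup>2 / (1 - 0 - 2 * e))"
        by (rule cone_bound[OF Bop_cone_good[OF g fn_cone] _ e(1) _ m])
          (use e y sub gJ in \<open>auto intro: Bop_measurable\<close>)
      then show ?thesis by (simp add: D_def)
    qed
    have "F n (pre g A) = (\<integral>\<^sup>+x. (\<Sum>i\<in>UNIV. indicator A (T g x) * fn n x * indicator (pc i) x) \<partial>lborel)"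
      unfolding F_def sum_distrib_left[symmetric] pc_disj[symmetric]
      by (intro nn_integral_cong) (auto simp: pre_def split: split_indicator)
    also have "\<dots> = (\<Sum>i\<in>UNIV. \<integral>\<^sup>+x\<in>pc i. indicator A (T g x) * fn n x \<partial>lborel)"
    proof (rule nn_integral_sum)
      fix i
      have "(\<lambda>x. (indicator A (T g x) * indicator (pc i) x) * fn n x) \<in> borel_measurable lborel"
        using T_comp_measurable[OF gJ, of "indicator A" i] by measurable
      then show "(\<lambda>x. indicator A (T g x) * fn n x * indicator (pc i) x) \<in> borel_measurable lborel"
        by (simp add: mult_ac)
    qed
    also have "\<dots> = (\<Sum>i\<in>UNIV. \<integral>\<^sup>+y. indicator A y * Bop g i (fn n) y \<partial>lborel)"
      by (intro sum.cong refl Bop_dual[OF gJ, symmetric]) measurable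
    also have "\<dots> \<le> (\<Sum>i\<in>(UNIV::bool set). \<integral>\<^sup>+y. ennreal D * indicator A y \<partial>lborel)"
      using pt by (intro sum_mono nn_integral_mono) (auto split: split_indicator)
    also have "\<dots> = ennreal (2 * D) * emeasure lborel A"
    proof -
      have 1: "ennreal (2 * D) = ennreal D + ennreal D" using D by (simp add: ennreal_plus[symmetric] del: ennreal_plus)
      have 2: "(\<integral>\<^sup>+y. ennreal D * indicator A y \<partial>lborel) = ennreal D * emeasure lborel A"
        using A by (simp add: nn_integral_cmult_indicator)
      show ?thesis unfolding 1 2 distrib_right by (simp only: UNIV_bool, simp, rule mult_2)
    qed
    finally show "F n (pre g A) \<le> ennreal (2 * D) * emeasure lborel A" .
  qed
qed

lemma pre_large_derivative:
  assumes j: "j \<in> J" and A: "A \<in> sets borel" "A \<subseteq> U" and S: "S \<in> sets borel" "S \<subseteq> pc i"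
    and k: "0 < k" "\<And>x. x \<in> S \<Longrightarrow> k \<le> \<bar>der (T j) x\<bar>"
  shows "measure lborel (pre j A \<inter> S) \<le> measure lborel A / k"
proof -
  interpret b: branch c "outer i" "lo i" "hi i" "iu j i" "iv j i" "T j" "ee j" "fst (KM j)" "snd (KM j)"
    by (rule branch_inst[OF j])
  have E: "pre j A \<inter> S \<in> sets borel" using pre_borel[OF j A(1)] S by auto
  have "ennreal k * emeasure lborel (pre j A \<inter> S) = (\<integral>\<^sup>+x. ennreal k * indicator (pre j A \<inter> S) x \<partial>lborel)"
    using E by (simp add: nn_integral_cmult_indicator)
  also have "\<dots> \<le> (\<integral>\<^sup>+x\<in>pc i. indicator A (T j x) * ennreal \<bar>der (T j) x\<bar> \<partial>lborel)"
    using k(2) S(2) by (intro nn_integral_mono) (auto simp: pre_def ennreal_leI split: split_indicator)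
  also have "\<dots> = (\<integral>\<^sup>+y\<in>Z j i. indicator A y \<partial>lborel)" by (rule b.cv_T[symmetric]) (use A in auto)
  also have "\<dots> \<le> (\<integral>\<^sup>+y. indicator A y \<partial>lborel)" by (intro nn_integral_mono) (auto split: split_indicator)
  also have "\<dots> = emeasure lborel A" using A by simp
  finally have "ennreal k * emeasure lborel (pre j A \<inter> S) \<le> emeasure lborel A" .
  moreover have "pre j A \<inter> S \<subseteq> U" using pre_U by auto
  ultimately have "ennreal (k * measure lborel (pre j A \<inter> S)) \<le> ennreal (measure lborel A)"
    using k(1) A by (simp add: emeasure_U ennreal_mult)
  then have "k * measure lborel (pre j A \<inter> S) \<le> measure lborel A" by (simp add: ennreal_le_iff)
  then show ?thesis using k(1) by (simp add: field_simps)
qed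

text \<open>If the preimage has measure \<open>s\<close>, then at least half of it is at distance
  \<open>s/2\<close> or more from \<open>c\<close>, where the derivative is at least
  \<open>K * (s/2) powr (ee j - 1)\<close>. Hence \<open>K * (s/2) powr ee j\<close> is at most the
  measure of \<open>A\<close>, wherever \<open>A\<close> lies.\<close>

lemma pre_holder_piece:
  assumes j: "j \<in> J" and A: "A \<in> sets borel" "A \<subseteq> U"
  shows "measure lborel (pre j A \<inter> pc i) \<le> 2 * (measure lborel A / fst (KM j)) powr (1 / ee j)"
proof -
  interpret b: branch c "outer i" "lo i" "hi i" "iu j i" "iv j i" "T j" "ee j" "fst (KM j)" "snd (KM j)"
    by (rule branch_inst[OF j])
  define K where "K = fst (KM j)"
  define E where "E = pre j A \<inter> pc i"
  define s where "s = measure lborel E"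
  have K: "0 < K" using b.K0 by (simp add: K_def)
  have E: "E \<in> sets borel" "E \<subseteq> U" using pre_borel[OF j A(1)] pre_U by (auto simp: E_def)
  show ?thesis
  proof (cases "s = 0")
    case True
    then show ?thesis by (simp add: s_def E_def)
  next
    case False
    then have s: "0 < s" by (simp add: s_def zero_less_measure_iff)
    define S where "S = {x \<in> pc i. s / 2 \<le> \<bar>x - c\<bar>}"
    define near where "near = {x \<in> pc i. \<bar>x - c\<bar> < s / 2}"
    have Sm: "S \<in> sets borel" "near \<in> sets borel" unfolding S_def near_def by measurable
    have "measure lborel near \<le> s / 2"
    proof -
      have "near \<subseteq> (if i then {c - s/2..c} else {c..c + s/2})"
        by (cases i) (auto simp: near_def lo_def hi_def)
      then have "measure lborel near \<le> measure lborel (if i then {c - s/2..c} else {c..c + s/2})"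
        using Sm by (intro measure_mono_fmeasurable) (auto intro!: fmeasurableI simp: emeasure_lborel_Icc_eq)
      also have "\<dots> = s / 2" using s by auto
      finally show ?thesis .
    qed
    moreover have "s \<le> measure lborel (E \<inter> S) + measure lborel near"
    proof -
      have f: "E \<inter> S \<in> fmeasurable lborel" "near \<in> fmeasurable lborel"
      proof -
        have "near \<subseteq> U" using pc_U[of i] by (auto simp: near_def)
        then show "E \<inter> S \<in> fmeasurable lborel" "near \<in> fmeasurable lborel" using E Sm by (auto intro!: fmeasurable_U)
      qed
      have "s \<le> measure lborel (E \<inter> S \<union> near)"
        unfolding s_def using E f
        by (intro measure_mono_fmeasurable) (auto simp: E_def S_def near_def)
      also have "\<dots> \<le> measure lborel (E \<inter> S) + measure lborel near"
        using f by (intro measure_Un_le) auto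
      finally show ?thesis .
    qed
    ultimately have half: "s / 2 \<le> measure lborel (E \<inter> S)" by simp
    define k where "k = K * (s/2) powr (ee j - 1)"
    have k: "0 < k" using K s by (simp add: k_def)
    have "measure lborel (pre j A \<inter> S) \<le> measure lborel A / k"
    proof (rule pre_large_derivative[OF j A Sm(1) _ k])
      fix x assume x: "x \<in> S"
      then have "k \<le> K * \<bar>x - c\<bar> powr (ee j - 1)"
        unfolding k_def using K s b.e1 by (intro mult_left_mono powr_mono2) (auto simp: S_def)
      also have "\<dots> \<le> \<bar>der (T j) x\<bar>" using b.bounds[of x] x by (auto simp: S_def K_def)
      finally show "k \<le> \<bar>der (T j) x\<bar>" .
    qed (auto simp: S_def)
    moreover have "E \<inter> S = pre j A \<inter> S" by (auto simp: E_def S_def)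
    ultimately have "s / 2 \<le> measure lborel A / k" using half by (metis order_trans)
    then have "s / 2 * k \<le> measure lborel A" using k by (simp add: pos_le_divide_eq)
    moreover have "s / 2 * k = K * (s / 2) powr ee j" using s by (simp add: k_def powr_diff)
    ultimately have "(s / 2) powr ee j \<le> measure lborel A / K" using K by (simp add: field_simps)
    then have "((s / 2) powr ee j) powr (1 / ee j) \<le> (measure lborel A / K) powr (1 / ee j)"
      using b.e1 by (intro powr_mono2) auto
    moreover have "((s / 2) powr ee j) powr (1 / ee j) = s / 2" using s b.e1 by (simp add: powr_powr)
    ultimately show ?thesis by (simp add: s_def E_def K_def)
  qed
qed

lemma pre_holder:
  obtains C where "1 \<le> C" "\<And>j A. j \<in> J \<Longrightarrow> A \<in> sets borel \<Longrightarrow> A \<subseteq> U \<Longrightarrow>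
    measure lborel (pre j A) \<le> C * measure lborel A powr (1 / ee j)"
proof -
  define D where "D j = 4 * (1 / fst (KM j)) powr (1 / ee j)" for j
  define C where "C = 1 + (\<Sum>j\<in>J. D j)"
  have D: "0 \<le> D j" for j by (simp add: D_def)
  show thesis
  proof (rule that[of C])
    show "1 \<le> C" using D by (simp add: C_def sum_nonneg)
    fix j A assume j: "j \<in> J" and A: "A \<in> sets borel" "A \<subseteq> U"
    have m: "pre j A \<inter> pc i \<in> fmeasurable lborel" for i
      using pre_borel[OF j A(1)] pre_U by (intro fmeasurable_U) auto
    have "pre j A = (pre j A \<inter> pc True) \<union> (pre j A \<inter> pc False)" using pre_U by (auto simp: U_def)
    then have "measure lborel (pre j A) \<le> measure lborel (pre j A \<inter> pc True) + measure lborel (pre j A \<inter> pc False)"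
      using m by (metis fmeasurableD measure_Un_le)
    also have "\<dots> \<le> 4 * (measure lborel A / fst (KM j)) powr (1 / ee j)"
      using pre_holder_piece[OF j A, of True] pre_holder_piece[OF j A, of False] by simp
    also have "\<dots> = D j * measure lborel A powr (1 / ee j)"
      using KM(1)[OF j] by (simp add: D_def powr_divide)
    also have "\<dots> \<le> C * measure lborel A powr (1 / ee j)"
    proof (rule mult_right_mono)
      have "D j \<le> (\<Sum>j\<in>J. D j)" using j D by (intro member_le_sum) auto
      then show "D j \<le> C" by (simp add: C_def)
    qed simp
    finally show "measure lborel (pre j A) \<le> C * measure lborel A powr (1 / ee j)" .
  qed
qed

subsection \<open>The comparison functions\<close>

definition "theta = (\<Sum>b\<in>SigmaB. p b * l b)"
definition "rmax = Max (r ` SigmaG)"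
definition "lmax = Max (l ` SigmaB)"

lemma pB: "b \<in> SigmaB \<Longrightarrow> 0 < p b" and pG: "g \<in> SigmaG \<Longrightarrow> 0 < p g"
  using p_pos B_J G_J by (auto simp: J_def)

lemma l_le: "b \<in> SigmaB \<Longrightarrow> l b \<le> lmax" unfolding lmax_def using fin_GB by auto
lemma r_le: "g \<in> SigmaG \<Longrightarrow> r g \<le> rmax" unfolding rmax_def using fin_GB by auto
lemma lmax_gt1: "1 < lmax" using B_ne l_gt1 l_le by (meson all_not_in_conv less_le_trans)
lemma rmax_ge1: "1 \<le> rmax" using G_ne r_ge1 r_le by (meson all_not_in_conv order_trans)
lemma theta_pos: "0 < theta"
proof -
  have "0 < p b * l b" if "b \<in> SigmaB" for b using pB[OF that] l_gt1[OF that] by simp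
  then show ?thesis unfolding theta_def by (rule sum_pos[OF fin_GB(2) B_ne])
qed

text \<open>A sum over words of \<open>k\<close> bad maps: the probability of the word times
  \<open>s\<close> to the reciprocal of the product of its exponents. It models the measure of the
  preimages of a set near \<open>c\<close>, with the constants stripped off.\<close>

primrec psi :: "nat \<Rightarrow> real \<Rightarrow> real" where
  "psi 0 s = s"
| "psi (Suc k) s = (\<Sum>b\<in>SigmaB. p b * psi k (s powr (1 / l b)))"

definition PS :: "nat \<Rightarrow> real \<Rightarrow> real" where "PS n s = (\<Sum>k\<le>n. psi k s)"

lemma psi_nonneg: "0 \<le> s \<Longrightarrow> 0 \<le> psi k s"
proof (induction k arbitrary: s)
  case (Suc k)
  have "0 \<le> p b * psi k (s powr (1 / l b))" if "b \<in> SigmaB" for b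
    using pB[OF that] Suc.IH[of "s powr (1 / l b)"] by simp
  then show ?case unfolding psi.simps by (rule sum_nonneg)
qed simp

lemma psi_mono: "0 \<le> s \<Longrightarrow> s \<le> t \<Longrightarrow> psi k s \<le> psi k t"
proof (induction k arbitrary: s t)
  case (Suc k)
  have "psi k (s powr (1 / l b)) \<le> psi k (t powr (1 / l b))" if "b \<in> SigmaB" for b
    using Suc.prems l_gt1[OF that] by (intro Suc.IH powr_mono2) auto
  then have "p b * psi k (s powr (1 / l b)) \<le> p b * psi k (t powr (1 / l b))" if "b \<in> SigmaB" for b
    using pB[OF that] that by (intro mult_left_mono) auto
  then show ?case unfolding psi.simps by (rule sum_mono)
qed simp

lemma PS_mono: "0 \<le> s \<Longrightarrow> s \<le> t \<Longrightarrow> PS n s \<le> PS n t"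
  unfolding PS_def by (intro sum_mono psi_mono)

lemma PS_nonneg: "0 \<le> s \<Longrightarrow> 0 \<le> PS n s"
  unfolding PS_def by (intro sum_nonneg psi_nonneg)

text \<open>Brings \<open>PS\<close> into the form of the recursion in
  \<open>center_step\<close>.\<close>

lemma PS_Suc: "PS (Suc n) s = s + (\<Sum>b\<in>SigmaB. p b * PS n (s powr (1 / l b)))"
proof -
  have "PS (Suc n) s = s + (\<Sum>k\<le>n. psi (Suc k) s)" unfolding PS_def by (subst sum.atMost_Suc_shift) simp
  also have "(\<Sum>k\<le>n. psi (Suc k) s) = (\<Sum>b\<in>SigmaB. p b * PS n (s powr (1 / l b)))"
    unfolding PS_def sum_distrib_left psi.simps by (rule sum.swap)
  finally show ?thesis .
qed

lemma PS_le_Suc: "0 \<le> s \<Longrightarrow> PS n s \<le> PS (Suc n) s"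
  using psi_nonneg[of s "Suc n"] by (simp add: PS_def)

lemma exponent_le:
  assumes b: "b \<in> SigmaB" and s: "0 \<le> s" "s \<le> 1" and a: "0 < a"
  shows "s powr (a / l b / lmax ^ k) \<le> s powr (a / lmax ^ Suc k)"
proof (rule powr_mono'[OF _ s])
  have "l b * lmax ^ k \<le> lmax * lmax ^ k" using l_le[OF b] lmax_gt1 by (intro mult_right_mono) auto
  then have "a / (lmax * lmax ^ k) \<le> a / (l b * lmax ^ k)"
    using a l_gt1[OF b] lmax_gt1 by (intro divide_left_mono) auto
  then show "a / lmax ^ Suc k \<le> a / l b / lmax ^ k" by simp
qed

text \<open>The true weights are products of the \<open>p b\<close>; inserting factors
  \<open>l b > 1\<close> is wasteful here, but \<theta> is needed near the endpoints anyway. The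
  exponents may be lowered to powers of \<open>1 / lmax\<close> because
  \<open>s \<le> 1\<close>.\<close>

lemma psi_bound:
  assumes "0 \<le> s" "s \<le> 1" shows "psi k s \<le> theta ^ k * s powr (1 / lmax ^ k)"
  using assms
proof (induction k arbitrary: s)
  case (Suc k)
  have "psi (Suc k) s \<le> (\<Sum>b\<in>SigmaB. (p b * l b) * (theta ^ k * s powr (1 / lmax ^ Suc k)))"
    unfolding psi.simps
  proof (rule sum_mono)
    fix b assume b: "b \<in> SigmaB"
    have "s powr (1 / l b) \<le> 1" using Suc l_gt1[OF b] by (intro powr_le1) auto
    then have "psi k (s powr (1 / l b)) \<le> theta ^ k * (s powr (1 / l b)) powr (1 / lmax ^ k)"
      by (intro Suc.IH) auto
    also have "\<dots> = theta ^ k * s powr (1 / l b / lmax ^ k)" by (simp add: powr_powr)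
    also have "\<dots> \<le> theta ^ k * s powr (1 / lmax ^ Suc k)"
      using theta_pos exponent_le[OF b Suc.prems, of 1 k] by (intro mult_left_mono) auto
    finally have "psi k (s powr (1 / l b)) \<le> 1 * (theta ^ k * s powr (1 / lmax ^ Suc k))" by simp
    also have "\<dots> \<le> l b * (theta ^ k * s powr (1 / lmax ^ Suc k))"
      using l_gt1[OF b] theta_pos by (intro mult_right_mono) auto
    finally have "p b * psi k (s powr (1 / l b)) \<le> p b * (l b * (theta ^ k * s powr (1 / lmax ^ Suc k)))"
      using pB[OF b] by (intro mult_left_mono) auto
    then show "p b * psi k (s powr (1 / l b)) \<le> (p b * l b) * (theta ^ k * s powr (1 / lmax ^ Suc k))"
      by (simp add: mult.assoc)
  qed
  also have "\<dots> = theta * (theta ^ k * s powr (1 / lmax ^ Suc k))"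
    unfolding theta_def by (rule sum_distrib_right[symmetric])
  finally show ?case by simp
qed simp

text \<open>The factor \<open>1/a\<close> is what turns \<open>p\<^sub>b\<close> into \<open>p\<^sub>b \<ell>\<^sub>b\<close>: escaping from an endpoint after a close
  passage to \<open>c\<close> takes a time proportional to the logarithm of the distance.\<close>

lemma psi_geometric:
  assumes \<rho>: "0 < \<rho>" "\<rho> < 1" and "0 \<le> s" "s \<le> 1" and "0 < a" "a \<le> 1"
  shows "(\<Sum>m\<le>n. psi k ((\<rho> ^ m * s) powr a)) \<le> 1 / ((1 - \<rho>) * a) * (theta ^ k * s powr (a / lmax ^ k))"
  using assms(3-)
proof (induction k arbitrary: a)
  case 0
  define q where "q = \<rho> powr a"
  have q: "0 < q" "q < 1" using \<rho> 0 powr_less_mono2[of a \<rho> 1] by (auto simp: q_def)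
  \<comment> \<open>Weighted arithmetic-geometric mean:
    \<open>\<rho> powr a \<le> 1 - a * (1 - \<rho>)\<close>, so the geometric series with ratio
    \<open>\<rho> powr a\<close> sums to at most \<open>1 / ((1 - \<rho>) * a)\<close>.\<close>
  have "\<rho> powr a * 1 powr (1 - a) \<le> a * \<rho> + (1 - a) * 1"
    using 0 \<rho> by (intro Youngs_inequality_0) auto
  then have "a * (1 - \<rho>) \<le> 1 - q" by (simp add: q_def algebra_simps)
  then have inv: "1 / (1 - q) \<le> 1 / ((1 - \<rho>) * a)"
    using q \<rho> 0 by (intro divide_left_mono) (auto simp: mult.commute)
  have "(\<Sum>m\<le>n. psi 0 ((\<rho> ^ m * s) powr a)) = (\<Sum>m\<le>n. q ^ m) * s powr a"
    unfolding sum_distrib_right using \<rho> 0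
    by (intro sum.cong refl) (simp add: powr_mult q_def powr_power powr_realpow[symmetric] powr_powr mult.commute)
  also have "(\<Sum>m\<le>n. q ^ m) \<le> 1 / (1 - q)"
  proof -
    have "(\<Sum>m\<le>n. q ^ m) = (1 - q ^ Suc n) / (1 - q)" using q by (simp add: sum_gp_basic[symmetric] field_simps sum_gp0)
    also have "\<dots> \<le> 1 / (1 - q)" using q by (intro divide_right_mono) auto
    finally show ?thesis .
  qed
  then have "(\<Sum>m\<le>n. q ^ m) * s powr a \<le> 1 / ((1 - \<rho>) * a) * s powr a"
    using inv by (intro mult_right_mono) auto
  finally show ?case by simp
next
  case (Suc k)
  have "(\<Sum>m\<le>n. psi (Suc k) ((\<rho> ^ m * s) powr a)) = (\<Sum>b\<in>SigmaB. p b * (\<Sum>m\<le>n. psi k ((\<rho> ^ m * s) powr (a / l b))))"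
    unfolding psi.simps by (subst sum.swap) (simp add: sum_distrib_left powr_powr)
  also have "\<dots> \<le> (\<Sum>b\<in>SigmaB. (p b * l b) * (1 / ((1 - \<rho>) * a) * (theta ^ k * s powr (a / lmax ^ Suc k))))"
  proof (rule sum_mono)
    fix b assume b: "b \<in> SigmaB"
    have lb: "1 < l b" by (rule l_gt1[OF b])
    have al: "0 < a / l b" "a / l b \<le> 1" using Suc.prems lb by (auto simp: divide_le_eq)
    \<comment> \<open>The induction hypothesis is used for the exponent \<open>a / l b\<close>; its
      reciprocal releases the factor \<open>l b\<close> that joins \<open>p b\<close>.\<close>
    have "(\<Sum>m\<le>n. psi k ((\<rho> ^ m * s) powr (a / l b))) \<le> 1 / ((1 - \<rho>) * (a / l b)) * (theta ^ k * s powr (a / l b / lmax ^ k))"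
      using Suc.prems al by (intro Suc.IH) auto
    also have "\<dots> \<le> 1 / ((1 - \<rho>) * (a / l b)) * (theta ^ k * s powr (a / lmax ^ Suc k))"
      using theta_pos \<rho> lb Suc.prems exponent_le[OF b Suc.prems(1,2), of a k]
      by (intro mult_left_mono divide_nonneg_nonneg mult_nonneg_nonneg) auto
    also have "\<dots> = l b * (1 / ((1 - \<rho>) * a) * (theta ^ k * s powr (a / lmax ^ Suc k)))" using lb by simp
    finally have "p b * (\<Sum>m\<le>n. psi k ((\<rho> ^ m * s) powr (a / l b))) \<le> p b * (l b * (1 / ((1 - \<rho>) * a) * (theta ^ k * s powr (a / lmax ^ Suc k))))"
      using pB[OF b] by (intro mult_left_mono) auto
    then show "p b * (\<Sum>m\<le>n. psi k ((\<rho> ^ m * s) powr (a / l b))) \<le> (p b * l b) * (1 / ((1 - \<rho>) * a) * (theta ^ k * s powr (a / lmax ^ Suc k)))"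
      by (simp add: mult.assoc)
  qed
  also have "\<dots> = theta * (1 / ((1 - \<rho>) * a) * (theta ^ k * s powr (a / lmax ^ Suc k)))"
    unfolding theta_def by (rule sum_distrib_right[symmetric])
  finally show ?case by (simp add: mult_ac)
qed

subsection \<open>Mass near the critical point\<close>

text \<open>Half of the smaller gap, so that the zone of this radius around \<open>c\<close> is
  disjoint from end zones of width at most \<open>rad\<close>.\<close>

definition "rad = min c (1 - c) / 2"
definition "ctr = {x \<in> U. \<bar>x - c\<bar> < rad}"

lemma rad: "0 < rad" "2 * rad \<le> c" "2 * rad \<le> 1 - c" "rad \<le> 1/4" using c01 by (auto simp: rad_def min_def)

lemma ctr_borel[measurable]: "ctr \<in> sets borel" unfolding ctr_def by measurable

lemma J_sum: "(\<Sum>j\<in>J. f j) = (\<Sum>g\<in>SigmaG. f g) + (\<Sum>b\<in>SigmaB. f b)" for f :: "nat \<Rightarrow> 'x::comm_monoid_add"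
  unfolding GB_J[symmetric] using GB_disj fin_GB by (intro sum.union_disjoint) auto

text \<open>Mass near \<open>c\<close> has three sources. Through a good map
  \<open>good_middle\<close> bounds it; through a bad map from outside \<open>ctr\<close> both the
  density and the inverse of the derivative are bounded; through a bad map from inside
  \<open>ctr\<close> it is kept as the recursive term.\<close>

lemma center_step:
  obtains D where "0 \<le> D" "\<And>n A. A \<in> sets borel \<Longrightarrow> A \<subseteq> ctr \<Longrightarrow>
     F (Suc n) A \<le> ennreal (D * measure lborel A) + (\<Sum>b\<in>SigmaB. ennreal (p b) * F n (pre b A \<inter> ctr))"
proof -
  \<comment> \<open>A point closer than \<open>rad / deriv_bound\<close> to an endpoint has its
    image within \<open>rad\<close> of {0,1}, hence outside \<open>ctr\<close>. So the sources
    outside \<open>ctr\<close> avoid the endpoints and \<open>fn_middle\<close> applies.\<close>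
  define e where "e = min (rad / 2) (rad / deriv_bound)"
  have e: "0 < e" "e \<le> min c (1 - c) / 4" "e \<le> rad / deriv_bound" "e \<le> rad"
  proof -
    have "e \<le> rad / 2" "e \<le> rad / deriv_bound" unfolding e_def by (rule min.cobounded1, rule min.cobounded2)
    moreover have "rad / 2 = min c (1 - c) / 4" by (simp add: rad_def)
    ultimately show "e \<le> min c (1 - c) / 4" "e \<le> rad / deriv_bound" "e \<le> rad" using rad(1) by auto
    show "0 < e" using rad(1) deriv_bound(1) by (simp add: e_def)
  qed
  obtain C0 where C0: "0 \<le> C0" "\<And>n i x. x \<in> pc i \<Longrightarrow> e \<le> \<bar>x - c\<bar> \<Longrightarrow> e \<le> \<bar>x - outer i\<bar> \<Longrightarrow> fn n x \<le> ennreal C0"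
    by (rule fn_middle[OF e(1,2)]) blast
  obtain C1 where C1: "0 \<le> C1" "\<And>n g A. g \<in> SigmaG \<Longrightarrow> A \<in> sets borel \<Longrightarrow> A \<subseteq> {rad..1-rad} \<Longrightarrow> F n (pre g A) \<le> ennreal C1 * emeasure lborel A"
    by (rule good_middle[of rad]) (use rad in auto)
  define k where "k b = fst (KM b) * rad powr (ee b - 1)" for b
  have k: "0 < k b" if "b \<in> J" for b using KM(1)[OF that] rad by (simp add: k_def)
  define D where "D = (\<Sum>g\<in>SigmaG. p g * C1) + (\<Sum>b\<in>SigmaB. p b * (C0 * (2 / k b)))"
  show thesis
  proof (rule that[of D])
    show "0 \<le> D" unfolding D_def using C0(1) C1(1) pG pB k B_J
      by (intro add_nonneg_nonneg sum_nonneg mult_nonneg_nonneg) (auto intro: less_imp_le)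
    fix n A assume A: "A \<in> sets borel" "A \<subseteq> ctr"
    define a where "a = measure lborel A"
    have AU: "A \<subseteq> U" using A by (auto simp: ctr_def)
    have a: "emeasure lborel A = ennreal a" "0 \<le> a" using emeasure_U[OF AU] by (auto simp: a_def)
    have g: "F n (pre g A) \<le> ennreal (C1 * a)" if "g \<in> SigmaG" for g
    proof -
      have "ctr \<subseteq> {rad..1-rad}" using rad by (auto simp: ctr_def)
      then have "A \<subseteq> {rad..1-rad}" using A(2) by (rule order_trans[rotated])
      then show ?thesis using C1(2)[OF that A(1)] C1(1) a by (simp add: ennreal_mult)
    qed
    have b: "F n (pre b A) \<le> F n (pre b A \<inter> ctr) + ennreal (C0 * (2 / k b) * a)" if b: "b \<in> SigmaB" for b
    proof -
      note bJ = B_J[OF b]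
      define S where "S i = pre b A \<inter> {x \<in> pc i. rad \<le> \<bar>x - c\<bar>}" for i
      have pb[measurable]: "pre b A \<in> sets borel" by (rule pre_borel[OF bJ A(1)])
      have S[measurable]: "S i \<in> sets borel" for i unfolding S_def by measurable
      have eq: "pre b A = (pre b A \<inter> ctr) \<union> (S True \<union> S False)"
      proof (intro equalityI subsetI)
        fix x assume x: "x \<in> pre b A"
        then have "x \<in> U" using pre_U by auto
        then obtain i where "x \<in> pc i" by (rule U_cases)
        then show "x \<in> (pre b A \<inter> ctr) \<union> (S True \<union> S False)"
          using x \<open>x \<in> U\<close> by (cases i) (auto simp: S_def ctr_def not_less)
      qed (auto simp: S_def)
      have "F n (pre b A) \<le> F n (pre b A \<inter> ctr) + F n (S True \<union> S False)"
        by (subst eq, rule F_Un) measurable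
      also have "F n (S True \<union> S False) \<le> ennreal C0 * emeasure lborel (S True \<union> S False)"
      proof (rule F_le)
        fix x assume "x \<in> S True \<union> S False"
        then obtain i where x: "x \<in> pc i" "rad \<le> \<bar>x - c\<bar>" "T b x \<in> A" by (auto simp: S_def pre_def)
        have "T b (outer i) \<in> {0, 1}" by (rule T_outer[OF bJ])
        then have "rad \<le> \<bar>T b x - T b (outer i)\<bar>" using x(3) A(2) rad by (auto simp: ctr_def)
        also have "\<dots> \<le> snd (KM b) * \<bar>x - outer i\<bar>" by (rule branch.Tz_upper[OF branch_inst[OF bJ] x(1)])
        also have "\<dots> \<le> deriv_bound * \<bar>x - outer i\<bar>" using deriv_bound(2)[OF bJ] by (intro mult_right_mono) auto
        finally have "rad / deriv_bound \<le> \<bar>x - outer i\<bar>" using deriv_bound(1) by (simp add: field_simps)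
        then show "fn n x \<le> ennreal C0" using C0(2)[OF x(1)] e x(2) by auto
      qed measurable
      also have "emeasure lborel (S True \<union> S False) = ennreal (measure lborel (S True \<union> S False))"
        using pre_U by (intro emeasure_U) (auto simp: S_def)
      also have "ennreal C0 * ennreal (measure lborel (S True \<union> S False)) \<le> ennreal (C0 * (2 / k b) * a)"
      proof -
        have Sf: "S i \<in> fmeasurable lborel" for i using S pre_U by (intro fmeasurable_U) (auto simp: S_def)
        have "measure lborel (S i) \<le> a / k b" for i
          unfolding S_def a_def
        proof (rule pre_large_derivative[OF bJ A(1) AU _ _ k[OF bJ]])
          fix x assume x: "x \<in> {x \<in> pc i. rad \<le> \<bar>x - c\<bar>}"
          have "k b \<le> fst (KM b) * \<bar>x - c\<bar> powr (ee b - 1)"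
            unfolding k_def using x rad KM(1)[OF bJ] ee_exp[OF bJ] by (intro mult_left_mono powr_mono2) auto
          also have "\<dots> \<le> \<bar>der (T b) x\<bar>" using branch.bounds[OF branch_inst[OF bJ], of x i] x by auto
          finally show "k b \<le> \<bar>der (T b) x\<bar>" .
        qed auto
        from this[of True] this[of False] have "measure lborel (S True \<union> S False) \<le> 2 / k b * a"
          using measure_Un_le[of "S True" lborel "S False"] by simp
        then have "C0 * measure lborel (S True \<union> S False) \<le> C0 * (2 / k b * a)" using C0(1) by (rule mult_left_mono)
        then show ?thesis using C0(1) by (simp add: ennreal_mult[symmetric] ennreal_leI mult.assoc)
      qed
      finally show ?thesis by (simp add: add_left_mono)
    qed
    have "F (Suc n) A = (\<Sum>g\<in>SigmaG. ennreal (p g) * F n (pre g A)) + (\<Sum>b\<in>SigmaB. ennreal (p b) * F n (pre b A))"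
      unfolding F_Suc[OF A(1)] J_sum ..
    also have "\<dots> \<le> (\<Sum>g\<in>SigmaG. ennreal (p g) * ennreal (C1 * a)) + (\<Sum>b\<in>SigmaB. ennreal (p b) * (F n (pre b A \<inter> ctr) + ennreal (C0 * (2 / k b) * a)))"
      using g b by (intro add_mono sum_mono mult_left_mono) auto
    also have "\<dots> = ((\<Sum>g\<in>SigmaG. ennreal (p g * (C1 * a))) + (\<Sum>b\<in>SigmaB. ennreal (p b * (C0 * (2 / k b) * a)))) + (\<Sum>b\<in>SigmaB. ennreal (p b) * F n (pre b A \<inter> ctr))"
    proof -
      have "(\<Sum>g\<in>SigmaG. ennreal (p g * (C1 * a))) = (\<Sum>g\<in>SigmaG. ennreal (p g) * ennreal (C1 * a))"
        using pG by (intro sum.cong refl ennreal_mult') (auto intro: less_imp_le)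
      moreover have "(\<Sum>b\<in>SigmaB. ennreal (p b * (C0 * (2 / k b) * a))) = (\<Sum>b\<in>SigmaB. ennreal (p b) * ennreal (C0 * (2 / k b) * a))"
        using pB by (intro sum.cong refl ennreal_mult') (auto intro: less_imp_le)
      ultimately show ?thesis by (simp only: distrib_left sum.distrib add_ac)
    qed
    also have "(\<Sum>g\<in>SigmaG. ennreal (p g * (C1 * a))) + (\<Sum>b\<in>SigmaB. ennreal (p b * (C0 * (2 / k b) * a))) = ennreal (D * a)"
    proof -
      have 1: "0 \<le> p g * (C1 * a)" if "g \<in> SigmaG" for g using pG[OF that] C1(1) a by simp
      have 2: "0 \<le> p b * (C0 * (2 / k b) * a)" if "b \<in> SigmaB" for b using pB[OF that] C0(1) a k[OF B_J[OF that]] by simp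
      have "(\<Sum>g\<in>SigmaG. ennreal (p g * (C1 * a))) + (\<Sum>b\<in>SigmaB. ennreal (p b * (C0 * (2 / k b) * a))) =
         ennreal ((\<Sum>g\<in>SigmaG. p g * (C1 * a)) + (\<Sum>b\<in>SigmaB. p b * (C0 * (2 / k b) * a)))"
        using 1 2 by (simp add: sum_ennreal ennreal_plus sum_nonneg)
      also have "(\<Sum>g\<in>SigmaG. p g * (C1 * a)) + (\<Sum>b\<in>SigmaB. p b * (C0 * (2 / k b) * a)) = D * a"
        unfolding D_def distrib_right sum_distrib_right by (simp add: mult.assoc)
      finally show ?thesis .
    qed
    finally show "F (Suc n) A \<le> ennreal (D * measure lborel A) + (\<Sum>b\<in>SigmaB. ennreal (p b) * F n (pre b A \<inter> ctr))"
      by (simp add: a_def)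
  qed
qed

text \<open>Dividing by \<open>\<kappa>\<close> absorbs the Hoelder constant: from a preimage
  measure of at most \<open>CB * a powr (1 / l b)\<close> one gets the clean
  \<open>(a / \<kappa>) powr (1 / l b)\<close> as soon as \<open>\<kappa> powr (1 - 1 / l b)\<close>
  is at least \<open>CB\<close>. So constants do not accumulate in the recursion. The free
  \<open>\<kappa>1\<close> allows a larger \<open>\<kappa>\<close> to be requested.\<close>

lemma center_bound:
  obtains C \<kappa> where "1 \<le> C" "\<kappa>1 \<le> \<kappa>" "1 \<le> \<kappa>" "\<And>n A. A \<in> sets borel \<Longrightarrow> A \<subseteq> ctr \<Longrightarrow> F n A \<le> ennreal (C * PS n (measure lborel A / \<kappa>))"
proof -
  obtain D where D: "0 \<le> D" "\<And>n A. A \<in> sets borel \<Longrightarrow> A \<subseteq> ctr \<Longrightarrow>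
     F (Suc n) A \<le> ennreal (D * measure lborel A) + (\<Sum>b\<in>SigmaB. ennreal (p b) * F n (pre b A \<inter> ctr))"
    by (rule center_step) blast
  obtain CB where CB: "1 \<le> CB" "\<And>j A. j \<in> J \<Longrightarrow> A \<in> sets borel \<Longrightarrow> A \<subseteq> U \<Longrightarrow>
    measure lborel (pre j A) \<le> CB * measure lborel A powr (1 / ee j)" by (rule pre_holder) blast
  define \<kappa> where "\<kappa> = \<bar>\<kappa>1\<bar> + 1 + (\<Sum>b\<in>SigmaB. CB powr (1 / (1 - 1 / l b)))"
  have s0: "0 \<le> (\<Sum>b\<in>SigmaB. CB powr (1 / (1 - 1 / l b)))" by (intro sum_nonneg) auto
  then have \<kappa>: "1 \<le> \<kappa>" "\<kappa>1 \<le> \<kappa>" by (auto simp: \<kappa>_def)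
  have \<kappa>b: "CB * \<kappa> powr (1 / l b) \<le> \<kappa>" if b: "b \<in> SigmaB" for b
  proof -
    define q where "q = 1 - 1 / l b"
    have q: "0 < q" using l_gt1[OF b] by (simp add: q_def)
    have "CB powr (1 / q) \<le> (\<Sum>b\<in>SigmaB. CB powr (1 / (1 - 1 / l b)))"
      unfolding q_def using b fin_GB by (intro member_le_sum) auto
    then have "CB powr (1 / q) \<le> \<kappa>" by (simp add: \<kappa>_def)
    then have "(CB powr (1 / q)) powr q \<le> \<kappa> powr q" using q by (intro powr_mono2) auto
    then have "CB \<le> \<kappa> powr q" using q CB(1) by (simp add: powr_powr)
    then have "CB * \<kappa> powr (1 / l b) \<le> \<kappa> powr q * \<kappa> powr (1 / l b)" by (intro mult_right_mono) auto
    also have "\<dots> = \<kappa>" using \<kappa>(1) by (simp add: powr_add[symmetric] q_def)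
    finally show ?thesis .
  qed
  define C where "C = \<kappa> * (1 + D)"
  have C: "1 \<le> C" using mult_mono[of 1 \<kappa> 1 "1 + D"] \<kappa> D(1) by (simp add: C_def)
  have "F n A \<le> ennreal (C * PS n (measure lborel A / \<kappa>))" if "A \<in> sets borel" "A \<subseteq> ctr" for n A
    using that
  proof (induction n arbitrary: A)
    case 0
    define a where "a = measure lborel A"
    have AU: "A \<subseteq> U" using 0 by (auto simp: ctr_def)
    have "F 0 A = ennreal a" using 0 emeasure_U[OF AU] by (simp add: F_def fn_def a_def)
    also have "\<dots> \<le> ennreal (C * (a / \<kappa>))"
      using \<kappa> D(1) by (intro ennreal_leI) (simp add: C_def a_def mult_le_cancel_right1)
    finally show ?case by (simp add: PS_def a_def)
  next
    case (Suc n)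
    note A = Suc.prems
    define a where "a = measure lborel A"
    have a0: "0 \<le> a" by (simp add: a_def)
    have AU: "A \<subseteq> U" using A by (auto simp: ctr_def)
    define s where "s = a / \<kappa>"
    have s: "0 \<le> s" using a0 \<kappa> by (simp add: s_def)
    have one: "F n (pre b A \<inter> ctr) \<le> ennreal (C * PS n (s powr (1 / l b)))" if b: "b \<in> SigmaB" for b
    proof -
      note bJ = B_J[OF b]
      have m: "pre b A \<in> sets borel" by (rule pre_borel[OF bJ A(1)])
      have "measure lborel (pre b A \<inter> ctr) \<le> measure lborel (pre b A)"
        using m pre_U by (intro measure_mono_fmeasurable fmeasurable_U) auto
      also have "\<dots> \<le> CB * a powr (1 / l b)" using CB(2)[OF bJ A(1) AU] by (simp add: ee_B[OF b] a_def)
      finally have "measure lborel (pre b A \<inter> ctr) / \<kappa> \<le> CB * a powr (1 / l b) / \<kappa>"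
        using \<kappa> by (intro divide_right_mono) auto
      also have "\<dots> \<le> s powr (1 / l b)"
      proof -
        have "CB / \<kappa> \<le> 1 / \<kappa> powr (1 / l b)" using \<kappa>b[OF b] \<kappa> by (simp add: divide_simps)
        then have "CB / \<kappa> * a powr (1 / l b) \<le> 1 / \<kappa> powr (1 / l b) * a powr (1 / l b)" by (intro mult_right_mono) auto
        then show ?thesis using a0 \<kappa> by (simp add: s_def powr_divide)
      qed
      finally have "PS n (measure lborel (pre b A \<inter> ctr) / \<kappa>) \<le> PS n (s powr (1 / l b))"
        using \<kappa> by (intro PS_mono) auto
      then have "ennreal (C * PS n (measure lborel (pre b A \<inter> ctr) / \<kappa>)) \<le> ennreal (C * PS n (s powr (1 / l b)))"
        using C by (intro ennreal_leI mult_left_mono) auto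
      moreover have "F n (pre b A \<inter> ctr) \<le> ennreal (C * PS n (measure lborel (pre b A \<inter> ctr) / \<kappa>))"
        using m by (intro Suc.IH) auto
      ultimately show ?thesis by (rule order_trans[rotated])
    qed
    have "F (Suc n) A \<le> ennreal (D * a) + (\<Sum>b\<in>SigmaB. ennreal (p b) * ennreal (C * PS n (s powr (1 / l b))))"
      using D(2)[OF A, of n] one unfolding a_def
      by (elim order_trans) (intro add_left_mono sum_mono mult_left_mono, auto)
    also have "\<dots> = ennreal (D * a + (\<Sum>b\<in>SigmaB. p b * (C * PS n (s powr (1 / l b)))))"
    proof -
      have "0 \<le> p b * (C * PS n (s powr (1 / l b)))" if "b \<in> SigmaB" for b
        using pB[OF that] C PS_nonneg[of "s powr (1 / l b)" n] by simp
      moreover have "ennreal (p b) * ennreal (C * PS n (s powr (1 / l b))) = ennreal (p b * (C * PS n (s powr (1 / l b))))" if "b \<in> SigmaB" for b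
        using pB[OF that] by (simp add: ennreal_mult')
      ultimately show ?thesis using D(1) a0 by (simp add: sum_ennreal ennreal_plus sum_nonneg)
    qed
    also have "\<dots> \<le> ennreal (C * PS (Suc n) s)"
    proof (rule ennreal_leI)
      have "D * a \<le> C * s" using \<kappa> a0 by (simp add: C_def s_def mult_right_mono)
      then show "D * a + (\<Sum>b\<in>SigmaB. p b * (C * PS n (s powr (1 / l b)))) \<le> C * PS (Suc n) s"
        unfolding PS_Suc distrib_left sum_distrib_left by (simp add: mult_ac)
    qed
    finally show ?case by (simp add: s_def a_def)
  qed
  then show thesis by (rule that[OF C \<kappa>(2,1)])
qed

subsection \<open>Mass near the endpoints\<close>

definition "endr d = {x \<in> U. x < d \<or> 1 - d < x}"

lemma endr_borel[measurable]: "endr d \<in> sets borel" unfolding endr_def by measurable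

lemma outer_ends: "x \<in> pc i \<Longrightarrow> d \<le> rad \<Longrightarrow> x \<in> endr d \<longleftrightarrow> \<bar>x - outer i\<bar> < d"
  using rad pc_U[of i] c01 by (cases i) (auto simp: endr_def lo_def hi_def outer_def)

text \<open>Minima over the finitely many branches. Their purpose is a trap: mass can enter the end
  zone only from the end zone itself, or from near \<open>c\<close> through a good map.\<close>

lemma end_constants:
  obtains d \<rho> where "0 < d" "d \<le> rad" "deriv_bound * d \<le> rad" "0 < \<rho>" "\<rho> < 1"
    "\<And>j i x. j \<in> J \<Longrightarrow> x \<in> pc i \<Longrightarrow> \<bar>x - outer i\<bar> < d \<Longrightarrow> 1 / \<rho> \<le> \<bar>der (T j) x\<bar>"
    "\<And>j i x. j \<in> J \<Longrightarrow> x \<in> pc i \<Longrightarrow> d \<le> \<bar>x - outer i\<bar> \<Longrightarrow> d \<le> \<bar>T j x - T j (outer i)\<bar>"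
    "\<And>g i x. g \<in> SigmaG \<Longrightarrow> x \<in> pc i \<Longrightarrow> rad \<le> \<bar>x - c\<bar> \<Longrightarrow> d \<le> \<bar>T g x - branch.\<tau> c (outer i) (lo i) (hi i) (T g)\<bar>"
proof -
  define Q where "Q j i \<delta> \<rho> \<longleftrightarrow> 0 < \<delta> \<and> 0 < \<rho> \<and> \<rho> < 1 \<and> (\<forall>x\<in>pc i. \<bar>x - outer i\<bar> < \<delta> \<longrightarrow> 1 / \<rho> \<le> \<bar>der (T j) x\<bar>) \<and>
     (\<forall>x\<in>pc i. \<forall>d. 0 < d \<and> d < \<delta> \<and> d \<le> \<bar>x - outer i\<bar> \<longrightarrow> d / \<rho> \<le> \<bar>T j x - T j (outer i)\<bar>)"
    for j i and \<delta> \<rho> :: real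
  have "\<exists>\<delta> \<rho>. Q j i \<delta> \<rho>"
    if j: "j \<in> J" for j i
  proof -
    interpret b: branch c "outer i" "lo i" "hi i" "iu j i" "iv j i" "T j" "ee j" "fst (KM j)" "snd (KM j)"
      by (rule branch_inst[OF j])
    obtain \<delta> \<rho> where 1: "0 < \<delta>" "0 < \<rho>" "\<rho> < 1"
       "\<And>x. x \<in> pc i \<Longrightarrow> \<bar>x - outer i\<bar> < \<delta> \<Longrightarrow> 1 / \<rho> \<le> \<bar>der (T j) x\<bar>"
       "\<And>x d. x \<in> pc i \<Longrightarrow> 0 < d \<Longrightarrow> d < \<delta> \<Longrightarrow> d \<le> \<bar>x - outer i\<bar> \<Longrightarrow> d / \<rho> \<le> \<bar>T j x - T j (outer i)\<bar>"
      by (rule b.expanding_end) blast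
    then show ?thesis unfolding Q_def by blast
  qed
  then obtain \<delta> \<rho> where Q: "\<And>j i. j \<in> J \<Longrightarrow> Q j i (\<delta> j i) (\<rho> j i)" by metis
  have dr: "\<And>j i. j \<in> J \<Longrightarrow> 0 < \<delta> j i" "\<And>j i. j \<in> J \<Longrightarrow> 0 < \<rho> j i" "\<And>j i. j \<in> J \<Longrightarrow> \<rho> j i < 1"
     "\<And>j i x. j \<in> J \<Longrightarrow> x \<in> pc i \<Longrightarrow> \<bar>x - outer i\<bar> < \<delta> j i \<Longrightarrow> 1 / \<rho> j i \<le> \<bar>der (T j) x\<bar>"
     "\<And>j i x d. j \<in> J \<Longrightarrow> x \<in> pc i \<Longrightarrow> 0 < d \<Longrightarrow> d < \<delta> j i \<Longrightarrow> d \<le> \<bar>x - outer i\<bar> \<Longrightarrow> d / \<rho> j i \<le> \<bar>T j x - T j (outer i)\<bar>"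
    using Q unfolding Q_def by blast+
  define JB where "JB = J \<times> (UNIV :: bool set)"
  have fJB: "finite JB" by (simp add: JB_def)
  obtain d1 where d1: "0 < d1" "\<And>x. x \<in> JB \<Longrightarrow> d1 \<le> (\<lambda>(j, i). \<delta> j i) x"
    by (rule finite_pos_lower_bound[OF fJB, of "\<lambda>(j, i). \<delta> j i"]) (auto simp: JB_def dr)
  obtain d2 where d2: "0 < d2" "\<And>x. x \<in> JB \<Longrightarrow> d2 \<le> (\<lambda>(j, i). 1 - \<rho> j i) x"
    by (rule finite_pos_lower_bound[OF fJB, of "\<lambda>(j, i). 1 - \<rho> j i"]) (auto simp: JB_def dr)
  obtain d3 where d3: "0 < d3" "\<And>x. x \<in> JB \<Longrightarrow> d3 \<le> (\<lambda>(j, i). fst (KM j) * (rad / 2) powr ee j) x"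
    by (rule finite_pos_lower_bound[OF fJB, of "\<lambda>(j, i). fst (KM j) * (rad / 2) powr ee j"]) (use rad KM in \<open>auto simp: JB_def\<close>)
  define d where "d = min (min (d1 / 2) d3) (min rad (rad / deriv_bound))"
  have d: "0 < d" "d < d1" "d \<le> d3" "d \<le> rad" "d \<le> rad / deriv_bound"
    using d1(1) d3(1) rad deriv_bound(1) by (auto simp: d_def)
  \<comment> \<open>\<open>1 - d2\<close> bounds all the rates from above; the maximum with 1/2
    guarantees positivity.\<close>
  define R where "R = max (1/2) (1 - d2)"
  have R: "0 < R" "R < 1" using d2(1) by (auto simp: R_def)
  have JBm: "(j, i) \<in> JB" if "j \<in> J" for j i using that by (auto simp: JB_def)
  show thesis
  proof (rule that[OF d(1,4) _ R])
    show "deriv_bound * d \<le> rad" using d(5) deriv_bound(1) by (simp add: field_simps)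
  next
    fix j i x assume j: "j \<in> J" and x: "x \<in> pc i" "\<bar>x - outer i\<bar> < d"
    have "\<rho> j i \<le> R" using d2(2)[OF JBm[OF j, of i]] by (auto simp: R_def)
    then have "1 / R \<le> 1 / \<rho> j i" using R dr(2)[OF j, of i] by (intro divide_left_mono) auto
    also have "\<dots> \<le> \<bar>der (T j) x\<bar>" using dr(4)[OF j x(1)] d1(2)[OF JBm[OF j, of i]] x d by auto
    finally show "1 / R \<le> \<bar>der (T j) x\<bar>" .
  next
    fix j i x assume j: "j \<in> J" and x: "x \<in> pc i" "d \<le> \<bar>x - outer i\<bar>"
    have "d \<le> d / \<rho> j i" using dr(2,3)[OF j, of i] d(1) by (simp add: field_simps)
    also have "\<dots> \<le> \<bar>T j x - T j (outer i)\<bar>" using dr(5)[OF j x(1) d(1) _ x(2)] d1(2)[OF JBm[OF j, of i]] d by auto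
    finally show "d \<le> \<bar>T j x - T j (outer i)\<bar>" .
  next
    fix g i x assume g: "g \<in> SigmaG" and x: "x \<in> pc i" "rad \<le> \<bar>x - c\<bar>"
    note gJ = G_J[OF g]
    have "d \<le> fst (KM g) * (rad / 2) powr ee g" using d3(2)[OF JBm[OF gJ, of i]] d(3) by auto
    also have "\<dots> \<le> fst (KM g) * (\<bar>x - c\<bar> / 2) powr ee g"
      using x rad KM(1)[OF gJ] ee_exp[OF gJ] by (intro mult_left_mono powr_mono2) auto
    also have "\<dots> \<le> \<bar>T g x - branch.\<tau> c (outer i) (lo i) (hi i) (T g)\<bar>"
      by (rule branch.tau_lower[OF branch_inst[OF gJ] x(1)])
    finally show "d \<le> \<bar>T g x - branch.\<tau> c (outer i) (lo i) (hi i) (T g)\<bar>" .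
  qed
qed

text \<open>Near \<open>c\<close> the bound is \<open>center_bound\<close>, and away from
  \<open>c\<close> and the ends the density is bounded. Near the ends the mass at time
  \<open>n + 1\<close> comes from a contracted set near the ends or, through a good map, from near
  \<open>c\<close>; unrolling this gives a sum of \<open>PS\<close> along a geometric sequence,
  which \<open>psi_geometric\<close> evaluates.\<close>

theorem mass_bound:
  obtains C where "0 \<le> C" "\<And>n A. A \<in> sets borel \<Longrightarrow> A \<subseteq> U \<Longrightarrow>
    F n A \<le> ennreal (C * (\<Sum>k\<le>n. theta ^ k * measure lborel A powr (1 / rmax / lmax ^ k)))"
proof -
  obtain d \<rho> where d: "0 < d" "d \<le> rad" "deriv_bound * d \<le> rad" and \<rho>: "0 < \<rho>" "\<rho> < 1"
    and exp: "\<And>j i x. j \<in> J \<Longrightarrow> x \<in> pc i \<Longrightarrow> \<bar>x - outer i\<bar> < d \<Longrightarrow> 1 / \<rho> \<le> \<bar>der (T j) x\<bar>"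
    and far: "\<And>j i x. j \<in> J \<Longrightarrow> x \<in> pc i \<Longrightarrow> d \<le> \<bar>x - outer i\<bar> \<Longrightarrow> d \<le> \<bar>T j x - T j (outer i)\<bar>"
    and tau: "\<And>g i x. g \<in> SigmaG \<Longrightarrow> x \<in> pc i \<Longrightarrow> rad \<le> \<bar>x - c\<bar> \<Longrightarrow> d \<le> \<bar>T g x - branch.\<tau> c (outer i) (lo i) (hi i) (T g)\<bar>"
    by (rule end_constants) blast
  obtain CB where CB: "1 \<le> CB" "\<And>j A. j \<in> J \<Longrightarrow> A \<in> sets borel \<Longrightarrow> A \<subseteq> U \<Longrightarrow>
    measure lborel (pre j A) \<le> CB * measure lborel A powr (1 / ee j)" by (rule pre_holder) blast
  obtain Cc \<kappa> where Cc: "1 \<le> Cc" "2 * CB \<le> \<kappa>" "1 \<le> \<kappa>"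
    "\<And>n A. A \<in> sets borel \<Longrightarrow> A \<subseteq> ctr \<Longrightarrow> F n A \<le> ennreal (Cc * PS n (measure lborel A / \<kappa>))"
    by (rule center_bound[of "2 * CB"]) blast
  define a where "a = 1 / rmax"
  have a: "0 < a" "a \<le> 1" using rmax_ge1 by (auto simp: a_def)
  define E where "E = endr d"
  have EU: "E \<subseteq> U" by (auto simp: E_def endr_def)
  have Em[measurable]: "E \<in> sets borel" by (simp add: E_def)
  have E_end: "\<exists>y\<in>{0,1}. \<bar>x - y\<bar> < d" if "x \<in> E" for x using that by (auto simp: E_def endr_def U_alt)
  have in_end: "x \<in> E \<longleftrightarrow> \<bar>x - outer i\<bar> < d" if "x \<in> pc i" for x i
    unfolding E_def by (rule outer_ends[OF that d(2)])
  \<comment> \<open>Away from its own endpoint, a point can come close to {0,1} only by approaching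
    \<open>\<tau>\<close>. For a good map this requires being near \<open>c\<close>, and for a bad
    map \<open>\<tau>\<close> is \<open>c\<close> itself.\<close>
  have cases_pre: "x \<in> E \<or> (j \<in> SigmaG \<and> x \<in> ctr)" if j: "j \<in> J" and x: "x \<in> U" and Tx: "T j x \<in> E" for j x
  proof (rule ccontr)
    assume no: "\<not> ?thesis"
    obtain i where i: "x \<in> pc i" using x by (rule U_cases)
    have 1: "d \<le> \<bar>T j x - T j (outer i)\<bar>" using far[OF j i] in_end[OF i] no by auto
    have ends: "{T j (outer i), branch.\<tau> c (outer i) (lo i) (hi i) (T j)} = {iu j i, iv j i}"
      by (rule branch.ends[OF branch_inst[OF j]])
    obtain y where y: "y \<in> {0,1}" "\<bar>T j x - y\<bar> < d" using E_end[OF Tx] by blast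
    consider "j \<in> SigmaG" | "j \<in> SigmaB" using GB_J j by blast
    then show False
    proof cases
      case 1
      then have "x \<notin> ctr" using no by auto
      then have "d \<le> \<bar>T j x - branch.\<tau> c (outer i) (lo i) (hi i) (T j)\<bar>" using tau[OF 1 i] x by (auto simp: ctr_def)
      moreover have "y \<in> {T j (outer i), branch.\<tau> c (outer i) (lo i) (hi i) (T j)}"
        unfolding ends using y(1) iuv_G[OF 1, of i] by auto
      ultimately show False using y(2) \<open>d \<le> \<bar>T j x - T j (outer i)\<bar>\<close> by auto
    next
      case 2
      have "T j x \<in> Z j i" by (rule branch.T_in[OF branch_inst[OF j] i])
      moreover have "T j (outer i) \<in> {0, 1}" by (rule T_outer[OF j])
      moreover have "T j (outer i) \<in> {iu j i, iv j i}" using ends by blast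
      ultimately have "y = T j (outer i)" using y iuv_B[OF 2, of i] rad d c01 by auto
      then show False using y(2) \<open>d \<le> \<bar>T j x - T j (outer i)\<bar>\<close> by auto
    qed
  qed
  \<comment> \<open>The measure is tracked on each end separately. Both ends may be mapped to the
    same endpoint, so the total measure of the preimage can double, but the share of each end
    shrinks by \<open>\<rho>\<close>.\<close>
  have contract: "measure lborel (pre j A \<inter> E \<inter> pc i) \<le> \<rho> * s"
    if j: "j \<in> J" and A: "A \<in> sets borel" "A \<subseteq> E" and s: "\<And>i. measure lborel (A \<inter> pc i) \<le> s" for j A i s
  proof -
    define i' where "i' = (T j (outer i) = 0)"
    have AU: "A \<inter> pc i' \<subseteq> U" using A(2) EU by auto
    have "pre j A \<inter> E \<inter> pc i \<subseteq> pre j (A \<inter> pc i') \<inter> (E \<inter> pc i)"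
    proof
      fix x assume x: "x \<in> pre j A \<inter> E \<inter> pc i"
      then have xi: "x \<in> pc i" "\<bar>x - outer i\<bar> < d" using in_end by auto
      have "\<bar>T j x - T j (outer i)\<bar> \<le> snd (KM j) * \<bar>x - outer i\<bar>" by (rule branch.Tz_upper[OF branch_inst[OF j] xi(1)])
      also have "\<dots> \<le> deriv_bound * d" using deriv_bound(1) deriv_bound(2)[OF j] xi(2) by (intro mult_mono) auto
      also have "\<dots> \<le> rad" by (rule d(3))
      finally have "T j x \<in> pc i'"
        using T_outer[OF j, of i] T_U[OF j, of x] x rad EU c01 by (auto simp: i'_def lo_def hi_def)
      then show "x \<in> pre j (A \<inter> pc i') \<inter> (E \<inter> pc i)" using x by (auto simp: pre_def)
    qed
    moreover have m: "pre j (A \<inter> pc i') \<in> sets borel" "pre j A \<in> sets borel" using A(1) by (auto intro!: pre_borel[OF j])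
    ultimately have "measure lborel (pre j A \<inter> E \<inter> pc i) \<le> measure lborel (pre j (A \<inter> pc i') \<inter> (E \<inter> pc i))"
      using EU by (intro measure_mono_fmeasurable fmeasurable_U) auto
    also have "\<dots> \<le> measure lborel (A \<inter> pc i') / (1 / \<rho>)"
    proof (rule pre_large_derivative[OF j _ AU])
      show "1 / \<rho> \<le> \<bar>der (T j) x\<bar>" if "x \<in> E \<inter> pc i" for x using exp[OF j, of x i] in_end that by auto
    qed (use A(1) \<rho> in auto)
    also have "\<dots> \<le> \<rho> * s" using s[of i'] \<rho> by (simp add: mult.commute mult_left_mono)
    finally show ?thesis .
  qed
  \<comment> \<open>Here \<open>m\<close> counts the steps back along the endpoint until the passage
    through a good map, which costs the exponent \<open>a\<close>.\<close>
  define QS where "QS n s = (\<Sum>m\<le>n. PS n ((\<rho> ^ m * s) powr a))" for n s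
  define C where "C = 2 * Cc"
  have C: "2 \<le> C" using Cc(1) by (simp add: C_def)
  have two: "measure lborel A \<le> 2 * s" if A: "A \<in> sets borel" "A \<subseteq> U" and s: "\<And>i. measure lborel (A \<inter> pc i) \<le> s" for A s
  proof -
    have "A = (A \<inter> pc True) \<union> (A \<inter> pc False)" using A(2) by (auto simp: U_def)
    then have "measure lborel A \<le> measure lborel (A \<inter> pc True) + measure lborel (A \<inter> pc False)"
      using A by (metis measure_Un_le sets.Int sets_lborel borel_open open_greaterThanLessThan)
    then show ?thesis using s[of True] s[of False] by simp
  qed
  have ends_bound: "F n A \<le> ennreal (C * QS n s)"
    if "A \<in> sets borel" "A \<subseteq> E" "\<And>i. measure lborel (A \<inter> pc i) \<le> s" "s \<le> 1" for n A s
    using that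
  proof (induction n arbitrary: A s)
    case 0
    have AU: "A \<subseteq> U" using 0 EU by auto
    have s0: "0 \<le> s" using 0(3)[of True] by (rule order_trans[rotated]) simp
    have "measure lborel A \<le> 2 * s" by (rule two[OF 0(1) AU 0(3)])
    also have "s \<le> s powr a" using powr_mono'[of a 1 s] a s0 0 by simp
    also have "2 * s powr a \<le> C * s powr a" using C by (intro mult_right_mono) auto
    finally have "measure lborel A \<le> C * s powr a" by simp
    moreover have "F 0 A = ennreal (measure lborel A)" using 0 emeasure_U[OF AU] by (simp add: F_def fn_def)
    ultimately show ?case by (simp add: QS_def PS_def ennreal_leI)
  next
    case (Suc n)
    note A = Suc.prems
    have AU: "A \<subseteq> U" using A EU by auto
    have s0: "0 \<le> s" using A(3)[of True] by (rule order_trans[rotated]) simp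
    have each: "F n (pre j A) \<le> ennreal (C * (QS n (\<rho> * s) + PS n (s powr a)))" if j: "j \<in> J" for j
    proof -
      have m[measurable]: "pre j A \<in> sets borel" by (rule pre_borel[OF j A(1)])
      have QS0: "0 \<le> QS n (\<rho> * s)" "0 \<le> PS n (s powr a)" unfolding QS_def by (auto intro!: sum_nonneg PS_nonneg)
      have "F n (pre j A \<inter> E) \<le> ennreal (C * QS n (\<rho> * s))"
        using contract[OF j A(1,2,3)] \<rho> A(4) s0
        by (intro Suc.IH) (auto intro: mult_le_one)
      moreover have "F n (pre j A - E) \<le> ennreal (C * PS n (s powr a))"
      proof (cases "j \<in> SigmaG")
        case True
        have sub: "pre j A - E \<subseteq> ctr" using cases_pre[OF j] A(2) by (auto simp: pre_def)
        have "measure lborel (pre j A - E) \<le> measure lborel (pre j A)"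
          using pre_U by (intro measure_mono_fmeasurable fmeasurable_U) auto
        also have "\<dots> \<le> CB * measure lborel A powr (1 / r j)" using CB(2)[OF j A(1) AU] by (simp add: ee_G[OF True])
        \<comment> \<open>\<open>A\<close> may have measure \<open>s\<close> on each end, hence
          \<open>2 * s\<close> in total; this is why \<open>2 * CB \<le> \<kappa>\<close> was
          requested.\<close>
        also have "\<dots> \<le> CB * (2 * s powr (1 / rmax))"
          using two[OF A(1) AU A(3)] A(4) s0 r_ge1[OF True] r_le[OF True] CB(1)
          by (intro mult_left_mono powr_twice_le) auto
        also have "\<dots> \<le> \<kappa> * s powr a" using mult_right_mono[OF Cc(2), of "s powr a"] by (simp add: a_def)
        finally have "measure lborel (pre j A - E) / \<kappa> \<le> s powr a" using Cc(3) by (simp add: field_simps)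
        then have "PS n (measure lborel (pre j A - E) / \<kappa>) \<le> PS n (s powr a)" using Cc(3) by (intro PS_mono) auto
        then have "Cc * PS n (measure lborel (pre j A - E) / \<kappa>) \<le> C * PS n (s powr a)"
          using Cc(1,3) QS0 unfolding C_def by (intro mult_mono PS_nonneg) auto
        moreover have "F n (pre j A - E) \<le> ennreal (Cc * PS n (measure lborel (pre j A - E) / \<kappa>))"
          by (rule Cc(4)[OF _ sub]) measurable
        ultimately show ?thesis using ennreal_leI order_trans by blast
      next
        case False
        then have 0: "pre j A - E = {}" using cases_pre[OF j] A(2) by (auto simp: pre_def)
        have "F n {} = 0" by (simp add: F_def)
        then show ?thesis unfolding 0 by simp
      qed
      moreover have "F n (pre j A) \<le> F n (pre j A \<inter> E) + F n (pre j A - E)"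
        using F_Un[of "pre j A \<inter> E" "pre j A - E" n] by (simp add: Int_Diff_Un)
      ultimately have "F n (pre j A) \<le> ennreal (C * QS n (\<rho> * s)) + ennreal (C * PS n (s powr a))"
        by (meson add_mono order_trans)
      then show ?thesis using C QS0 by (simp add: ennreal_plus[symmetric] distrib_left del: ennreal_plus)
    qed
    have "F (Suc n) A = (\<Sum>j\<in>J. ennreal (p j) * F n (pre j A))" by (rule F_Suc[OF A(1)])
    also have "\<dots> \<le> (\<Sum>j\<in>J. ennreal (p j) * ennreal (C * (QS n (\<rho> * s) + PS n (s powr a))))"
      using each by (intro sum_mono mult_left_mono) auto
    also have "\<dots> = ennreal (C * (QS n (\<rho> * s) + PS n (s powr a)))"
      unfolding sum_distrib_right[symmetric] p_sum_ennreal by simp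
    also have "\<dots> \<le> ennreal (C * QS (Suc n) s)"
    proof (intro ennreal_leI mult_left_mono)
      have "QS (Suc n) s = PS (Suc n) (s powr a) + (\<Sum>m\<le>n. PS (Suc n) ((\<rho> ^ Suc m * s) powr a))"
        unfolding QS_def by (subst sum.atMost_Suc_shift) simp
      moreover have "PS n (s powr a) \<le> PS (Suc n) (s powr a)" by (rule PS_le_Suc) simp
      moreover have "QS n (\<rho> * s) \<le> (\<Sum>m\<le>n. PS (Suc n) ((\<rho> ^ Suc m * s) powr a))"
        unfolding QS_def by (intro sum_mono) (simp add: PS_le_Suc mult_ac)
      ultimately show "QS n (\<rho> * s) + PS n (s powr a) \<le> QS (Suc n) s" by simp
    qed (use C in simp)
    finally show ?case .
  qed
  \<comment> \<open>Partial sums of the asserted series, a common majorant for all three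
    zones.\<close>
  define H where "H n s = (\<Sum>k\<le>n. theta ^ k * s powr (1 / rmax / lmax ^ k))" for n s
  have H0: "0 \<le> H n s" for n s unfolding H_def using theta_pos by (intro sum_nonneg) auto
  have s_H: "s \<le> H n s" if "0 \<le> s" "s \<le> 1" for n s
  proof -
    have "s = s powr 1" using that by simp
    also have "\<dots> \<le> s powr (1 / rmax)" using that a by (intro powr_mono') (auto simp: a_def)
    also have "\<dots> = theta ^ 0 * s powr (1 / rmax / lmax ^ 0)" by simp
    also have "\<dots> \<le> H n s" unfolding H_def using theta_pos
      by (intro member_le_sum) auto
    finally show ?thesis .
  qed
  have PS_H: "PS n s \<le> H n s" if "0 \<le> s" "s \<le> 1" for n s
    unfolding PS_def H_def
  proof (rule sum_mono)
    fix k
    have "1 / rmax / lmax ^ k \<le> 1 / lmax ^ k" using rmax_ge1 lmax_gt1 by (intro divide_right_mono) auto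
    then have "theta ^ k * s powr (1 / lmax ^ k) \<le> theta ^ k * s powr (1 / rmax / lmax ^ k)"
      using theta_pos that by (intro mult_left_mono powr_mono') auto
    then show "psi k s \<le> theta ^ k * s powr (1 / rmax / lmax ^ k)" using psi_bound[OF that, of k] by simp
  qed
  define B where "B = 1 / ((1 - \<rho>) * a)"
  have B: "0 \<le> B" using \<rho> a by (simp add: B_def)
  have QS_H: "QS n s \<le> B * H n s" if "0 \<le> s" "s \<le> 1" for n s
  proof -
    have "QS n s = (\<Sum>k\<le>n. \<Sum>m\<le>n. psi k ((\<rho> ^ m * s) powr a))" unfolding QS_def PS_def by (rule sum.swap)
    also have "\<dots> \<le> (\<Sum>k\<le>n. B * (theta ^ k * s powr (a / lmax ^ k)))"
      unfolding B_def by (intro sum_mono psi_geometric \<rho> a that)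
    also have "\<dots> = B * H n s" unfolding H_def a_def by (simp add: sum_distrib_left)
    finally show ?thesis .
  qed
  define e where "e = min d (rad / 2)"
  have e: "0 < e" "e \<le> min c (1 - c) / 4" "e \<le> d" "e \<le> rad" 
  proof -
    have 1: "e \<le> d" "e \<le> rad / 2" unfolding e_def by (rule min.cobounded1, rule min.cobounded2)
    moreover have "rad / 2 = min c (1 - c) / 4" by (simp add: rad_def)
    ultimately show "e \<le> min c (1 - c) / 4" "e \<le> d" "e \<le> rad" using rad(1) by auto
    show "0 < e" using rad(1) d(1) by (simp add: e_def)
  qed
  obtain C0 where C0: "0 \<le> C0" "\<And>n i x. x \<in> pc i \<Longrightarrow> e \<le> \<bar>x - c\<bar> \<Longrightarrow> e \<le> \<bar>x - outer i\<bar> \<Longrightarrow> fn n x \<le> ennreal C0"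
    by (rule fn_middle[OF e(1,2)]) blast
  show thesis
  proof (rule that[of "C0 + Cc + C * B"])
    show "0 \<le> C0 + Cc + C * B" using C0(1) Cc(1) C B by simp
    fix n A assume A[measurable]: "A \<in> sets borel" and AU: "A \<subseteq> U"
    define s where "s = measure lborel A"
    have s: "0 \<le> s" "s \<le> 1" using measure_U_le1[OF AU] by (auto simp: s_def)
    have Af: "A \<in> fmeasurable lborel" by (rule fmeasurable_U[OF A AU])
    have sub: "measure lborel A' \<le> s" if "A' \<subseteq> A" "A' \<in> sets borel" for A'
      unfolding s_def using that Af by (intro measure_mono_fmeasurable) auto
    have 1: "F n (A \<inter> ctr) \<le> ennreal (Cc * H n s)"
    proof -
      have "measure lborel (A \<inter> ctr) / \<kappa> \<le> s / 1" using sub[of "A \<inter> ctr"] Cc(3) s by (intro frac_le) auto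
      then have "PS n (measure lborel (A \<inter> ctr) / \<kappa>) \<le> PS n s" using Cc(3) by (intro PS_mono) auto
      also have "\<dots> \<le> H n s" by (rule PS_H[OF s])
      finally have "ennreal (Cc * PS n (measure lborel (A \<inter> ctr) / \<kappa>)) \<le> ennreal (Cc * H n s)"
        using Cc(1) by (intro ennreal_leI mult_left_mono) auto
      moreover have "F n (A \<inter> ctr) \<le> ennreal (Cc * PS n (measure lborel (A \<inter> ctr) / \<kappa>))" by (rule Cc(4)) auto
      ultimately show ?thesis by (rule order_trans[rotated])
    qed
    have 2: "F n (A \<inter> E) \<le> ennreal (C * B * H n s)"
    proof -
      have "F n (A \<inter> E) \<le> ennreal (C * QS n s)" using s by (intro ends_bound) (auto intro!: sub)
      also have "\<dots> \<le> ennreal (C * (B * H n s))" using C QS_H[OF s] by (intro ennreal_leI mult_left_mono) auto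
      finally show ?thesis by (simp add: mult.assoc)
    qed
    have 3: "F n (A - ctr - E) \<le> ennreal (C0 * H n s)"
    proof -
      have "F n (A - ctr - E) \<le> ennreal C0 * emeasure lborel (A - ctr - E)"
      proof (rule F_le)
        fix x assume x: "x \<in> A - ctr - E"
        then have "x \<in> U" using AU by auto
        then obtain i where i: "x \<in> pc i" by (rule U_cases)
        have "rad \<le> \<bar>x - c\<bar>" using x \<open>x \<in> U\<close> by (auto simp: ctr_def)
        moreover have "d \<le> \<bar>x - outer i\<bar>" using in_end[OF i] x by auto
        ultimately show "fn n x \<le> ennreal C0" using e by (intro C0(2)[OF i]) auto
      qed measurable
      also have "emeasure lborel (A - ctr - E) = ennreal (measure lborel (A - ctr - E))"
        using AU by (intro emeasure_U) auto
      also have "ennreal C0 * \<dots> = ennreal (C0 * measure lborel (A - ctr - E))" using C0(1) by (simp add: ennreal_mult)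
      also have "\<dots> \<le> ennreal (C0 * H n s)"
        using order_trans[OF sub[of "A - ctr - E"] s_H[OF s, of n]] C0(1) by (intro ennreal_leI mult_left_mono) auto
      finally show ?thesis .
    qed
    have "F n A \<le> F n ((A \<inter> ctr) \<union> ((A \<inter> E) \<union> (A - ctr - E)))" by (rule F_mono) auto
    also have "\<dots> \<le> F n (A \<inter> ctr) + F n ((A \<inter> E) \<union> (A - ctr - E))" by (rule F_Un) auto
    also have "F n ((A \<inter> E) \<union> (A - ctr - E)) \<le> F n (A \<inter> E) + F n (A - ctr - E)" by (rule F_Un) auto
    finally have "F n A \<le> F n (A \<inter> ctr) + (F n (A \<inter> E) + F n (A - ctr - E))" by (simp add: add_left_mono)
    also have "\<dots> \<le> ennreal (Cc * H n s) + (ennreal (C * B * H n s) + ennreal (C0 * H n s))"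
      by (intro add_mono 1 2 3)
    also have "\<dots> = ennreal ((C0 + Cc + C * B) * H n s)"
      using Cc(1) C B C0(1) H0[of n s] by (simp add: ennreal_plus[symmetric] algebra_simps del: ennreal_plus)
    finally show "F n A \<le> ennreal ((C0 + Cc + C * B) * (\<Sum>k\<le>n. theta ^ k * measure lborel A powr (1 / rmax / lmax ^ k)))"
      by (simp add: H_def s_def)
  qed
qed

subsection \<open>A finite invariant density\<close>

definition "ex k = 1 / rmax / lmax ^ k"
definition mass_series :: "real \<Rightarrow> real" where "mass_series s = (\<Sum>k. theta ^ k * s powr ex k)"

lemma ex_pos: "0 < ex k" using rmax_ge1 lmax_gt1 by (auto simp: ex_def)

lemma mass_series_summable: assumes "theta < 1" "0 \<le> s" "s \<le> 1" shows "summable (\<lambda>k. theta ^ k * s powr ex k)"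
proof (rule summable_comparison_test'[of "\<lambda>k. theta ^ k" 0])
  show "summable (\<lambda>k. theta ^ k)" using assms(1) theta_pos by (intro summable_geometric) auto
  fix k
  have "s powr ex k \<le> 1" using assms ex_pos[of k] by (intro powr_le1) auto
  then show "norm (theta ^ k * s powr ex k) \<le> theta ^ k" using theta_pos by (simp add: mult_left_le)
qed

lemma mass_series_partial: assumes "theta < 1" "0 \<le> s" "s \<le> 1" shows "(\<Sum>k\<le>n. theta ^ k * s powr ex k) \<le> mass_series s"
  unfolding mass_series_def using theta_pos by (intro sum_le_suminf mass_series_summable assms) auto

lemma mass_series_nonneg: assumes "theta < 1" "0 \<le> s" "s \<le> 1" shows "0 \<le> mass_series s"
  unfolding mass_series_def using theta_pos by (intro suminf_nonneg mass_series_summable assms) auto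

text \<open>The tail from \<open>K\<close> on is at most \<open>theta ^ K / (1 - theta)\<close> for
  every \<open>s \<le> 1\<close>, and the terms before \<open>K\<close> add up to at most
  \<open>s powr ex K / (1 - theta)\<close>. Smallness here means that no mass concentrates at
  \<open>0\<close>, \<open>c\<close> or \<open>1\<close>.\<close>

lemma mass_series_small:
  assumes \<theta>: "theta < 1" and \<epsilon>: "0 < \<epsilon>"
  obtains s0 where "0 < s0" "s0 \<le> 1" "\<And>s. 0 \<le> s \<Longrightarrow> s \<le> s0 \<Longrightarrow> mass_series s \<le> \<epsilon>"
proof -
  define \<eta> where "\<eta> = \<epsilon> * (1 - theta) / 2"
  have \<eta>: "0 < \<eta>" using assms by (simp add: \<eta>_def)
  obtain K where K: "theta ^ K < \<eta>" using real_arch_pow_inv[OF \<eta> \<theta>] by blast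
  define s0 where "s0 = min 1 (\<eta> powr (1 / ex K))"
  have sg: "summable (\<lambda>k. theta ^ k)" using \<theta> theta_pos by (intro summable_geometric) auto
  show thesis
  proof (rule that[of s0])
    show "0 < s0" "s0 \<le> 1" using \<eta> by (auto simp: s0_def)
    fix s :: real assume s: "0 \<le> s" "s \<le> s0"
    then have s1: "s \<le> 1" by (auto simp: s0_def)
    define q where "q = s powr ex K"
    have "q \<le> (\<eta> powr (1 / ex K)) powr ex K" unfolding q_def using s ex_pos[of K] by (intro powr_mono2) (auto simp: s0_def)
    then have q: "q \<le> \<eta>" "0 \<le> q" using \<eta> ex_pos[of K] by (auto simp: powr_powr q_def)
    have "mass_series s \<le> (\<Sum>k. q * theta ^ k + (if k < K then 0 else theta ^ k))"
      unfolding mass_series_def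
    proof (rule suminf_le[OF _ mass_series_summable[OF \<theta> s(1) s1]])
      show "summable (\<lambda>k. q * theta ^ k + (if k < K then 0 else theta ^ k))"
        using theta_pos by (intro summable_add summable_mult sg summable_comparison_test'[OF sg, of 0]) auto
      fix k
      show "theta ^ k * s powr ex k \<le> q * theta ^ k + (if k < K then 0 else theta ^ k)"
      proof (cases "k < K")
        case True
        have "lmax ^ k \<le> lmax ^ K" using True lmax_gt1 by (intro power_increasing) auto
        then have "ex K \<le> ex k" using lmax_gt1 rmax_ge1 unfolding ex_def by (intro divide_left_mono) auto
        then have "s powr ex k \<le> q" unfolding q_def by (intro powr_mono' s s1)
        then show ?thesis using True theta_pos by (simp add: mult.commute mult_right_mono)
      next
        case False
        have "s powr ex k \<le> 1" using s s1 ex_pos[of k] by (intro powr_le1) auto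
        then have "theta ^ k * s powr ex k \<le> theta ^ k" using theta_pos by (simp add: mult_left_le)
        also have "\<dots> \<le> q * theta ^ k + theta ^ k" using q theta_pos by simp
        finally show ?thesis using False by simp
      qed
    qed
    also have "\<dots> = q * (1 / (1 - theta)) + theta ^ K * (1 / (1 - theta))"
    proof -
      have g: "(\<Sum>k. theta ^ k) = 1 / (1 - theta)" using \<theta> theta_pos by (intro suminf_geometric) auto
      define t where "t k = (if k < K then 0 else theta ^ k)" for k
      have st: "summable t" unfolding t_def using theta_pos by (intro summable_comparison_test'[OF sg, of 0]) auto
      have "suminf t = (\<Sum>k. t (k + K)) + (\<Sum>k<K. t k)" by (rule suminf_split_initial_segment[OF st])
      also have "(\<Sum>k<K. t k) = 0" by (simp add: t_def)
      also have "(\<Sum>k. t (k + K)) = (\<Sum>k. theta ^ K * theta ^ k)" by (simp add: t_def power_add mult.commute)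
      also have "\<dots> = theta ^ K * (1 / (1 - theta))" by (simp only: suminf_mult[OF sg] g)
      finally have "suminf t = theta ^ K * (1 / (1 - theta))" by simp
      moreover have "(\<Sum>k. q * theta ^ k + t k) = (\<Sum>k. q * theta ^ k) + suminf t"
        by (rule suminf_add[symmetric]) (intro summable_mult sg st)+
      moreover have "(\<Sum>k. q * theta ^ k) = q * (1 / (1 - theta))" by (simp only: suminf_mult[OF sg] g)
      ultimately show ?thesis unfolding t_def by simp
    qed
    also have "\<dots> \<le> \<eta> * (1 / (1 - theta)) + \<eta> * (1 / (1 - theta))"
      using q K \<theta> by (intro add_mono mult_right_mono) auto
    also have "\<dots> = \<epsilon>"
    proof -
      have nz: "1 - theta \<noteq> 0" using \<theta> by simp
      have "\<eta> * (1 / (1 - theta)) + \<eta> * (1 / (1 - theta)) = (2 * \<eta>) * (1 / (1 - theta))" by simp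
      also have "2 * \<eta> = \<epsilon> * (1 - theta)" by (simp add: \<eta>_def)
      also have "\<epsilon> * (1 - theta) * (1 / (1 - theta)) = \<epsilon>" using nz by simp
      finally show ?thesis .
    qed
    finally show "mass_series s \<le> \<epsilon>" .
  qed
qed

section \<open>Cesaro means of the iterated densities\<close>

definition avg :: "nat \<Rightarrow> real \<Rightarrow> ennreal" where "avg n y = ennreal (1 / real n) * (\<Sum>i<n. fn i y)"

lemma avg_measurable[measurable]: "avg n \<in> borel_measurable borel" unfolding avg_def[abs_def] by measurable

lemma avg_cone: "cone (lo i) (hi i) (avg n)"
  unfolding avg_def[abs_def] by (rule cone_scale[OF cone_sum[of "{..<n}"]]) (auto intro: fn_cone)

lemma avg_integral: "(\<integral>\<^sup>+x\<in>A. avg n x \<partial>lborel) = ennreal (1 / real n) * (\<Sum>i<n. F i A)" if "A \<in> sets borel"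
proof -
  have "(\<integral>\<^sup>+x\<in>A. avg n x \<partial>lborel) = (\<integral>\<^sup>+x. ennreal (1 / real n) * (\<Sum>i<n. fn i x * indicator A x) \<partial>lborel)"
  proof (rule nn_integral_cong)
    fix x show "avg n x * indicator A x = ennreal (1 / real n) * (\<Sum>i<n. fn i x * indicator A x)"
      by (cases "x \<in> A") (simp_all add: avg_def)
  qed
  also have "\<dots> = ennreal (1 / real n) * (\<Sum>i<n. F i A)"
  proof -
    have m: "(\<lambda>x. fn i x * indicator A x) \<in> borel_measurable lborel" for i using that by measurable
    have "(\<integral>\<^sup>+x. (\<Sum>i<n. fn i x * indicator A x) \<partial>lborel) = (\<Sum>i<n. F i A)"
      unfolding F_def by (rule nn_integral_sum[OF m])
    moreover have "(\<lambda>x. \<Sum>i<n. fn i x * indicator A x) \<in> borel_measurable lborel" by (rule borel_measurable_sum[OF m])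
    ultimately show ?thesis by (simp only: nn_integral_cmult)
  qed
  finally show ?thesis .
qed

lemma inv_n: "0 < n \<Longrightarrow> ennreal (1 / real n) * of_nat n = 1"
  by (simp add: ennreal_of_nat_eq_real_of_nat ennreal_mult'[symmetric])

lemma avg_le:
  assumes A: "A \<in> sets borel" and le: "\<And>i. F i A \<le> k" shows "(\<integral>\<^sup>+x\<in>A. avg n x \<partial>lborel) \<le> k"
proof (cases "n = 0")
  case False
  have "ennreal (1 / real n) * (\<Sum>i<n. F i A) \<le> ennreal (1 / real n) * (of_nat n * k)"
    using sum_bounded_above[of "{..<n}" "\<lambda>i. F i A" k] le by (intro mult_left_mono) auto
  also have "\<dots> = k" using False inv_n[of n] by (simp add: mult.assoc[symmetric])
  finally show ?thesis by (simp add: avg_integral[OF A])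
qed (simp add: avg_def)

lemma avg_U: "0 < n \<Longrightarrow> (\<integral>\<^sup>+x\<in>U. avg n x \<partial>lborel) = 1"
  using inv_n[of n] by (simp add: avg_integral F_U)

text \<open>Applying \<open>P\<close> shifts the summation by one: the term \<open>fn n\<close> is
  gained, and the lost \<open>fn 0\<close> is simply added back, hence an inequality.\<close>

lemma P_avg: "P (avg n) y \<le> avg n y + ennreal (1 / real n) * fn n y"
proof -
  have "P (avg n) y = ennreal (1 / real n) * (\<Sum>i<n. fn (Suc i) y)"
    unfolding avg_def[abs_def] P_cmult by (subst P_sum) (auto simp: fn_Suc)
  also have "(\<Sum>i<n. fn (Suc i) y) \<le> (\<Sum>i<Suc n. fn i y)"
    by (subst sum.lessThan_Suc_shift) simp
  finally show ?thesis by (simp add: avg_def distrib_left mult_left_mono)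
qed

lemma P_SUP:
  assumes inc: "\<And>x. incseq (\<lambda>n. g n x)"
  shows "P (\<lambda>x. SUP n. g n x) y = (SUP n. P (g n) y)"
proof -
  have B: "Bop j i (\<lambda>x. SUP n. g n x) y = (SUP n. Bop j i (g n) y)" for j i
    unfolding Bop_def SUP_mult_right_ennreal ..
  have Binc: "incseq (\<lambda>n. ennreal (p j) * Bop j i (g n) y)" for j i
    unfolding Bop_def using inc by (auto simp: incseq_def intro!: mult_left_mono mult_right_mono)
  have Sinc: "incseq (\<lambda>n. \<Sum>i\<in>UNIV. ennreal (p j) * Bop j i (g n) y)" for j
    using Binc by (auto simp: incseq_def intro!: sum_mono)
  have "P (\<lambda>x. SUP n. g n x) y = (\<Sum>j\<in>J. \<Sum>i\<in>UNIV. SUP n. ennreal (p j) * Bop j i (g n) y)"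
    unfolding P_def B SUP_mult_left_ennreal ..
  also have "\<dots> = (\<Sum>j\<in>J. SUP n. \<Sum>i\<in>UNIV. ennreal (p j) * Bop j i (g n) y)"
    by (intro sum.cong refl ennreal_SUP_sum[symmetric] Binc)
  also have "\<dots> = (SUP n. P (g n) y)"
    unfolding P_def by (intro ennreal_SUP_sum[symmetric] Sinc)
  finally show ?thesis .
qed

text \<open>Distortion turns a lower bound for the mass of a middle interval into a pointwise lower
  bound, which survives the passage to a lower limit.\<close>

lemma mid_estimate:
  assumes e: "0 < e" "2 * e < hi i - lo i" and x: "x \<in> {lo i + e..hi i - e}"
    and m: "ennreal (1 / 4) \<le> (\<integral>\<^sup>+x\<in>{lo i + e..hi i - e}. avg n x \<partial>lborel)"
  shows "ennreal (1 / (4 * ((hi i - lo i) / e)\<^sup>2)) \<le> avg n x"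
proof -
  define D where "D = ((hi i - lo i) / e)\<^sup>2"
  have D: "0 < D" using e lohi[of i] by (simp add: D_def)
  have "ennreal (1/4) \<le> (\<integral>\<^sup>+y. (ennreal D * avg n x) * indicator {0..1::real} y \<partial>lborel)"
    unfolding D_def using cone_ratio[OF avg_cone e(1) _ x] lohi[of i] e
    by (intro order_trans[OF m] nn_integral_mono) (auto split: split_indicator)
  also have "\<dots> = ennreal D * avg n x" by (simp add: nn_integral_cmult_indicator)
  finally have "ennreal (1/4) / ennreal D \<le> (ennreal D * avg n x) / ennreal D" by (rule divide_right_mono_ennreal)
  also have "\<dots> = avg n x" using D by (subst mult.commute, subst mult_divide_eq_ennreal) auto
  finally show ?thesis using D by (simp add: divide_ennreal D_def mult.commute)
qed

text \<open>A lower limit inherits upper bounds on mass by monotone convergence but could vanish.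
  This is excluded by a pointwise lower bound on one middle interval, valid along a suitable
  subsequence; \<open>full_support\<close> then extends positivity to almost every point.\<close>

theorem finite_invariant_density:
  assumes \<theta>: "theta < 1"
  obtains k C where "k \<in> borel_measurable borel" "AE y in lborel. y \<in> {0<..<1} \<longrightarrow> P k y = k y"
    "AE y in lborel. y \<in> {0<..<1} \<longrightarrow> k y \<noteq> 0" "0 \<le> C" "(\<integral>\<^sup>+x\<in>U. k x \<partial>lborel) \<le> 1"
    "\<And>A. A \<in> sets borel \<Longrightarrow> A \<subseteq> U \<Longrightarrow> (\<integral>\<^sup>+x\<in>A. k x \<partial>lborel) \<le> ennreal (C * mass_series (measure lborel A))"
proof -
  obtain C where C: "0 \<le> C" "\<And>n A. A \<in> sets borel \<Longrightarrow> A \<subseteq> U \<Longrightarrow>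
    F n A \<le> ennreal (C * (\<Sum>k\<le>n. theta ^ k * measure lborel A powr (1 / rmax / lmax ^ k)))"
    by (rule mass_bound) blast
  have FH: "F n A \<le> ennreal (C * mass_series (measure lborel A))" if A: "A \<in> sets borel" "A \<subseteq> U" for n A
  proof -
    have "(\<Sum>k\<le>n. theta ^ k * measure lborel A powr (1 / rmax / lmax ^ k)) \<le> mass_series (measure lborel A)"
      using mass_series_partial[OF \<theta> measure_nonneg measure_U_le1[OF A(2)]] by (simp add: ex_def)
    then have "ennreal (C * (\<Sum>k\<le>n. theta ^ k * measure lborel A powr (1 / rmax / lmax ^ k))) \<le> ennreal (C * mass_series (measure lborel A))"
      using C(1) by (intro ennreal_leI mult_left_mono)
    then show ?thesis using C(2)[OF A, of n] by (rule order_trans[rotated])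
  qed
  obtain s0 where s0: "0 < s0" "s0 \<le> 1" "\<And>s. 0 \<le> s \<Longrightarrow> s \<le> s0 \<Longrightarrow> mass_series s \<le> 1 / (2 * (C + 1))"
    by (rule mass_series_small[OF \<theta>, of "1 / (2 * (C + 1))"]) (use C(1) in auto)
  \<comment> \<open>The complement of the two middle intervals has measure at most
    \<open>4 * e \<le> s0\<close>, so it carries at most half of the mass at all times.\<close>
  define e where "e = min (s0 / 4) (rad / 2)"
  have e: "0 < e" "4 * e \<le> s0" "2 * e \<le> rad"
  proof -
    have "e \<le> s0 / 4" "e \<le> rad / 2" unfolding e_def by (rule min.cobounded1, rule min.cobounded2)
    then show "4 * e \<le> s0" "2 * e \<le> rad" by auto
    show "0 < e" using s0 rad by (simp add: e_def)
  qed
  define mid where "mid i = {lo i + e..hi i - e}" for i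
  have len: "2 * e < hi i - lo i" for i using e rad by (cases i) (auto simp: lo_def hi_def)
  have mid_pc: "mid i \<subseteq> pc i" for i using e by (auto simp: mid_def)
  have [measurable]: "mid i \<in> sets borel" for i by (simp add: mid_def)
  define R where "R = U - (mid True \<union> mid False)"
  have R[measurable]: "R \<in> sets borel" by (simp add: R_def)
  have mR: "measure lborel R \<le> s0"
  proof -
    have "R \<subseteq> {0..e} \<union> ({c-e..c+e} \<union> {1-e..1})" by (auto simp: R_def mid_def U_alt lo_def hi_def)
    then have "measure lborel R \<le> measure lborel ({0..e} \<union> ({c-e..c+e} \<union> {1-e..1}))"
      by (intro measure_mono_fmeasurable fmeasurable.Un) (auto intro!: fmeasurableI simp: emeasure_lborel_Icc_eq)
    also have "\<dots> \<le> measure lborel {0..e} + measure lborel ({c-e..c+e} \<union> {1-e..1})" by (rule measure_Un_le) auto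
    also have "\<dots> \<le> measure lborel {0..e} + (measure lborel {c-e..c+e} + measure lborel {1-e..1})"
      by (intro add_left_mono measure_Un_le) auto
    also have "\<dots> = 4 * e" using e by simp
    finally show ?thesis using e by simp
  qed
  have RU: "R \<subseteq> U" by (auto simp: R_def)
  have "F n R \<le> ennreal (1/2)" for n
  proof -
    have "C * mass_series (measure lborel R) \<le> (C + 1) * (1 / (2 * (C + 1)))"
      using C(1) s0(3)[OF measure_nonneg mR] mass_series_nonneg[OF \<theta> measure_nonneg measure_U_le1[OF RU]] by (intro mult_mono) auto
    also have "\<dots> = 1/2" using C(1) by simp
    finally have "ennreal (C * mass_series (measure lborel R)) \<le> ennreal (1/2)" by (rule ennreal_leI)
    then show ?thesis using FH[OF R RU, of n] by (rule order_trans[rotated])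
  qed
  then have avgR: "(\<integral>\<^sup>+x\<in>R. avg n x \<partial>lborel) \<le> ennreal (1/2)" for n by (intro avg_le R)
  \<comment> \<open>At least half of the mass is in the two middle intervals, so one of them has a
    quarter.\<close>
  have large: "\<exists>i. ennreal (1/4) \<le> (\<integral>\<^sup>+x\<in>mid i. avg n x \<partial>lborel)" if n: "0 < n" for n
  proof (rule ccontr)
    assume "\<not> ?thesis"
    then have lt: "(\<integral>\<^sup>+x\<in>mid i. avg n x \<partial>lborel) < ennreal (1/4)" for i by (auto simp: not_le)
    have "1 = (\<integral>\<^sup>+x\<in>U. avg n x \<partial>lborel)" using avg_U[OF n] by simp
    also have "\<dots> \<le> (\<integral>\<^sup>+x. (avg n x * indicator (mid True) x + avg n x * indicator (mid False) x) + avg n x * indicator R x \<partial>lborel)"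
      by (intro nn_integral_mono) (auto simp: R_def split: split_indicator)
    also have "\<dots> = ((\<integral>\<^sup>+x\<in>mid True. avg n x \<partial>lborel) + (\<integral>\<^sup>+x\<in>mid False. avg n x \<partial>lborel)) + (\<integral>\<^sup>+x\<in>R. avg n x \<partial>lborel)"
      by (subst nn_integral_add, measurable, subst nn_integral_add, measurable)
    finally have 1: "1 \<le> (\<integral>\<^sup>+x\<in>mid True. avg n x \<partial>lborel) + (\<integral>\<^sup>+x\<in>mid False. avg n x \<partial>lborel) + (\<integral>\<^sup>+x\<in>R. avg n x \<partial>lborel)" .
    have fin: "\<exists>a\<ge>0. X = ennreal a \<and> a \<le> b" if "X \<le> ennreal b" "0 \<le> b" for X b
      using that by (cases X) (auto simp: top_unique)
    have fin': "\<exists>a\<ge>0. X = ennreal a \<and> a < b" if "X < ennreal b" for X b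
      using that by (cases X) (auto simp: ennreal_less_iff)
    obtain a1 where a1: "(\<integral>\<^sup>+x\<in>mid True. avg n x \<partial>lborel) = ennreal a1" "0 \<le> a1" "a1 < 1/4" using fin'[OF lt] by blast
    obtain a2 where a2: "(\<integral>\<^sup>+x\<in>mid False. avg n x \<partial>lborel) = ennreal a2" "0 \<le> a2" "a2 < 1/4" using fin'[OF lt] by blast
    obtain a3 where a3: "(\<integral>\<^sup>+x\<in>R. avg n x \<partial>lborel) = ennreal a3" "0 \<le> a3" "a3 \<le> 1/2" using fin[OF avgR] by auto
    have "ennreal 1 \<le> ennreal (a1 + a2 + a3)" using 1 a1 a2 a3 by simp
    then have "1 \<le> a1 + a2 + a3" using a1 a2 a3 by (subst (asm) ennreal_le_iff) auto
    then show False using a1 a2 a3 by simp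
  qed
  \<comment> \<open>Which interval is heavy may depend on \<open>n\<close>; the lower limit runs
    over those \<open>n\<close> for which it is one fixed interval.\<close>
  define SS where "SS i = {n. 0 < n \<and> ennreal (1/4) \<le> (\<integral>\<^sup>+x\<in>mid i. avg n x \<partial>lborel)}" for i
  obtain i where i: "infinite (SS i)"
  proof (rule ccontr)
    assume "\<not> thesis"
    then have "finite (SS True \<union> SS False)" using that by blast
    moreover have "{1..} \<subseteq> SS True \<union> SS False" using large by (auto simp: SS_def Suc_le_eq) (metis (full_types))
    ultimately show False using infinite_Ici finite_subset by blast
  qed
  define S where "S = SS i"
  have S_inf: "\<exists>m\<in>S. n \<le> m" for n using i unfolding S_def by (meson infinite_nat_iff_unbounded_le)
  have S_pos: "0 < m" if "m \<in> S" for m using that by (auto simp: S_def SS_def)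
  define g where "g n y = (INF m\<in>{m\<in>S. n \<le> m}. avg m y)" for n y
  define k where "k y = (SUP n. g n y)" for y
  have [measurable]: "g n \<in> borel_measurable borel" for n unfolding g_def[abs_def] by measurable
  have km[measurable]: "k \<in> borel_measurable borel" unfolding k_def[abs_def] by measurable
  have g_inc: "incseq (\<lambda>n. g n y)" for y
    unfolding g_def incseq_def by (auto intro!: INF_superset_mono)
  have g_le: "g n y \<le> avg m y" if "m \<in> S" "n \<le> m" for n m y unfolding g_def using that by (intro INF_lower) auto
  have k_int: "(\<integral>\<^sup>+x\<in>A. k x \<partial>lborel) \<le> b"
    if A[measurable]: "A \<in> sets borel" and b: "\<And>n. F n A \<le> b" for A b
  proof -
    have "(\<integral>\<^sup>+x\<in>A. k x \<partial>lborel) = (\<integral>\<^sup>+x. (SUP n. g n x * indicator A x) \<partial>lborel)"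
      unfolding k_def SUP_mult_right_ennreal ..
    also have "\<dots> = (SUP n. \<integral>\<^sup>+x\<in>A. g n x \<partial>lborel)"
      using g_inc by (intro nn_integral_monotone_convergence_SUP) (auto simp: incseq_def le_fun_def intro!: mult_right_mono)
    also have "\<dots> \<le> b"
    proof (rule SUP_least)
      fix n
      obtain m where m: "m \<in> S" "n \<le> m" using S_inf by blast
      have "(\<integral>\<^sup>+x\<in>A. g n x \<partial>lborel) \<le> (\<integral>\<^sup>+x\<in>A. avg m x \<partial>lborel)"
        using g_le[OF m] by (intro nn_integral_mono mult_right_mono) auto
      also have "\<dots> \<le> b" by (rule avg_le[OF A b])
      finally show "(\<integral>\<^sup>+x\<in>A. g n x \<partial>lborel) \<le> b" .
    qed
    finally show ?thesis .
  qed
  have kU: "(\<integral>\<^sup>+x\<in>U. k x \<partial>lborel) \<le> 1" by (rule k_int) (auto simp: F_U)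
  \<comment> \<open>At a fixed \<open>y\<close> in \<open>U\<close> the values \<open>fn m y\<close>
    are bounded in \<open>m\<close>, so the error term of \<open>P_avg\<close> tends to 0. A lower
    limit yields only an inequality; equality follows below from conservation of mass.\<close>
  have Pk_le: "P k y \<le> k y" if y: "y \<in> U" for y
  proof -
    obtain i' where i': "y \<in> pc i'" using y by (rule U_cases)
    define e' where "e' = Min {\<bar>y - c\<bar>, \<bar>y - outer i'\<bar>, rad / 2}"
    have e': "0 < e'" "e' \<le> \<bar>y - c\<bar>" "e' \<le> \<bar>y - outer i'\<bar>" "e' \<le> rad / 2"
    proof -
      have "outer i' \<notin> pc i'" using c01 by (simp add: outer_def lo_def hi_def)
      then have "y \<noteq> outer i'" "y \<noteq> c" using i' y by (auto simp: U_alt)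
      then show "0 < e'" unfolding e'_def using rad by (subst Min_gr_iff) auto
      show "e' \<le> \<bar>y - c\<bar>" "e' \<le> \<bar>y - outer i'\<bar>" "e' \<le> rad / 2" unfolding e'_def by (rule Min_le; simp)+
    qed
    have "e' \<le> min c (1 - c) / 4" using e'(4) by (simp add: rad_def)
    then obtain C' where C': "0 \<le> C'" "\<And>n i x. x \<in> pc i \<Longrightarrow> e' \<le> \<bar>x - c\<bar> \<Longrightarrow> e' \<le> \<bar>x - outer i\<bar> \<Longrightarrow> fn n x \<le> ennreal C'"
      using fn_middle[OF e'(1)] by metis
    have fy: "fn n y \<le> ennreal C'" for n by (rule C'(2)[OF i' e'(2,3)])
    have "P (g n) y \<le> k y" for n
    proof (rule ennreal_le_epsilon)
      fix \<epsilon> :: real assume \<epsilon>: "0 < \<epsilon>"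
      obtain M0 where M0: "C' / \<epsilon> < real M0" using reals_Archimedean2 by blast
      define M where "M = max n M0"
      have "P (g n) y - ennreal \<epsilon> \<le> g M y"
        unfolding g_def[of M]
      proof (rule INF_greatest)
        fix m assume "m \<in> {m \<in> S. M \<le> m}"
        then have m: "m \<in> S" "M \<le> m" "0 < m" using S_pos by auto
        have "P (g n) y \<le> P (avg m) y" using g_le[OF m(1)] m(2) by (intro P_mono) (auto simp: M_def)
        also have "\<dots> \<le> avg m y + ennreal (1 / real m) * fn m y" by (rule P_avg)
        also have "\<dots> \<le> avg m y + ennreal (1 / real m) * ennreal C'" by (intro add_left_mono mult_left_mono fy) auto
        also have "\<dots> = avg m y + ennreal (C' / real m)" using C'(1) by (simp add: ennreal_mult'[symmetric])
        also have "\<dots> \<le> avg m y + ennreal \<epsilon>"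
        proof (intro add_left_mono ennreal_leI)
          have "C' / \<epsilon> < real m" using M0 m(2) by (auto simp: M_def)
          then show "C' / real m \<le> \<epsilon>" using \<epsilon> m(3) by (simp add: field_simps)
        qed
        finally show "P (g n) y - ennreal \<epsilon> \<le> avg m y" by (simp add: ennreal_minus_le_iff add.commute)
      qed
      also have "g M y \<le> k y" unfolding k_def by (rule SUP_upper) simp
      finally show "P (g n) y \<le> k y + ennreal \<epsilon>" by (simp add: ennreal_minus_le_iff add.commute)
    qed
    then show ?thesis unfolding k_def P_SUP[OF g_inc] by (intro SUP_least) (simp add: k_def)
  qed
  have Pk: "AE y in lborel. y \<in> {0<..<1} \<longrightarrow> P k y = k y"
  proof -
    have "AE y in lborel. P k y * indicator U y = k y * indicator U y"
    proof (rule AE_eq_of_nn_integral_le)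
      have "(\<integral>\<^sup>+y\<in>U. P k y \<partial>lborel) = (\<integral>\<^sup>+y. P k y \<partial>lborel)"
        using AE_U by (intro nn_integral_cong_AE, eventually_elim) (auto simp: U_alt P_outside split: split_indicator)
      then show "(\<integral>\<^sup>+y\<in>U. k y \<partial>lborel) \<le> (\<integral>\<^sup>+y\<in>U. P k y \<partial>lborel)" using P_mass[OF km] by simp
      show "(\<integral>\<^sup>+y\<in>U. k y \<partial>lborel) \<noteq> \<infinity>" using kU by (auto simp: top_unique)
      show "AE y in lborel. P k y * indicator U y \<le> k y * indicator U y"
        using Pk_le by (auto split: split_indicator)
    qed measurable
    with AE_U show ?thesis by eventually_elim auto
  qed
  have "\<not> (AE y in lborel. y \<in> {0<..<1} \<longrightarrow> k y = 0)"
  proof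
    assume 0: "AE y in lborel. y \<in> {0<..<1} \<longrightarrow> k y = 0"
    define D where "D = 1 / (4 * ((hi i - lo i) / e)\<^sup>2)"
    have D: "0 < D" using e lohi[of i] by (auto simp: D_def)
    have "ennreal D \<le> k x" if x: "x \<in> mid i" for x
    proof -
      have "ennreal D \<le> g 0 x" unfolding g_def D_def
        using mid_estimate[OF e(1) len[of i], of x] x by (intro INF_greatest) (auto simp: S_def SS_def mid_def)
      also have "\<dots> \<le> k x" unfolding k_def by (rule SUP_upper) simp
      finally show ?thesis .
    qed
    then have "k x \<noteq> 0" if "x \<in> mid i" for x using that D by fastforce
    with 0 have "AE x in lborel. x \<notin> mid i"
      using mid_pc[of i] lohi[of i] by (auto elim!: eventually_mono)
    then have "emeasure lborel (mid i) = 0" by (subst (asm) AE_iff_measurable[OF _ refl]) auto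
    then show False using len[of i] by (simp add: mid_def)
  qed
  then have "AE y in lborel. y \<in> {0<..<1} \<longrightarrow> k y \<noteq> 0" by (rule full_support[OF km Pk])
  then show thesis using that[OF km Pk _ C(1) kU] k_int FH by blast
qed

subsection \<open>Every absolutely continuous stationary measure is dominated by the finite one\<close>

text \<open>Truncating at a multiple of \<open>k\<close> produces finite mass even if
  \<open>h\<close> has none. If no multiple dominated \<open>h\<close>, then \<open>h\<close> would
  exceed every multiple of \<open>k\<close> almost everywhere, against \<open>h\<close> being finite
  and \<open>k\<close> positive.\<close>

theorem density_dominated:
  assumes k[measurable]: "k \<in> borel_measurable borel" and Pk: "AE y in lborel. y \<in> {0<..<1} \<longrightarrow> P k y = k y"
    and k0: "AE y in lborel. y \<in> {0<..<1} \<longrightarrow> k y \<noteq> 0" and kfin: "(\<integral>\<^sup>+x\<in>U. k x \<partial>lborel) \<noteq> \<infinity>"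
    and h[measurable]: "h \<in> borel_measurable borel" and Ph: "AE y in lborel. y \<in> {0<..<1} \<longrightarrow> P h y = h y"
    and hfin: "AE y in lborel. y \<in> {0<..<1} \<longrightarrow> h y \<noteq> \<infinity>"
  obtains s :: nat where "AE y in lborel. y \<in> {0<..<1} \<longrightarrow> h y \<le> of_nat s * k y"
proof (rule ccontr)
  assume no: "\<not> thesis"
  define H where "H t y = min (h y) (of_nat t * k y)" for t :: nat and y
  have [measurable]: "H t \<in> borel_measurable borel" for t unfolding H_def[abs_def] by measurable
  have Hfin: "(\<integral>\<^sup>+x\<in>U. H t x \<partial>lborel) \<noteq> \<infinity>" for t
  proof -
    have "(\<integral>\<^sup>+x\<in>U. H t x \<partial>lborel) \<le> (\<integral>\<^sup>+x. of_nat t * (k x * indicator U x) \<partial>lborel)"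
      by (intro nn_integral_mono) (auto simp: H_def split: split_indicator)
    also have "\<dots> = of_nat t * (\<integral>\<^sup>+x\<in>U. k x \<partial>lborel)" by (rule nn_integral_cmult) measurable
    also have "\<dots> < \<infinity>" using kfin by (simp add: ennreal_mult_less_top less_top of_nat_less_top)
    finally show ?thesis by simp
  qed
  \<comment> \<open>\<open>P (H t)\<close> is below both \<open>P h = h\<close> and \<open>t\<close>
    times \<open>P k = k\<close>, hence below their minimum; finite mass turns this into
    equality.\<close>
  have PH: "AE y in lborel. y \<in> {0<..<1} \<longrightarrow> P (H t) y = H t y" for t
  proof -
    have "AE y in lborel. P (H t) y * indicator U y = H t y * indicator U y"
    proof (rule AE_eq_of_nn_integral_le)
      have "(\<integral>\<^sup>+y\<in>U. P (H t) y \<partial>lborel) = (\<integral>\<^sup>+y. P (H t) y \<partial>lborel)"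
        using AE_U by (intro nn_integral_cong_AE, eventually_elim) (auto simp: U_alt P_outside split: split_indicator)
      then show "(\<integral>\<^sup>+y\<in>U. H t y \<partial>lborel) \<le> (\<integral>\<^sup>+y\<in>U. P (H t) y \<partial>lborel)" using P_mass[of "H t"] by simp
      show "(\<integral>\<^sup>+y\<in>U. H t y \<partial>lborel) \<noteq> \<infinity>" by (rule Hfin)
      show "AE y in lborel. P (H t) y * indicator U y \<le> H t y * indicator U y"
        using Pk Ph
      proof eventually_elim
        case (elim y)
        have "P (H t) y \<le> P h y" by (rule P_mono) (simp add: H_def)
        moreover have "P (H t) y \<le> P (\<lambda>x. of_nat t * k x) y" by (rule P_mono) (simp add: H_def)
        ultimately show ?case using elim by (auto simp: H_def P_cmult U_alt split: split_indicator)
      qed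
    qed measurable
    with AE_U show ?thesis by eventually_elim auto
  qed
  \<comment> \<open>The difference of two invariant truncations is invariant, so it is positive
    almost everywhere once it is nonzero, and where it is positive \<open>h\<close> exceeds the
    smaller multiple of \<open>k\<close>.\<close>
  have above: "AE y in lborel. y \<in> {0<..<1} \<longrightarrow> of_nat s * k y < h y" for s :: nat
  proof -
    have "\<not> (AE y in lborel. y \<in> {0<..<1} \<longrightarrow> h y \<le> of_nat s * k y)" using that no by blast
    have "\<exists>t\<ge>s. \<not> (AE y in lborel. y \<in> {0<..<1} \<longrightarrow> H t y - H s y = 0)"
    proof (rule ccontr)
      assume "\<not> ?thesis"
      then have "AE y in lborel. \<forall>t. s \<le> t \<longrightarrow> y \<in> {0<..<1} \<longrightarrow> H t y - H s y = 0"
        unfolding AE_all_countable by auto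
      with k0 hfin have "AE y in lborel. y \<in> {0<..<1} \<longrightarrow> h y \<le> of_nat s * k y"
      proof eventually_elim
        case (elim y)
        show ?case
        proof
          assume y: "y \<in> {0<..<1}"
          then obtain t0 where "h y \<le> of_nat t0 * k y" using elim ennreal_archimedean by blast
          also have "of_nat t0 * k y \<le> of_nat (max s t0) * k y" by (intro mult_right_mono) auto
          finally have "H (max s t0) y = h y" by (simp add: H_def)
          moreover have "H (max s t0) y - H s y = 0" using elim y by auto
          moreover have "H s y \<noteq> top" using elim y by (auto simp: H_def min_def top_unique)
          ultimately have "h y \<le> H s y" by (simp add: diff_eq_0_iff_ennreal less_top)
          then show "h y \<le> of_nat s * k y" by (simp add: H_def)
        qed
      qed
      then show False using that no by blast
    qed
    then obtain t where t: "s \<le> t" "\<not> (AE y in lborel. y \<in> {0<..<1} \<longrightarrow> H t y - H s y = 0)" by blast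
    define D where "D y = H t y - H s y" for y
    have Dm[measurable]: "D \<in> borel_measurable borel" unfolding D_def[abs_def] by measurable
    have le: "H s y \<le> H t y" for y
    proof -
      have "of_nat s * k y \<le> of_nat t * k y" using t(1) by (intro mult_right_mono) auto
      then show ?thesis unfolding H_def by (intro min.mono) auto
    qed
    have HD: "H t = (\<lambda>y. H s y + D y)"
      unfolding D_def using diff_add_cancel_ennreal[OF le] by (metis add.commute)
    have PD: "AE y in lborel. y \<in> {0<..<1} \<longrightarrow> P D y = D y"
      using PH[of t] PH[of s] hfin
    proof eventually_elim
      case (elim y)
      show ?case
      proof
        assume y: "y \<in> {0<..<1}"
        have fin: "H s y \<noteq> top" using elim y by (auto simp: H_def min_def top_unique)
        have "P (H t) y = P (H s) y + P D y" unfolding HD by (rule P_add)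
        then have "H t y = H s y + P D y" using elim y by simp
        then have "D y = (H s y + P D y) - H s y" by (simp add: D_def)
        also have "\<dots> = P D y" using fin by simp
        finally show "P D y = D y" by simp
      qed
    qed
    have "AE y in lborel. y \<in> {0<..<1} \<longrightarrow> D y \<noteq> 0" by (rule full_support[OF Dm PD]) (use t(2) in \<open>simp add: D_def\<close>)
    with hfin show ?thesis
    proof eventually_elim
      case (elim y)
      have "\<not> h y \<le> of_nat s * k y" if "D y \<noteq> 0" and y: "y \<in> {0<..<1}"
      proof
        assume a: "h y \<le> of_nat s * k y"
        then have "H s y = h y" by (simp add: H_def)
        then have "D y = H t y - h y" by (simp add: D_def)
        moreover have "H t y \<le> h y" by (simp add: H_def)
        ultimately have "H t y = H s y" using \<open>H s y = h y\<close> le[of y] by auto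
        then show False using that y elim \<open>H s y = h y\<close> by (simp add: D_def)
      qed
      then show ?case using elim by auto
    qed
  qed
  then have "AE y in lborel. \<forall>s::nat. y \<in> {0<..<1} \<longrightarrow> of_nat s * k y < h y" unfolding AE_all_countable by blast
  with k0 hfin have "AE y in lborel. y \<notin> {0<..<1::real}"
  proof eventually_elim
    case (elim y)
    show ?case
    proof
      assume y: "y \<in> {0<..<1}"
      then obtain t where "h y \<le> of_nat t * k y" using elim ennreal_archimedean by blast
      then show False using elim y by (auto simp: not_le[symmetric])
    qed
  qed
  then have "emeasure lborel {0<..<1::real} = 0"
    by (subst (asm) AE_iff_measurable[of "{0<..<1}"]) auto
  then show False by simp
qed

end

section \<open>Transfer of the two implications from densities to measures\<close>

theorem theorem1p3:
  fixes c :: real and N :: nat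
    and T :: "nat \<Rightarrow> real \<Rightarrow> real" and p r l :: "nat \<Rightarrow> real"
    and SigmaG SigmaB :: "nat set" and \<theta> rmax lmax :: real
    and \<mu> :: "real measure"
  assumes "0 < c" and "c < 1"
    and "\<forall>j\<in>{1..N}. good_map c (T j) \<or> bad_map c (T j)"
    and "SigmaG = {j\<in>{1..N}. good_map c (T j)}" and "SigmaG \<noteq> {}"
    and "SigmaB = {j\<in>{1..N}. bad_map c (T j)}" and "SigmaB \<noteq> {}"
    and "\<forall>g\<in>SigmaG. good_exponent c (T g) (r g)"
    and "\<forall>b\<in>SigmaB. bad_exponent c (T b) (l b)"
    and "\<forall>j\<in>{1..N}. 0 < p j" and "(\<Sum>j\<in>{1..N}. p j) = 1"
    and "acs_measure {1..N} p T \<mu>"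
    and "\<theta> = (\<Sum>b\<in>SigmaB. p b * l b)"
    and "rmax = Max (r ` SigmaG)" and "lmax = Max (l ` SigmaB)"
  shows "(finite_measure \<mu> \<longleftrightarrow> \<theta> < 1) \<and>
    (\<theta> < 1 \<longrightarrow>
      (\<exists>C>0. \<forall>A\<in>sets borel. A \<subseteq> {0..1} \<longrightarrow>
        measure \<mu> A \<le>
          C * (\<Sum>k. \<theta> ^ k * measure lborel A powr (inverse (lmax ^ k) * inverse rmax))))"
proof -
  interpret R: rmap c N T p r l SigmaG SigmaB by unfold_locales fact+
  have \<theta>: "\<theta> = R.theta" and rm: "rmax = R.rmax" and lm: "lmax = R.lmax"
    unfolding R.theta_def R.rmax_def R.lmax_def by (fact assms)+
  obtain h where h[measurable]: "h \<in> borel_measurable borel"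
    and em: "\<And>A. A \<in> sets borel \<Longrightarrow> A \<subseteq> {0..1} \<Longrightarrow> emeasure \<mu> A = (\<integral>\<^sup>+x\<in>A. h x \<partial>lborel)"
    and hfin: "AE x in lborel. x \<in> {0<..<1} \<longrightarrow> h x \<noteq> \<infinity>"
    and Ph: "AE y in lborel. y \<in> {0<..<1} \<longrightarrow> R.P h y = h y"
    and nz: "\<not> (AE y in lborel. y \<in> {0<..<1} \<longrightarrow> h y = 0)"
    using R.stationary_density[OF assms(12)] by blast
  have sp: "space \<mu> = {0..1}"
    using assms(12) unfolding acs_measure_def stationary_def borel_measure_on_unit_def by blast
  have AE01: "AE x in lborel. x \<in> {0..1} \<longrightarrow> x \<in> R.U"
  proof -
    have "AE x in lborel. x \<noteq> 0 \<and> x \<noteq> (1::real)" by (intro AE_conjI AE_lborel_singleton)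
    with R.AE_U show ?thesis by eventually_elim auto
  qed
  have emU: "emeasure \<mu> A = (\<integral>\<^sup>+x\<in>A \<inter> R.U. h x \<partial>lborel)" if "A \<in> sets borel" "A \<subseteq> {0..1}" for A
    unfolding em[OF that] using AE01
    by (intro nn_integral_cong_AE, eventually_elim) (use that in \<open>auto split: split_indicator\<close>)
  have dir1: "\<theta> < 1" if "finite_measure \<mu>"
  proof -
    have "emeasure \<mu> {0..1} \<noteq> \<infinity>" using finite_measure.emeasure_finite[OF that, of "{0..1}"] by simp
    then have "(\<integral>\<^sup>+x\<in>{0..1} \<inter> R.U. h x \<partial>lborel) \<noteq> \<infinity>" by (simp add: emU)
    moreover have "{0..1} \<inter> R.U = R.U" by (auto simp: R.U_alt)
    ultimately have "(\<integral>\<^sup>+x\<in>R.U. h x \<partial>lborel) \<noteq> \<infinity>" by simp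
    then show ?thesis using R.finite_imp_theta_less_1[OF h Ph nz] by (simp add: \<theta> R.theta_def)
  qed
  have dir2: "finite_measure \<mu> \<and> (\<exists>C>0. \<forall>A\<in>sets borel. A \<subseteq> {0..1} \<longrightarrow>
        measure \<mu> A \<le> C * (\<Sum>k. \<theta> ^ k * measure lborel A powr (inverse (lmax ^ k) * inverse rmax)))"
    if lt: "\<theta> < 1"
  proof -
    have \<theta>1: "R.theta < 1" using lt \<theta> by simp
    obtain k C where k: "k \<in> borel_measurable borel" "AE y in lborel. y \<in> {0<..<1} \<longrightarrow> R.P k y = k y"
      "AE y in lborel. y \<in> {0<..<1} \<longrightarrow> k y \<noteq> 0" "0 \<le> C" "(\<integral>\<^sup>+x\<in>R.U. k x \<partial>lborel) \<le> 1"
      "\<And>A. A \<in> sets borel \<Longrightarrow> A \<subseteq> R.U \<Longrightarrow> (\<integral>\<^sup>+x\<in>A. k x \<partial>lborel) \<le> ennreal (C * R.mass_series (measure lborel A))"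
      by (rule R.finite_invariant_density[OF \<theta>1]) blast
    have [measurable]: "k \<in> borel_measurable borel" by fact
    have kfin: "(\<integral>\<^sup>+x\<in>R.U. k x \<partial>lborel) \<noteq> \<infinity>" using k(5) by (auto simp: top_unique)
    obtain s :: nat where s: "AE y in lborel. y \<in> {0<..<1} \<longrightarrow> h y \<le> of_nat s * k y"
      by (rule R.density_dominated[OF k(1-3) kfin h Ph hfin]) blast
    have bound: "emeasure \<mu> A \<le> ennreal (real s * C * R.mass_series (measure lborel A))" if A[measurable]: "A \<in> sets borel" and A01: "A \<subseteq> {0..1}" for A
    proof -
      have AU: "A \<inter> R.U \<in> sets borel" by measurable
      have "emeasure \<mu> A \<le> (\<integral>\<^sup>+x. of_nat s * (k x * indicator (A \<inter> R.U) x) \<partial>lborel)"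
        unfolding emU[OF A A01] using s
        by (intro nn_integral_mono_AE, eventually_elim) (auto simp: R.U_alt split: split_indicator)
      also have "\<dots> = of_nat s * (\<integral>\<^sup>+x\<in>A \<inter> R.U. k x \<partial>lborel)" by (rule nn_integral_cmult) measurable
      also have "\<dots> \<le> of_nat s * ennreal (C * R.mass_series (measure lborel (A \<inter> R.U)))" by (intro mult_left_mono k(6)) auto
      also have "measure lborel (A \<inter> R.U) = measure lborel A"
        using AE01 A01 by (intro measure_eq_AE) (auto elim!: eventually_mono)
      also have "of_nat s * ennreal (C * R.mass_series (measure lborel A)) = ennreal (real s * C * R.mass_series (measure lborel A))"
        by (simp add: ennreal_of_nat_eq_real_of_nat ennreal_mult'[symmetric] mult.assoc)
      finally show ?thesis .
    qed
    have le1: "0 \<le> measure lborel A" "measure lborel A \<le> 1" if "A \<subseteq> {0..1::real}" for A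
    proof -
      have "emeasure lborel A \<le> emeasure lborel {0..1::real}" using that by (intro emeasure_mono) auto
      then show "measure lborel A \<le> 1" unfolding measure_def by (simp add: enn2real_leI)
    qed simp
    have fin: "finite_measure \<mu>"
    proof
      show "emeasure \<mu> (space \<mu>) \<noteq> \<infinity>" using bound[of "{0..1}"] unfolding sp by (auto simp: top_unique)
    qed
    have mass_series: "R.mass_series t = (\<Sum>k. \<theta> ^ k * t powr (inverse (lmax ^ k) * inverse rmax))" for t
      unfolding R.mass_series_def R.ex_def \<theta> rm lm by (simp add: divide_inverse mult.commute)
    \<comment> \<open>The constant has to be strictly positive, while \<open>s\<close> or
      \<open>C\<close> may be 0; hence the added 1.\<close>
    have "measure \<mu> A \<le> (real s * C + 1) * R.mass_series (measure lborel A)" if A: "A \<in> sets borel" "A \<subseteq> {0..1}" for A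
    proof -
      have H0: "0 \<le> R.mass_series (measure lborel A)" by (rule R.mass_series_nonneg[OF \<theta>1 le1[OF A(2)]])
      have "measure \<mu> A \<le> real s * C * R.mass_series (measure lborel A)"
        unfolding measure_def using bound[OF A] H0 k(4) by (intro enn2real_leI) (auto simp: measure_def)
      also have "\<dots> \<le> (real s * C + 1) * R.mass_series (measure lborel A)" using H0 by (intro mult_right_mono) auto
      finally show ?thesis .
    qed
    moreover have "0 < real s * C + 1" using k(4) by (simp add: add_nonneg_pos)
    ultimately show ?thesis using fin unfolding mass_series by blast
  qed
  show ?thesis using dir1 dir2 by blast
qed

end
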